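(* Let $A$ be a monomial $k$-algebra with CPS graph $\Gamma(A)$ and Yoneda algebra $E(A)=\operatorname{Ext}_A(k,k)$. If no pair of distinct circuits in $\Gamma(A)$ have a common vertex, then $\operatorname{GKdim}(E(A))$ is the maximal number of distinct circuits contained in any walk in $\Gamma(A)$. Otherwise, $\operatorname{GKdim}(E(A))=\infty$.
   Context: Let $k$ be a field, $s\in\mathbb N$, $V=\operatorname{span}_k\{x_1,\dots,x_s\}$, and $T(V)$ the tensor algebra, graded by tensor degree. A monomial is a pure tensor in the $x_i$ with coefficient $1$ (that is, a word in the $x_i$, including the empty word $1$). $\mathcal M$ denotes the monoid of all monomials. A monomial $k$-algebra is an algebra $A=T(V)/I$, where $I$ is a two-sided ideal generated by finitely many monomials, each of degree at least $2$; it is graded by the grading inherited from $T(V)$. CPS graph. For $m,w\in\mathcal M\setminus I$ with $w\otimes m\in I$, let $L(w,m)=w'$, where $w=w''\otimes w'$ with $w',w''\in\mathcal M$ and $w'$ is the suffix of minimal degree such that $w'\otimes m\in I$. For $m\in\mathcal M\setminus I$ let $\mathfrak A_m=\{w\in\mathcal M\setminus I: w\otimes m\in I,\ L(w,m)=w\}$. Let $\mathfrak G_0=\{x_1,\dots,x_s\}$, $\mathfrak G_i=\bigcup_{w\in\mathfrak G_{i-1}}\mathfrak A_w$ for $i\ge1$, and $\mathfrak G=\bigcup_{i\ge0}\mathfrak G_i$. The CPS graph $\Gamma(A)$ is the (finite) directed graph with vertex set $\mathfrak G$ and an edge $m_1\to m_2$ whenever $m_2\in\mathfrak A_{m_1}$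 (loops allowed). A walk is a finite or infinite sequence of vertices $v_0v_1v_2\cdots$ with each $v_i\to v_{i+1}$ an edge; a finite walk $v_0\cdots v_n$ has length $n$. A circuit of length $n\ge1$ is a walk $v_0\cdots v_n$ with $v_n=v_0$ and $v_0,\dots,v_{n-1}$ distinct. Circuits that differ only by the choice of starting vertex are regarded as the same. When counting the distinct circuits contained in a walk, multiplicity is ignored. Yoneda algebra. Let $k$ also denote the trivial left $A$-module $A/A_+$, where $A_+=\bigoplus_{i\ge1}A_i$. Then $E(A)=\bigoplus_{i\ge0}\operatorname{Ext}^i_A(k,k)$, a $k$-algebra under the Yoneda composition product. $\operatorname{GKdim}(E(A))$ denotes the Gelfand-Kirillov dimension of the $k$-algebra $E(A)$.
   Formalization: GKdim(E(A)) is taken as the graded growth limsup log_n(sum of dim Ext^i, i ≤ n); it equals the algebra's GK dimension if E(A) is finitely generated, but the standard one fails the claim in general: for k<a,b>/(aba) it is 0, the claim gives 1. *)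

theory Defs
  imports "HOL-Algebra.QuotRing" "HOL-Algebra.Module" "HOL-Library.Extended_Real" "HOL-Library.Liminf_Limsup"
    "HOL-Library.Sublist" Complex_Main
begin

section \<open>Algebras and left modules\<close>

text \<open>
  Records of type \<^typ>\<open>('r, 'v) module\<close> carry \<open>k\<close>-algebras (\<open>'r\<close> the ground field, given as a
  type of class \<^class>\<open>field\<close>) as well as left modules over a not necessarily commutative ring
  (\<open>'r\<close> the type of ring elements). In the latter case, and for plain \<open>k\<close>-vector spaces, the fields
  \<^const>\<open>mult\<close> and \<^const>\<open>one\<close> play no role.
  The library locale \<^locale>\<open>module\<close> is not usable since it demands a commutative ring.
\<close>

locale left_module = R?: ring R + M?: abelian_group M
  for R :: "('a, 'z) ring_scheme" (structure) and M :: "('a, 'b, 'y) module_scheme" (structure) +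
  assumes smult_closed:
      "\<lbrakk>a \<in> carrier R; x \<in> carrier M\<rbrakk> \<Longrightarrow> a \<odot>\<^bsub>M\<^esub> x \<in> carrier M"
    and smult_l_distr:
      "\<lbrakk>a \<in> carrier R; b \<in> carrier R; x \<in> carrier M\<rbrakk> \<Longrightarrow>
        (a \<oplus>\<^bsub>R\<^esub> b) \<odot>\<^bsub>M\<^esub> x = a \<odot>\<^bsub>M\<^esub> x \<oplus>\<^bsub>M\<^esub> b \<odot>\<^bsub>M\<^esub> x"
    and smult_r_distr:
      "\<lbrakk>a \<in> carrier R; x \<in> carrier M; y \<in> carrier M\<rbrakk> \<Longrightarrow>
        a \<odot>\<^bsub>M\<^esub> (x \<oplus>\<^bsub>M\<^esub> y) = a \<odot>\<^bsub>M\<^esub> x \<oplus>\<^bsub>M\<^esub> a \<odot>\<^bsub>M\<^esub> y"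
    and smult_assoc:
      "\<lbrakk>a \<in> carrier R; b \<in> carrier R; x \<in> carrier M\<rbrakk> \<Longrightarrow>
        (a \<otimes>\<^bsub>R\<^esub> b) \<odot>\<^bsub>M\<^esub> x = a \<odot>\<^bsub>M\<^esub> (b \<odot>\<^bsub>M\<^esub> x)"
    and smult_one:
      "x \<in> carrier M \<Longrightarrow> \<one>\<^bsub>R\<^esub> \<odot>\<^bsub>M\<^esub> x = x"

text \<open>
  The library quotient \<^const>\<open>FactRing\<close> together with the induced scalar action. It is used
  for algebras modulo two-sided ideals and for modules modulo submodules.
\<close>

definition quot_module :: "('r, 'v, 'z) module_scheme \<Rightarrow> 'v set \<Rightarrow> ('r, 'v set) module" where
  "quot_module M U =
    \<lparr>carrier = carrier (M Quot U), mult = mult (M Quot U), one = one (M Quot U),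
     zero = zero (M Quot U), add = add (M Quot U),
     smult = (\<lambda>c X. \<Union>x\<in>X. U +>\<^bsub>M\<^esub> (c \<odot>\<^bsub>M\<^esub> x))\<rparr>"

definition regular_module :: "('a, 'z) ring_scheme \<Rightarrow> ('a, 'a) module" where
  "regular_module R =
    \<lparr>carrier = carrier R, mult = mult R, one = one R, zero = zero R, add = add R,
     smult = mult R\<rparr>"

text \<open>Homomorphisms are extensional, so that equal maps on the carrier are equal functions.\<close>

definition lmod_hom ::
  "('a, 'z) ring_scheme \<Rightarrow> ('a, 'b, 'y) module_scheme \<Rightarrow> ('a, 'c, 'x) module_scheme
    \<Rightarrow> ('b \<Rightarrow> 'c) set" where
  "lmod_hom R M N =
    {f \<in> carrier M \<rightarrow>\<^sub>E carrier N.
      (\<forall>x\<in>carrier M. \<forall>y\<in>carrier M. f (x \<oplus>\<^bsub>M\<^esub> y) = f x \<oplus>\<^bsub>N\<^esub> f y) \<and>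
      (\<forall>a\<in>carrier R. \<forall>x\<in>carrier M. f (a \<odot>\<^bsub>M\<^esub> x) = a \<odot>\<^bsub>N\<^esub> f x)}"

definition free_lmod :: "('a, 'z) ring_scheme \<Rightarrow> 'i set \<Rightarrow> ('a, 'i \<Rightarrow> 'a) module" where
  "free_lmod R J =
    \<lparr>carrier = {f. (\<forall>j. f j \<in> carrier R) \<and> finite {j. f j \<noteq> \<zero>\<^bsub>R\<^esub>} \<and> {j. f j \<noteq> \<zero>\<^bsub>R\<^esub>} \<subseteq> J},
     mult = undefined, one = undefined,
     zero = (\<lambda>j. \<zero>\<^bsub>R\<^esub>), add = (\<lambda>f g j. f j \<oplus>\<^bsub>R\<^esub> g j), smult = (\<lambda>a f j. a \<otimes>\<^bsub>R\<^esub> f j)\<rparr>"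

text \<open>
  Direct summands of free modules. Restricting the index sets to the type of elements of \<open>P\<close> is no
  loss of generality: a projective \<open>P\<close> is a direct summand of the free module on \<^term>\<open>carrier P\<close>.
\<close>

definition projective_lmod :: "('a, 'z) ring_scheme \<Rightarrow> ('a, 'p, 'y) module_scheme \<Rightarrow> bool" where
  "projective_lmod R P \<longleftrightarrow> left_module R P \<and>
    (\<exists>J :: 'p set. \<exists>i \<in> lmod_hom R P (free_lmod R J). \<exists>r \<in> lmod_hom R (free_lmod R J) P.
      \<forall>x\<in>carrier P. r (i x) = x)"


section \<open>Ext and the Yoneda algebra\<close>

record ('a, 'p, 'm) resolution =
  obj :: "nat \<Rightarrow> ('a, 'p) module"
  diff :: "nat \<Rightarrow> 'p \<Rightarrow> 'p"  \<comment> \<open>\<open>diff X n\<close> maps degree \<open>n + 1\<close> to degree \<open>n\<close>\<close>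
  aug :: "'p \<Rightarrow> 'm"

definition projective_resolution ::
  "('a, 'z) ring_scheme \<Rightarrow> ('a, 'm, 'y) module_scheme \<Rightarrow> ('a, 'p, 'm) resolution \<Rightarrow> bool" where
  "projective_resolution R M X \<longleftrightarrow>
    (\<forall>n. projective_lmod R (obj X n)) \<and>
    (\<forall>n. diff X n \<in> lmod_hom R (obj X (Suc n)) (obj X n)) \<and>
    aug X \<in> lmod_hom R (obj X 0) M \<and>
    aug X ` carrier (obj X 0) = carrier M \<and>
    diff X 0 ` carrier (obj X 1) = {x \<in> carrier (obj X 0). aug X x = \<zero>\<^bsub>M\<^esub>} \<and>
    (\<forall>n. diff X (Suc n) ` carrier (obj X (Suc (Suc n))) =
      {x \<in> carrier (obj X (Suc n)). diff X n x = \<zero>\<^bsub>obj X n\<^esub>})"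

text \<open>For a \<open>k\<close>-algebra \<open>A\<close>, the scalar \<open>c\<close> acts on an \<open>A\<close>-module as \<open>c \<cdot> 1\<^sub>A\<close>.\<close>

definition hom_space ::
  "('k, 'a, 'z) module_scheme \<Rightarrow> ('a, 'b, 'y) module_scheme \<Rightarrow> ('a, 'c, 'x) module_scheme
    \<Rightarrow> ('k, 'b \<Rightarrow> 'c) module" where
  "hom_space A M N =
    \<lparr>carrier = lmod_hom A M N, mult = undefined, one = undefined,
     zero = (\<lambda>x\<in>carrier M. \<zero>\<^bsub>N\<^esub>),
     add = (\<lambda>f g. \<lambda>x\<in>carrier M. f x \<oplus>\<^bsub>N\<^esub> g x),
     smult = (\<lambda>c f. \<lambda>x\<in>carrier M. (c \<odot>\<^bsub>A\<^esub> \<one>\<^bsub>A\<^esub>) \<odot>\<^bsub>N\<^esub> f x)\<rparr>"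

definition cocycles ::
  "('k, 'a, 'z) module_scheme \<Rightarrow> ('a, 'p, 'm) resolution \<Rightarrow> ('a, 'c, 'x) module_scheme
    \<Rightarrow> nat \<Rightarrow> ('p \<Rightarrow> 'c) set" where
  "cocycles A X N n =
    {f \<in> lmod_hom A (obj X n) N. \<forall>x\<in>carrier (obj X (Suc n)). f (diff X n x) = \<zero>\<^bsub>N\<^esub>}"

primrec coboundaries ::
  "('k, 'a, 'z) module_scheme \<Rightarrow> ('a, 'p, 'm) resolution \<Rightarrow> ('a, 'c, 'x) module_scheme
    \<Rightarrow> nat \<Rightarrow> ('p \<Rightarrow> 'c) set" where
  "coboundaries A X N 0 = {\<lambda>x\<in>carrier (obj X 0). \<zero>\<^bsub>N\<^esub>}"
| "coboundaries A X N (Suc n) =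
    (\<lambda>h. compose (carrier (obj X (Suc n))) h (diff X n)) ` lmod_hom A (obj X n) N"

text \<open>\<open>Ext\<^sup>n\<close> from \<open>M\<close> to \<open>N\<close> as a \<open>k\<close>-space, computed from a projective resolution \<open>X\<close> of \<open>M\<close>.\<close>

definition Ext ::
  "('k, 'a, 'z) module_scheme \<Rightarrow> ('a, 'p, 'm) resolution \<Rightarrow> ('a, 'c, 'x) module_scheme
    \<Rightarrow> nat \<Rightarrow> ('k, ('p \<Rightarrow> 'c) set) module" where
  "Ext A X N n =
    quot_module ((hom_space A (obj X n) N)\<lparr>carrier := cocycles A X N n\<rparr>) (coboundaries A X N n)"

text \<open>
  Chain maps \<open>G i : X\<^bsub>n+i\<^esub> \<rightarrow> X\<^bsub>i\<^esub>\<close> covering a map \<open>g : X\<^bsub>n\<^esub> \<rightarrow> M\<close>. No signs are used; the customary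
  ones change the product of degrees \<open>m, n\<close> by a factor \<open>(-1)\<^bsup>mn\<^esup>\<close>,
  which gives an isomorphic algebra.
\<close>

definition chain_lifts ::
  "('k, 'a, 'z) module_scheme \<Rightarrow> ('a, 'p, 'm) resolution \<Rightarrow> nat \<Rightarrow> ('p \<Rightarrow> 'm)
    \<Rightarrow> (nat \<Rightarrow> 'p \<Rightarrow> 'p) set" where
  "chain_lifts A X n g =
    {G. (\<forall>i. G i \<in> lmod_hom A (obj X (n + i)) (obj X i)) \<and>
        (\<forall>x\<in>carrier (obj X n). aug X (G 0 x) = g x) \<and>
        (\<forall>i. \<forall>x\<in>carrier (obj X (Suc (n + i))).
          diff X i (G (Suc i) x) = G i (diff X (n + i) x))}"

text \<open>
  The composition product \<open>Ext\<^sup>m(M,M) \<times> Ext\<^sup>n(M,M) \<rightarrow> Ext\<^sup>m\<^sup>+\<^sup>n(M,M)\<close>: lift the second cocycle to a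
  chain map and compose with the first. As in \<^const>\<open>rcoset_mult\<close>, the union runs over all
  representatives and lifts, which all yield the same class.
\<close>

definition yoneda_prod ::
  "('k, 'a, 'z) module_scheme \<Rightarrow> ('a, 'm, 'y) module_scheme \<Rightarrow> ('a, 'p, 'm) resolution
    \<Rightarrow> nat \<Rightarrow> nat \<Rightarrow> ('p \<Rightarrow> 'm) set \<Rightarrow> ('p \<Rightarrow> 'm) set \<Rightarrow> ('p \<Rightarrow> 'm) set" where
  "yoneda_prod A M X m n \<alpha> \<beta> =
    (\<Union>f\<in>\<alpha>. \<Union>g\<in>\<beta>. \<Union>G\<in>chain_lifts A X n g.
      coboundaries A X M (m + n) +>\<^bsub>hom_space A (obj X (m + n)) M\<^esub>
        compose (carrier (obj X (m + n))) f (G m))"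

text \<open>
  The \<open>k\<close>-algebra \<open>\<Oplus>\<^sub>n Ext\<^sup>n(M,M)\<close>; an element is the family of its homogeneous components.
\<close>

definition yoneda_algebra ::
  "('k, 'a, 'z) module_scheme \<Rightarrow> ('a, 'm, 'y) module_scheme \<Rightarrow> ('a, 'p, 'm) resolution
    \<Rightarrow> ('k, nat \<Rightarrow> ('p \<Rightarrow> 'm) set) module" where
  "yoneda_algebra A M X =
    \<lparr>carrier = {\<xi>. (\<forall>n. \<xi> n \<in> carrier (Ext A X M n)) \<and> finite {n. \<xi> n \<noteq> \<zero>\<^bsub>Ext A X M n\<^esub>}},
     mult = (\<lambda>\<xi> \<eta> n. finsum (Ext A X M n)
       (\<lambda>m. yoneda_prod A M X m (n - m) (\<xi> m) (\<eta> (n - m))) {..n}),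
     one = (\<lambda>n. if n = 0
       then coboundaries A X M 0 +>\<^bsub>hom_space A (obj X 0) M\<^esub> aug X else \<zero>\<^bsub>Ext A X M n\<^esub>),
     zero = (\<lambda>n. \<zero>\<^bsub>Ext A X M n\<^esub>),
     add = (\<lambda>\<xi> \<eta> n. \<xi> n \<oplus>\<^bsub>Ext A X M n\<^esub> \<eta> n),
     smult = (\<lambda>c \<xi> n. c \<odot>\<^bsub>Ext A X M n\<^esub> \<xi> n)\<rparr>"

definition yoneda_component ::
  "('k, 'a, 'z) module_scheme \<Rightarrow> ('a, 'm, 'y) module_scheme \<Rightarrow> ('a, 'p, 'm) resolution
    \<Rightarrow> nat \<Rightarrow> (nat \<Rightarrow> ('p \<Rightarrow> 'm) set) set" where
  "yoneda_component A M X n =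
    {\<xi> \<in> carrier (yoneda_algebra A M X). \<forall>m. m \<noteq> n \<longrightarrow> \<xi> m = \<zero>\<^bsub>Ext A X M m\<^esub>}"


section \<open>Gelfand-Kirillov dimension\<close>

definition lin_indep :: "('k::field, 'v, 'z) module_scheme \<Rightarrow> 'v set \<Rightarrow> bool" where
  "lin_indep V B \<longleftrightarrow> finite B \<and> B \<subseteq> carrier V \<and>
    (\<forall>c. finsum V (\<lambda>x. c x \<odot>\<^bsub>V\<^esub> x) B = \<zero>\<^bsub>V\<^esub> \<longrightarrow> (\<forall>x\<in>B. c x = 0))"

definition vdim :: "('k::field, 'v, 'z) module_scheme \<Rightarrow> 'v set \<Rightarrow> enat" where
  "vdim V S = (SUP B\<in>{B. B \<subseteq> S \<and> lin_indep V B}. enat (card B))"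

definition elog :: "nat \<Rightarrow> enat \<Rightarrow> ereal" where
  "elog n d = (case d of enat m \<Rightarrow> ereal (log (real n) (real m)) | \<infinity> \<Rightarrow> \<infinity>)"

text \<open>
  The Gelfand-Kirillov dimension of a graded \<open>k\<close>-algebra \<open>E\<close> with homogeneous components
  \<open>C 0, C 1, \<dots>\<close>, in the form used for graded algebras:
  \<open>limsup log\<^sub>n (dim C 0 + \<dots> + dim C n)\<close>.

  For finitely generated \<open>E\<close> with finite-dimensional components this is the supremum over
  finite-dimensional subspaces \<open>W\<close> of \<open>limsup log\<^sub>n dim (W\<^sup>0 + \<dots> + W\<^sup>n)\<close>. Yoneda
  algebras of monomial algebras need not be finitely generated, and then the two differ: for
  \<open>A = k\<langle>a,b\<rangle>/(aba)\<close>, the space \<open>Ext\<^sup>n(k,k)\<close> (\<open>n \<ge> 2\<close>) is one-dimensional of internal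
  degree \<open>2n - 1\<close>, and \<open>Ext\<^sup>1(k,k)\<close> has internal degree 1, so all products of elements of positive
  degree vanish and the supremum is 0; but the CPS graph contains the loop \<open>ab \<rightarrow> ab\<close>, and the
  growth of the graded pieces is 1.
\<close>

definition GKdim :: "('k::field, 'v, 'z) module_scheme \<Rightarrow> (nat \<Rightarrow> 'v set) \<Rightarrow> ereal" where
  "GKdim E C = limsup (\<lambda>n. elog n (\<Sum>i\<le>n. vdim E (C i)))"


section \<open>Monomial algebras\<close>

text \<open>
  The tensor algebra on \<open>x\<^sub>0, \<dots>, x\<^bsub>s-1\<^esub>\<close>, in its basis of words: monomials are lists of letters
  below \<open>s\<close>, the tensor product of monomials is concatenation, and an element is its
  finitely supported coefficient function.
\<close>

abbreviation words :: "nat \<Rightarrow> nat list set" where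
  "words s \<equiv> lists {..<s}"

definition tensor_algebra :: "nat \<Rightarrow> ('k::field, nat list \<Rightarrow> 'k) module" where
  "tensor_algebra s =
    \<lparr>carrier = {f. finite {w. f w \<noteq> 0} \<and> {w. f w \<noteq> 0} \<subseteq> words s},
     mult = (\<lambda>f g w. \<Sum>i\<le>length w. f (take i w) * g (drop i w)),
     one = (\<lambda>w. if w = [] then 1 else 0),
     zero = (\<lambda>w. 0),
     add = (\<lambda>f g w. f w + g w),
     smult = (\<lambda>c f w. c * f w)\<rparr>"

definition mon :: "nat list \<Rightarrow> nat list \<Rightarrow> 'k::field" where
  "mon w = (\<lambda>u. if u = w then 1 else 0)"

definition monomial_ideal :: "nat \<Rightarrow> (nat list \<Rightarrow> 'k::field) set \<Rightarrow> bool" where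
  "monomial_ideal s I \<longleftrightarrow>
    (\<exists>R \<subseteq> words s. finite R \<and> (\<forall>r\<in>R. length r \<ge> 2) \<and> I = Idl\<^bsub>tensor_algebra s\<^esub> (mon ` R))"

definition monomial_algebra ::
  "nat \<Rightarrow> (nat list \<Rightarrow> 'k::field) set \<Rightarrow> ('k, (nat list \<Rightarrow> 'k) set) module" where
  "monomial_algebra s I = quot_module (tensor_algebra s) I"

text \<open>\<open>A\<^sub>+\<close> is the image of the span of the nonempty words.\<close>

definition aug_ideal :: "nat \<Rightarrow> (nat list \<Rightarrow> 'k::field) set \<Rightarrow> (nat list \<Rightarrow> 'k) set set" where
  "aug_ideal s I =
    (\<lambda>f. I +>\<^bsub>tensor_algebra s\<^esub> f) ` {f \<in> carrier (tensor_algebra s). f [] = 0}"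

definition trivial_module ::
  "nat \<Rightarrow> (nat list \<Rightarrow> 'k::field) set
    \<Rightarrow> ((nat list \<Rightarrow> 'k) set, (nat list \<Rightarrow> 'k) set set) module" where
  "trivial_module s I = quot_module (regular_module (monomial_algebra s I)) (aug_ideal s I)"


section \<open>The CPS graph\<close>

definition cps_L :: "(nat list \<Rightarrow> 'k::field) set \<Rightarrow> nat list \<Rightarrow> nat list \<Rightarrow> nat list" where
  "cps_L I w m = (ARG_MIN length w'. suffix w' w \<and> mon (w' @ m) \<in> I)"

definition cps_A :: "nat \<Rightarrow> (nat list \<Rightarrow> 'k::field) set \<Rightarrow> nat list \<Rightarrow> nat list set" where
  "cps_A s I m = {w \<in> words s. mon w \<notin> I \<and> mon (w @ m) \<in> I \<and> cps_L I w m = w}"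

primrec cps_G :: "nat \<Rightarrow> (nat list \<Rightarrow> 'k::field) set \<Rightarrow> nat \<Rightarrow> nat list set" where
  "cps_G s I 0 = {[i] | i. i < s}"
| "cps_G s I (Suc n) = (\<Union>w\<in>cps_G s I n. cps_A s I w)"

definition cps_vertices :: "nat \<Rightarrow> (nat list \<Rightarrow> 'k::field) set \<Rightarrow> nat list set" where
  "cps_vertices s I = (\<Union>n. cps_G s I n)"

definition cps_edges :: "nat \<Rightarrow> (nat list \<Rightarrow> 'k::field) set \<Rightarrow> (nat list \<times> nat list) set" where
  "cps_edges s I = {(m1, m2). m1 \<in> cps_vertices s I \<and> m2 \<in> cps_A s I m1}"


section \<open>Walks and circuits\<close>

text \<open>
  \<open>walk V E N v\<close>: the vertices \<open>v i\<close> with \<open>i \<le> N\<close> form a walk of length \<open>N\<close>, infinite if \<open>N = \<infinity>\<close>.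
  The values of \<open>v\<close> beyond \<open>N\<close> are irrelevant.
\<close>

definition walk :: "'v set \<Rightarrow> ('v \<times> 'v) set \<Rightarrow> enat \<Rightarrow> (nat \<Rightarrow> 'v) \<Rightarrow> bool" where
  "walk V E N v \<longleftrightarrow>
    (\<forall>i. enat i \<le> N \<longrightarrow> v i \<in> V) \<and> (\<forall>i. enat i < N \<longrightarrow> (v i, v (Suc i)) \<in> E)"

definition circuit :: "'v set \<Rightarrow> ('v \<times> 'v) set \<Rightarrow> nat \<Rightarrow> (nat \<Rightarrow> 'v) \<Rightarrow> bool" where
  "circuit V E n v \<longleftrightarrow> n \<ge> 1 \<and> walk V E (enat n) v \<and> v n = v 0 \<and> inj_on v {..<n}"

text \<open>
  The circuit \<open>v 0, \<dots>, v n\<close> up to choice of the starting vertex: the set of all rotations of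
  \<open>[v 0, \<dots>, v (n - 1)]\<close>.
\<close>

definition circuit_class :: "nat \<Rightarrow> (nat \<Rightarrow> 'v) \<Rightarrow> 'v list set" where
  "circuit_class n v = {rotate j (map v [0..<n]) | j. True}"

definition circuits :: "'v set \<Rightarrow> ('v \<times> 'v) set \<Rightarrow> 'v list set set" where
  "circuits V E = {circuit_class n v | n v. circuit V E n v}"

definition class_vertices :: "'v list set \<Rightarrow> 'v set" where
  "class_vertices c = (\<Union>xs\<in>c. set xs)"

definition circuits_in_walk ::
  "'v set \<Rightarrow> ('v \<times> 'v) set \<Rightarrow> enat \<Rightarrow> (nat \<Rightarrow> 'v) \<Rightarrow> 'v list set set" where
  "circuits_in_walk V E N v =
    {circuit_class n (\<lambda>j. v (i + j)) | i n. enat (i + n) \<le> N \<and> circuit V E n (\<lambda>j. v (i + j))}"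

definition circuits_disjoint :: "'v set \<Rightarrow> ('v \<times> 'v) set \<Rightarrow> bool" where
  "circuits_disjoint V E \<longleftrightarrow>
    (\<forall>c\<in>circuits V E. \<forall>c'\<in>circuits V E. c \<noteq> c' \<longrightarrow> class_vertices c \<inter> class_vertices c' = {})"

text \<open>
  For nonempty finite sets of numbers (the case of a finite nonempty graph)
  \<^const>\<open>Sup\<close> on \<^typ>\<open>nat\<close> is \<^const>\<open>Max\<close>; the graph without vertices gets the value 0.
\<close>

definition max_circuits_in_walk :: "'v set \<Rightarrow> ('v \<times> 'v) set \<Rightarrow> nat" where
  "max_circuits_in_walk V E = Sup {card (circuits_in_walk V E N v) | N v. walk V E N v}"

end

theory Submission
  imports Defs "HOL-Real_Asymp.Real_Asymp"
begin

text \<open>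
  The left annihilator of a nonzero monomial \<open>m\<close> of \<open>A\<close> is spanned by the words killing \<open>m\<close>; each of
  them has a unique shortest suffix killing \<open>m\<close>, so the annihilator is the direct sum of the left ideals
  \<open>A w\<close> with \<open>m \<rightarrow> w\<close> an edge of the CPS graph. Splicing these presentations gives a free resolution of
  \<open>k\<close> whose generators in degree \<open>n + 1\<close> are the walks of length \<open>n\<close> starting at a letter and whose
  differential maps generators into \<open>A\<^sub>+\<close> times generators. It is therefore minimal, and comparing it with
  the given resolution shows that \<open>Ext\<^sup>n\<^sup>+\<^sup>1\<close> has a basis indexed by these walks.

  It remains to count walks. If two circuits share a vertex, then some vertex has two different first
  steps from which one can return, and the number of walks grows exponentially. Otherwise every strong
  component is a single vertex or a circuit, and a walk is determined by the times at which it leaves the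
  circuits it meets; so the number of walks of length at most \<open>n\<close> grows like \<open>n\<^sup>d\<close>,
  where \<open>d\<close> is the maximal number of circuits on one walk.
\<close>

section \<open>Modules and resolutions\<close>

text \<open>The resolution \<open>X\<close> in the statement is arbitrary, so nothing about its
  modules can be counted. The comparison map from the minimal resolution is therefore evaluated at
  the free generators: their images in \<open>X\<close> are test points, and the values of a cocycle
  there are coordinates on Ext, because every homomorphism from the minimal resolution to k kills
  boundaries. For the count, disjointness of circuits is replaced by a local condition,
  \<open>usucc\<close>: at most one edge out of each vertex can be continued to a walk back. The two
  bounds then have different shapes. From above, a walk is followed from a strong component to the
  vertices just outside it, and each cyclic component costs one factor n. From below, a circuit
  offers at each lap the choice between another lap and leaving; this is Pascal's recursion, so a
  binomial coefficient bounds the count. Ext sees only walks that start at letters, while circuits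
  may lie anywhere; but every vertex is reachable from a letter, and a bounded shift of the length
  does not change the exponent.\<close>

lemma (in left_module) smult_zero_right:
  assumes "a \<in> carrier R" shows "a \<odot>\<^bsub>M\<^esub> \<zero>\<^bsub>M\<^esub> = \<zero>\<^bsub>M\<^esub>"
proof -
  have "a \<odot>\<^bsub>M\<^esub> \<zero>\<^bsub>M\<^esub> \<oplus>\<^bsub>M\<^esub> a \<odot>\<^bsub>M\<^esub> \<zero>\<^bsub>M\<^esub> = a \<odot>\<^bsub>M\<^esub> \<zero>\<^bsub>M\<^esub>"
    using smult_r_distr[of a "\<zero>\<^bsub>M\<^esub>" "\<zero>\<^bsub>M\<^esub>"] assms by simp
  then show ?thesis using assms smult_closed by (metis M.add.l_cancel_one' M.zero_closed)
qed

lemma (in left_module) smult_zero_left: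
  assumes "x \<in> carrier M" shows "\<zero>\<^bsub>R\<^esub> \<odot>\<^bsub>M\<^esub> x = \<zero>\<^bsub>M\<^esub>"
proof -
  have "\<zero>\<^bsub>R\<^esub> \<odot>\<^bsub>M\<^esub> x \<oplus>\<^bsub>M\<^esub> \<zero>\<^bsub>R\<^esub> \<odot>\<^bsub>M\<^esub> x = \<zero>\<^bsub>R\<^esub> \<odot>\<^bsub>M\<^esub> x"
    using smult_l_distr[of "\<zero>\<^bsub>R\<^esub>" "\<zero>\<^bsub>R\<^esub>" x] assms by simp
  then show ?thesis using assms smult_closed by (metis M.add.l_cancel_one' R.zero_closed)
qed

lemma (in left_module) smult_minus:
  assumes "a \<in> carrier R" "x \<in> carrier M" shows "a \<odot>\<^bsub>M\<^esub> (\<ominus>\<^bsub>M\<^esub> x) = \<ominus>\<^bsub>M\<^esub> (a \<odot>\<^bsub>M\<^esub> x)"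
proof -
  have "a \<odot>\<^bsub>M\<^esub> (\<ominus>\<^bsub>M\<^esub> x) \<oplus>\<^bsub>M\<^esub> a \<odot>\<^bsub>M\<^esub> x = \<zero>\<^bsub>M\<^esub>"
    using smult_r_distr[of a "\<ominus>\<^bsub>M\<^esub> x" x] assms smult_zero_right by (simp add: M.l_neg)
  then show ?thesis using assms smult_closed by (metis M.a_inv_closed M.minus_equality)
qed

lemma (in left_module) finsum_smult:
  assumes "finite S" "a \<in> carrier R" "f \<in> S \<rightarrow> carrier M"
  shows "a \<odot>\<^bsub>M\<^esub> finsum M f S = finsum M (\<lambda>i. a \<odot>\<^bsub>M\<^esub> f i) S"
  using assms(1,3)
proof (induction S)
  case (insert i S)
  then have "f i \<in> carrier M" "f \<in> S \<rightarrow> carrier M" "finsum M f S \<in> carrier M"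
    by auto
  with insert show ?case
    using assms(2) by (auto simp: smult_r_distr Pi_iff smult_closed)
qed (simp add: smult_zero_right assms)

section \<open>Homomorphisms of left modules\<close>

lemma lmod_homD:
  assumes "f \<in> lmod_hom R M N"
  shows "x \<in> carrier M \<Longrightarrow> f x \<in> carrier N"
    and "x \<in> carrier M \<Longrightarrow> y \<in> carrier M \<Longrightarrow> f (x \<oplus>\<^bsub>M\<^esub> y) = f x \<oplus>\<^bsub>N\<^esub> f y"
    and "a \<in> carrier R \<Longrightarrow> x \<in> carrier M \<Longrightarrow> f (a \<odot>\<^bsub>M\<^esub> x) = a \<odot>\<^bsub>N\<^esub> f x"
    and "f \<in> extensional (carrier M)"
  using assms unfolding lmod_hom_def by (auto simp: PiE_iff)

text \<open>Homomorphisms are extensional, so every map constructed below enters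
  \<open>lmod_hom\<close> as a restriction to the carrier.\<close>

lemma lmod_hom_restrictI:
  assumes "left_module R M"
    and "\<And>x. x \<in> carrier M \<Longrightarrow> f x \<in> carrier N"
    and "\<And>x y. x \<in> carrier M \<Longrightarrow> y \<in> carrier M \<Longrightarrow> f (x \<oplus>\<^bsub>M\<^esub> y) = f x \<oplus>\<^bsub>N\<^esub> f y"
    and "\<And>a x. a \<in> carrier R \<Longrightarrow> x \<in> carrier M \<Longrightarrow> f (a \<odot>\<^bsub>M\<^esub> x) = a \<odot>\<^bsub>N\<^esub> f x"
  shows "restrict f (carrier M) \<in> lmod_hom R M N"
proof -
  interpret left_module R M by fact
  show ?thesis unfolding lmod_hom_def using assms(2-4) by (auto simp: smult_closed)
qed

lemma lmod_hom_zero: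
  assumes "left_module R M" "left_module R N" "f \<in> lmod_hom R M N"
  shows "f \<zero>\<^bsub>M\<^esub> = \<zero>\<^bsub>N\<^esub>"
proof -
  interpret M: left_module R M by fact
  interpret N: left_module R N by fact
  have "f \<zero>\<^bsub>M\<^esub> \<oplus>\<^bsub>N\<^esub> f \<zero>\<^bsub>M\<^esub> = f \<zero>\<^bsub>M\<^esub>" "f \<zero>\<^bsub>M\<^esub> \<in> carrier N"
    using lmod_homD[OF assms(3)] by (metis M.M.l_zero M.M.zero_closed, simp)
  then show ?thesis by (metis N.M.add.l_cancel_one')
qed

lemma lmod_hom_minus:
  assumes "left_module R M" "left_module R N" "f \<in> lmod_hom R M N"
    and "x \<in> carrier M" "y \<in> carrier M"
  shows "f (x \<ominus>\<^bsub>M\<^esub> y) = f x \<ominus>\<^bsub>N\<^esub> f y"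
proof -
  interpret M: left_module R M by fact
  interpret N: left_module R N by fact
  have "f (\<ominus>\<^bsub>M\<^esub> y) \<oplus>\<^bsub>N\<^esub> f y = f (\<ominus>\<^bsub>M\<^esub> y \<oplus>\<^bsub>M\<^esub> y)"
    using assms(5) lmod_homD(2)[OF assms(3)] by simp
  also have "\<dots> = \<zero>\<^bsub>N\<^esub>"
    using assms(5) lmod_hom_zero[OF assms(1-3)] by (simp add: M.M.l_neg)
  finally have "f (\<ominus>\<^bsub>M\<^esub> y) = \<ominus>\<^bsub>N\<^esub> f y"
    using lmod_homD(1)[OF assms(3)] assms(5) by (metis M.M.a_inv_closed N.M.minus_equality)
  then show ?thesis using assms(4,5) lmod_homD(2)[OF assms(3)]
    by (simp add: a_minus_def)
qed

lemma lmod_hom_compose: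
  assumes "left_module R M" "f \<in> lmod_hom R M N" "g \<in> lmod_hom R N P"
  shows "(\<lambda>x\<in>carrier M. g (f x)) \<in> lmod_hom R M P"
  using lmod_homD[OF assms(2)] lmod_homD[OF assms(3)]
  by (intro lmod_hom_restrictI assms) auto

lemma lmod_hom_id: "left_module R M \<Longrightarrow> (\<lambda>x\<in>carrier M. x) \<in> lmod_hom R M M"
  by (rule lmod_hom_restrictI) simp_all

lemma lmod_hom_diff:
  assumes "left_module R M" "left_module R N" "f \<in> lmod_hom R M N" "g \<in> lmod_hom R M N"
  shows "(\<lambda>x\<in>carrier M. f x \<ominus>\<^bsub>N\<^esub> g x) \<in> lmod_hom R M N"
proof -
  interpret N: left_module R N by fact
  note f = lmod_homD[OF assms(3)] and g = lmod_homD[OF assms(4)]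
  show ?thesis
  proof (rule lmod_hom_restrictI)
    fix x y assume "x \<in> carrier M" "y \<in> carrier M"
    then show "f (x \<oplus>\<^bsub>M\<^esub> y) \<ominus>\<^bsub>N\<^esub> g (x \<oplus>\<^bsub>M\<^esub> y) = f x \<ominus>\<^bsub>N\<^esub> g x \<oplus>\<^bsub>N\<^esub> (f y \<ominus>\<^bsub>N\<^esub> g y)"
      using f(1)[of x] f(1)[of y] g(1)[of x] g(1)[of y] f(2)[of x y] g(2)[of x y]
      by (simp add: a_minus_def N.M.minus_add N.M.a_ac)
  next
    fix a x assume "a \<in> carrier R" "x \<in> carrier M"
    then show "f (a \<odot>\<^bsub>M\<^esub> x) \<ominus>\<^bsub>N\<^esub> g (a \<odot>\<^bsub>M\<^esub> x) = a \<odot>\<^bsub>N\<^esub> (f x \<ominus>\<^bsub>N\<^esub> g x)"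
      using f(1)[of x] g(1)[of x] f(3)[of a x] g(3)[of a x]
      by (simp add: a_minus_def N.smult_minus N.smult_r_distr)
  qed (use assms(1) f g in auto)
qed

subsection \<open>Free and projective modules\<close>

lemma left_module_free_lmod:
  assumes "ring R" shows "left_module R (free_lmod R J)"
proof -
  interpret ring R by fact
  have supp: "{j. f j \<oplus>\<^bsub>R\<^esub> g j \<noteq> \<zero>\<^bsub>R\<^esub>} \<subseteq> {j. f j \<noteq> \<zero>\<^bsub>R\<^esub>} \<union> {j. g j \<noteq> \<zero>\<^bsub>R\<^esub>}" for f g :: "'e \<Rightarrow> 'a"
    by auto
  have add: "(\<lambda>j. f j \<oplus>\<^bsub>R\<^esub> g j) \<in> carrier (free_lmod R J)"
    if "f \<in> carrier (free_lmod R J)" "g \<in> carrier (free_lmod R J)" for f g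
    using that finite_subset[OF supp[of f g]] supp[of f g]
    unfolding free_lmod_def by auto
  have neg: "(\<lambda>j. \<ominus>\<^bsub>R\<^esub> f j) \<in> carrier (free_lmod R J)"
    if "f \<in> carrier (free_lmod R J)" for f
  proof -
    have "{j. \<ominus>\<^bsub>R\<^esub> f j \<noteq> \<zero>\<^bsub>R\<^esub>} \<subseteq> {j. f j \<noteq> \<zero>\<^bsub>R\<^esub>}" by auto
    then show ?thesis using that finite_subset[of "{j. \<ominus>\<^bsub>R\<^esub> f j \<noteq> \<zero>\<^bsub>R\<^esub>}"]
      unfolding free_lmod_def by auto
  qed
  have smult: "(\<lambda>j. a \<otimes>\<^bsub>R\<^esub> f j) \<in> carrier (free_lmod R J)"
    if "f \<in> carrier (free_lmod R J)" "a \<in> carrier R" for f a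
  proof -
    have "{j. a \<otimes>\<^bsub>R\<^esub> f j \<noteq> \<zero>\<^bsub>R\<^esub>} \<subseteq> {j. f j \<noteq> \<zero>\<^bsub>R\<^esub>}" using that by auto
    then show ?thesis using that finite_subset[of "{j. a \<otimes>\<^bsub>R\<^esub> f j \<noteq> \<zero>\<^bsub>R\<^esub>}"]
      unfolding free_lmod_def by auto
  qed
  have ag: "abelian_group (free_lmod R J)"
  proof (rule abelian_groupI)
    fix f assume f: "f \<in> carrier (free_lmod R J)"
    have "(\<lambda>j. \<ominus>\<^bsub>R\<^esub> f j) \<oplus>\<^bsub>free_lmod R J\<^esub> f = \<zero>\<^bsub>free_lmod R J\<^esub>"
      using f by (auto simp: free_lmod_def l_neg)
    then show "\<exists>y\<in>carrier (free_lmod R J). y \<oplus>\<^bsub>free_lmod R J\<^esub> f = \<zero>\<^bsub>free_lmod R J\<^esub>"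
      using neg[OF f] by blast
  next
    fix f g assume "f \<in> carrier (free_lmod R J)" "g \<in> carrier (free_lmod R J)"
    then show "f \<oplus>\<^bsub>free_lmod R J\<^esub> g \<in> carrier (free_lmod R J)"
      using add[of f g] by (simp add: free_lmod_def)
  qed (auto simp: free_lmod_def a_ac)
  interpret F: abelian_group "free_lmod R J" by (rule ag)
  show ?thesis
  proof unfold_locales
    fix a f assume "a \<in> carrier R" "f \<in> carrier (free_lmod R J)"
    then show "a \<odot>\<^bsub>free_lmod R J\<^esub> f \<in> carrier (free_lmod R J)"
      using smult[of f a] by (simp add: free_lmod_def)
  qed (auto simp: free_lmod_def l_distr r_distr m_assoc)
qed

definition unit_vec :: "('a, 'z) ring_scheme \<Rightarrow> 'i \<Rightarrow> 'i \<Rightarrow> 'a" where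
  "unit_vec R j = (\<lambda>i. if i = j then \<one>\<^bsub>R\<^esub> else \<zero>\<^bsub>R\<^esub>)"

lemma unit_vec_carrier: "ring R \<Longrightarrow> j \<in> J \<Longrightarrow> unit_vec R j \<in> carrier (free_lmod R J)"
proof -
  assume "ring R" "j \<in> J"
  then interpret ring R by simp
  have "{i. (if i = j then \<one>\<^bsub>R\<^esub> else \<zero>\<^bsub>R\<^esub>) \<noteq> \<zero>\<^bsub>R\<^esub>} \<subseteq> {j}" by auto
  then show ?thesis using \<open>j \<in> J\<close> finite_subset[of _ "{j}"]
    by (auto simp: unit_vec_def free_lmod_def)
qed

text \<open>Induction on the support: a vector is one coordinate times a basis vector plus the
  vector with that coordinate erased.\<close>

lemma free_lmod_hom_eqI:
  assumes R: "ring R" and N: "left_module R N"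
    and f: "f \<in> lmod_hom R (free_lmod R J) N" and g: "g \<in> lmod_hom R (free_lmod R J) N"
    and eq: "\<And>j. j \<in> J \<Longrightarrow> f (unit_vec R j) = g (unit_vec R j)"
    and x: "x \<in> carrier (free_lmod R J)"
  shows "f x = g x"
proof -
  interpret ring R by fact
  let ?F = "free_lmod R J"
  have F: "left_module R ?F" by (rule left_module_free_lmod[OF R])
  have "finite S \<Longrightarrow> x \<in> carrier ?F \<Longrightarrow> {j. x j \<noteq> \<zero>\<^bsub>R\<^esub>} \<subseteq> S \<Longrightarrow> f x = g x" for S x
  proof (induction S arbitrary: x rule: finite_induct)
    case empty
    then have "x = \<zero>\<^bsub>?F\<^esub>" by (auto simp: free_lmod_def)
    then show ?case using lmod_hom_zero[OF F N f] lmod_hom_zero[OF F N g] by simp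
  next
    case (insert j S)
    show ?case
    proof (cases "x j = \<zero>\<^bsub>R\<^esub>")
      case True then show ?thesis using insert by blast
    next
      case False
      let ?y = "x(j := \<zero>\<^bsub>R\<^esub>)"
      have j: "j \<in> J" and xj: "x j \<in> carrier R" using insert.prems False by (auto simp: free_lmod_def)
      have sub: "{i. ?y i \<noteq> \<zero>\<^bsub>R\<^esub>} \<subseteq> {i. x i \<noteq> \<zero>\<^bsub>R\<^esub>}" by auto
      have y: "?y \<in> carrier ?F"
        using insert.prems(1) finite_subset[OF sub] sub unfolding free_lmod_def by auto
      have u: "unit_vec R j \<in> carrier ?F" by (rule unit_vec_carrier[OF R j])
      have z: "x j \<odot>\<^bsub>?F\<^esub> unit_vec R j \<in> carrier ?F"
        using left_module.smult_closed[OF F xj u] .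
      have x: "x = x j \<odot>\<^bsub>?F\<^esub> unit_vec R j \<oplus>\<^bsub>?F\<^esub> ?y"
        using insert.prems xj by (auto simp: free_lmod_def unit_vec_def fun_eq_iff)
      have "{i. ?y i \<noteq> \<zero>\<^bsub>R\<^esub>} \<subseteq> S" using insert.prems(2) by auto
      then have "f ?y = g ?y" using insert.IH y by blast
      moreover have "f (x j \<odot>\<^bsub>?F\<^esub> unit_vec R j) = g (x j \<odot>\<^bsub>?F\<^esub> unit_vec R j)"
        using lmod_homD(3)[OF f xj u] lmod_homD(3)[OF g xj u] eq[OF j] by simp
      ultimately have "f (x j \<odot>\<^bsub>?F\<^esub> unit_vec R j \<oplus>\<^bsub>?F\<^esub> ?y) = g (x j \<odot>\<^bsub>?F\<^esub> unit_vec R j \<oplus>\<^bsub>?F\<^esub> ?y)"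
        using lmod_homD(2)[OF f z y] lmod_homD(2)[OF g z y] by simp
      then show ?thesis by (simp only: x[symmetric])
    qed
  qed
  then show ?thesis using x by (auto simp: free_lmod_def)
qed

lemma free_lmod_hom_exists:
  assumes R: "ring R" and N: "left_module R N" and y: "\<And>j. j \<in> J \<Longrightarrow> y j \<in> carrier N"
  shows "\<exists>f\<in>lmod_hom R (free_lmod R J) N. \<forall>j\<in>J. f (unit_vec R j) = y j"
proof -
  interpret N: left_module R N by fact
  let ?F = "free_lmod R J"
  have F: "left_module R ?F" by (rule left_module_free_lmod[OF R])
  define supp where "supp x = {j. x j \<noteq> \<zero>\<^bsub>R\<^esub>}" for x :: "'e \<Rightarrow> 'a"
  define h where "h x = (\<Oplus>\<^bsub>N\<^esub>j\<in>supp x. x j \<odot>\<^bsub>N\<^esub> y j)" for x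
  have supp: "finite (supp x)" "supp x \<subseteq> J" "\<And>j. x j \<in> carrier R" if "x \<in> carrier ?F" for x
    using that by (auto simp: supp_def free_lmod_def)
  \<comment> \<open>The support varies with \<open>x\<close> and may shrink under addition. Allowing
    any finite index set between the support and \<open>J\<close> makes the sums for
    \<open>x\<close>, \<open>x'\<close> and their sum comparable.\<close>
  have h_eq: "h x = (\<Oplus>\<^bsub>N\<^esub>j\<in>S. x j \<odot>\<^bsub>N\<^esub> y j)"
    if "x \<in> carrier ?F" "finite S" "supp x \<subseteq> S" "S \<subseteq> J" for x S
    unfolding h_def
  proof (rule N.M.add.finprod_mono_neutral_cong_left)
    show "x j \<odot>\<^bsub>N\<^esub> y j = \<zero>\<^bsub>N\<^esub>" if "j \<in> S - supp x" for j
      using that y \<open>S \<subseteq> J\<close> by (auto simp: supp_def intro!: N.smult_zero_left)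
  qed (use that supp y N.smult_closed in \<open>auto simp: Pi_iff subset_iff\<close>)
  have h: "restrict h (carrier ?F) \<in> lmod_hom R ?F N"
  proof (rule lmod_hom_restrictI[OF F])
    fix x x' assume x: "x \<in> carrier ?F" and x': "x' \<in> carrier ?F"
    let ?S = "supp x \<union> supp x'"
    have xx': "x \<oplus>\<^bsub>?F\<^esub> x' \<in> carrier ?F" using left_module.axioms(2)[OF F] x x'
      by (intro abelian_monoid.a_closed abelian_group.axioms(1))
    have S: "finite ?S" "?S \<subseteq> J" using supp[OF x] supp[OF x'] by auto
    have sub: "supp (x \<oplus>\<^bsub>?F\<^esub> x') \<subseteq> ?S"
      by (auto simp: supp_def free_lmod_def)
    have "h (x \<oplus>\<^bsub>?F\<^esub> x') = (\<Oplus>\<^bsub>N\<^esub>j\<in>?S. x j \<odot>\<^bsub>N\<^esub> y j \<oplus>\<^bsub>N\<^esub> x' j \<odot>\<^bsub>N\<^esub> y j)"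
      unfolding h_eq[OF xx' S(1) sub S(2)]
    proof (rule N.M.finsum_cong')
      fix i assume "i \<in> ?S"
      then show "(x \<oplus>\<^bsub>?F\<^esub> x') i \<odot>\<^bsub>N\<^esub> y i = x i \<odot>\<^bsub>N\<^esub> y i \<oplus>\<^bsub>N\<^esub> x' i \<odot>\<^bsub>N\<^esub> y i"
        using supp(3)[OF x] supp(3)[OF x'] y S(2)
        by (subst N.smult_l_distr[symmetric]) (auto simp: free_lmod_def)
    qed (use supp(3)[OF x] supp(3)[OF x'] y S in \<open>auto simp: Pi_iff subset_iff intro!: N.M.a_closed N.smult_closed\<close>)
    also have "\<dots> = h x \<oplus>\<^bsub>N\<^esub> h x'"
      unfolding h_eq[OF x S(1) _ S(2), OF Un_upper1] h_eq[OF x' S(1) _ S(2), OF Un_upper2]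
      by (rule N.M.finsum_addf)
        (use supp(3)[OF x] supp(3)[OF x'] y S in \<open>auto simp: Pi_iff subset_iff intro!: N.M.a_closed N.smult_closed\<close>)
    finally show "h (x \<oplus>\<^bsub>?F\<^esub> x') = h x \<oplus>\<^bsub>N\<^esub> h x'" .
  next
    fix a x assume a: "a \<in> carrier R" and x: "x \<in> carrier ?F"
    have ax: "a \<odot>\<^bsub>?F\<^esub> x \<in> carrier ?F" by (rule left_module.smult_closed[OF F a x])
    have sub: "supp (a \<odot>\<^bsub>?F\<^esub> x) \<subseteq> supp x" using a by (auto simp: supp_def free_lmod_def)
    have "h (a \<odot>\<^bsub>?F\<^esub> x) = (\<Oplus>\<^bsub>N\<^esub>j\<in>supp x. a \<odot>\<^bsub>N\<^esub> (x j \<odot>\<^bsub>N\<^esub> y j))"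
      unfolding h_eq[OF ax supp(1)[OF x] sub supp(2)[OF x]]
    proof (rule N.M.finsum_cong')
      fix i assume "i \<in> supp x"
      then show "(a \<odot>\<^bsub>?F\<^esub> x) i \<odot>\<^bsub>N\<^esub> y i = a \<odot>\<^bsub>N\<^esub> (x i \<odot>\<^bsub>N\<^esub> y i)"
        using supp[OF x] y a by (subst N.smult_assoc[symmetric]) (auto simp: free_lmod_def)
    qed (use supp[OF x] y a in \<open>auto simp: Pi_iff subset_iff intro!: N.smult_closed\<close>)
    also have "\<dots> = a \<odot>\<^bsub>N\<^esub> h x"
      unfolding h_def
      by (rule N.finsum_smult[symmetric]) (use supp[OF x] y a in \<open>auto simp: Pi_iff subset_iff intro!: N.smult_closed\<close>)
    finally show "h (a \<odot>\<^bsub>?F\<^esub> x) = a \<odot>\<^bsub>N\<^esub> h x" .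
  qed (use supp y in \<open>auto simp: h_def Pi_iff subset_iff intro!: N.M.finsum_closed N.smult_closed\<close>)
  moreover have "restrict h (carrier ?F) (unit_vec R j) = y j" if j: "j \<in> J" for j
  proof -
    have "h (unit_vec R j) = (\<Oplus>\<^bsub>N\<^esub>i\<in>{j}. unit_vec R j i \<odot>\<^bsub>N\<^esub> y i)"
      by (rule h_eq[OF unit_vec_carrier[OF R j]]) (use j in \<open>auto simp: supp_def unit_vec_def\<close>)
    also have "\<dots> = y j" using y[OF j] by (simp add: unit_vec_def N.smult_one)
    finally show ?thesis using unit_vec_carrier[OF R j] by simp
  qed
  ultimately show ?thesis by blast
qed

text \<open>Preimages are chosen for the basis of the free module of which \<open>P\<close> is a
  summand, and the resulting map is precomposed with the inclusion. Comparing images, instead of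
  asking \<open>g\<close> to be onto, makes the lemma apply directly to differentials.\<close>

lemma projective_lift:
  fixes P :: "('a, 'p, 'y) module_scheme"
  assumes P: "projective_lmod R P" and M: "left_module R M" and N: "left_module R N"
    and f: "f \<in> lmod_hom R P N" and g: "g \<in> lmod_hom R M N"
    and im: "f ` carrier P \<subseteq> g ` carrier M"
  shows "\<exists>h\<in>lmod_hom R P M. \<forall>x\<in>carrier P. g (h x) = f x"
proof -
  obtain J :: "'p set" and i r where PM: "left_module R P"
    and i: "i \<in> lmod_hom R P (free_lmod R J)" and r: "r \<in> lmod_hom R (free_lmod R J) P"
    and ri: "\<And>x. x \<in> carrier P \<Longrightarrow> r (i x) = x"
    using P unfolding projective_lmod_def by blast
  have R: "ring R" using PM by (rule left_module.axioms)
  let ?F = "free_lmod R J"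
  have F: "left_module R ?F" by (rule left_module_free_lmod[OF R])
  have "\<exists>y\<in>carrier M. g y = f (r (unit_vec R j))" if "j \<in> J" for j
    using lmod_homD(1)[OF r unit_vec_carrier[OF R that]] im by (metis image_iff image_subset_iff)
  then have "\<forall>j\<in>J. \<exists>y. y \<in> carrier M \<and> g y = f (r (unit_vec R j))" by blast
  from bchoice[OF this] obtain y where y: "\<And>j. j \<in> J \<Longrightarrow> y j \<in> carrier M"
    "\<And>j. j \<in> J \<Longrightarrow> g (y j) = f (r (unit_vec R j))"
    by blast
  from free_lmod_hom_exists[OF R M y(1)] obtain h
    where h: "h \<in> lmod_hom R ?F M" "\<forall>j\<in>J. h (unit_vec R j) = y j" ..
  have "g (h x) = f (r x)" if x: "x \<in> carrier ?F" for x
    using free_lmod_hom_eqI[OF R N lmod_hom_compose[OF F h(1) g] lmod_hom_compose[OF F r f] _ x]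
      x unit_vec_carrier[OF R] y(2) h(2) by simp
  moreover have "(\<lambda>x\<in>carrier P. h (i x)) \<in> lmod_hom R P M" by (rule lmod_hom_compose[OF PM i h(1)])
  ultimately show ?thesis using ri lmod_homD(1)[OF i]
    by (intro bexI[of _ "\<lambda>x\<in>carrier P. h (i x)"]) auto
qed

text \<open>\<open>projective_lmod\<close> wants an index set consisting of elements of the module
  itself, so the basis is reindexed by its own unit vectors. Both maps are prescribed on generators,
  and their composite fixes the generators.\<close>

lemma projective_free_lmod:
  fixes J :: "'i set"
  assumes R: "ring R"
  shows "projective_lmod R (free_lmod R J)"
proof -
  interpret ring R by fact
  let ?F = "free_lmod R J"
  let ?e = "unit_vec R :: 'i \<Rightarrow> 'i \<Rightarrow> 'a"
  let ?G = "free_lmod R (?e ` J)"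
  have F: "left_module R ?F" and G: "left_module R ?G"
    by (rule left_module_free_lmod[OF R])+
  have ue: "unit_vec R (?e j) \<in> carrier ?G" and e: "?e j \<in> carrier ?F" if "j \<in> J" for j
    using that by (simp_all add: unit_vec_carrier[OF R])
  from free_lmod_hom_exists[OF R G ue] obtain i
    where i: "i \<in> lmod_hom R ?F ?G" "\<forall>j\<in>J. i (?e j) = unit_vec R (?e j)" ..
  have q: "q \<in> carrier ?F" if "q \<in> ?e ` J" for q
    using that e by auto
  from free_lmod_hom_exists[OF R F q] obtain r
    where r: "r \<in> lmod_hom R ?G ?F" "\<forall>q\<in>?e ` J. r (unit_vec R q) = q" ..
  have "r (i x) = x" if "x \<in> carrier ?F" for x
    using free_lmod_hom_eqI[OF R F lmod_hom_compose[OF F i(1) r(1)] lmod_hom_id[OF F] _ that]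
      that e i(2) r(2) by simp
  then show ?thesis unfolding projective_lmod_def
    by (intro conjI F exI[of _ "?e ` J"] bexI[OF _ i(1)] bexI[OF _ r(1)]) simp
qed

subsection \<open>Comparison of resolutions\<close>

text \<open>Degree 0 uses the augmentation in place of a differential, so that exactness is one
  equation in all degrees.\<close>

primrec cycles :: "('a, 'm, 'y) module_scheme \<Rightarrow> ('a, 'p, 'm) resolution \<Rightarrow> nat \<Rightarrow> 'p set" where
  "cycles M X 0 = {x \<in> carrier (obj X 0). aug X x = \<zero>\<^bsub>M\<^esub>}"
| "cycles M X (Suc n) = {x \<in> carrier (obj X (Suc n)). diff X n x = \<zero>\<^bsub>obj X n\<^esub>}"

lemma projective_resolutionD:
  assumes "projective_resolution R M X"
  shows "projective_lmod R (obj X n)" "left_module R (obj X n)"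
    and "diff X n \<in> lmod_hom R (obj X (Suc n)) (obj X n)"
    and "aug X \<in> lmod_hom R (obj X 0) M" "aug X ` carrier (obj X 0) = carrier M"
    and "diff X n ` carrier (obj X (Suc n)) = cycles M X n"
  using assms unfolding projective_resolution_def projective_lmod_def
  by (simp_all, cases n, simp_all)

lemma diff_cycle:
  assumes "projective_resolution R M X" "x \<in> carrier (obj X (Suc n))"
  shows "diff X n x \<in> cycles M X n"
  using projective_resolutionD(6)[OF assms(1), of n] assms(2) by blast

lemma diff_diff:
  assumes "projective_resolution R M X" "x \<in> carrier (obj X (Suc (Suc n)))"
  shows "diff X n (diff X (Suc n) x) = \<zero>\<^bsub>obj X n\<^esub>"
  using diff_cycle[OF assms] by simp

definition chain_map ::
  "('a, 'z) ring_scheme \<Rightarrow> ('a, 'p, 'm) resolution \<Rightarrow> ('a, 'q, 'm) resolution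
    \<Rightarrow> (nat \<Rightarrow> 'p \<Rightarrow> 'q) \<Rightarrow> bool" where
  "chain_map R X Y F \<longleftrightarrow>
    (\<forall>n. F n \<in> lmod_hom R (obj X n) (obj Y n)) \<and>
    (\<forall>x\<in>carrier (obj X 0). aug Y (F 0 x) = aug X x) \<and>
    (\<forall>n. \<forall>x\<in>carrier (obj X (Suc n)). diff Y n (F (Suc n) x) = F n (diff X n x))"

lemma chain_mapD:
  assumes "chain_map R X Y F"
  shows "F n \<in> lmod_hom R (obj X n) (obj Y n)"
    and "x \<in> carrier (obj X 0) \<Longrightarrow> aug Y (F 0 x) = aug X x"
    and "x \<in> carrier (obj X (Suc n)) \<Longrightarrow> diff Y n (F (Suc n) x) = F n (diff X n x)"
  using assms unfolding chain_map_def by auto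

theorem comparison:
  assumes M: "left_module R M"
    and X: "projective_resolution R M X" and Y: "projective_resolution R M Y"
  shows "\<exists>F. chain_map R X Y F"
proof -
  note DX = projective_resolutionD[OF X] and DY = projective_resolutionD[OF Y]
  \<comment> \<open>Preservation of cycles is the invariant that allows the next lift: it puts the
    composite with the differential of \<open>X\<close> into the image of the differential of
    \<open>Y\<close>. The clause for \<open>n = 0\<close> carries the augmentation through the
    recursion, and \<open>Q\<close> ties consecutive degrees together.\<close>
  define P where "P n f \<longleftrightarrow> f \<in> lmod_hom R (obj X n) (obj Y n) \<and> f ` cycles M X n \<subseteq> cycles M Y n \<and>
    (n = 0 \<longrightarrow> (\<forall>x\<in>carrier (obj X 0). aug Y (f x) = aug X x))" for n f
  define Q where "Q n f f' \<longleftrightarrow> (\<forall>x\<in>carrier (obj X (Suc n)). diff Y n (f' x) = f (diff X n x))" for n f f'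
  have "\<exists>F. \<forall>n. P n (F n) \<and> Q n (F n) (F (Suc n))"
  proof (rule dependent_nat_choice)
    have "aug X ` carrier (obj X 0) \<subseteq> aug Y ` carrier (obj Y 0)"
      using DX(5) DY(5) by simp
    from projective_lift[OF DX(1) DY(2) M DX(4) DY(4) this] obtain f
      where f: "f \<in> lmod_hom R (obj X 0) (obj Y 0)"
        "\<forall>x\<in>carrier (obj X 0). aug Y (f x) = aug X x" ..
    then have "P 0 f" using lmod_homD(1)[OF f(1)] by (auto simp: P_def)
    then show "\<exists>f. P 0 f" by (rule exI[of _ f])
  next
    fix f n assume "P n f"
    then have f: "f \<in> lmod_hom R (obj X n) (obj Y n)" and fZ: "f ` cycles M X n \<subseteq> cycles M Y n"
      by (auto simp: P_def)
    let ?g = "\<lambda>x\<in>carrier (obj X (Suc n)). f (diff X n x)"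
    have g: "?g \<in> lmod_hom R (obj X (Suc n)) (obj Y n)"
      by (rule lmod_hom_compose[OF DX(2) DX(3) f])
    have "?g ` carrier (obj X (Suc n)) \<subseteq> diff Y n ` carrier (obj Y (Suc n))"
      unfolding DY(6) using fZ DX(6)[of n] by auto
    from projective_lift[OF DX(1) DY(2) DY(2) g DY(3) this] obtain f'
      where f': "f' \<in> lmod_hom R (obj X (Suc n)) (obj Y (Suc n))"
        "\<forall>x\<in>carrier (obj X (Suc n)). diff Y n (f' x) = ?g x" ..
    have "P (Suc n) f'"
      using f' lmod_homD(1)[OF f'(1)] lmod_hom_zero[OF DX(2) DY(2) f]
      by (auto simp: P_def)
    moreover have "Q n f f'" using f'(2) by (simp add: Q_def)
    ultimately show "\<exists>f'. P (Suc n) f' \<and> Q n f f'" by blast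
  qed
  then obtain F where F: "\<And>n. P n (F n)" "\<And>n. Q n (F n) (F (Suc n))" by blast
  have "chain_map R X Y F"
    using F(1) F(2) unfolding chain_map_def P_def Q_def by simp
  then show ?thesis by (rule exI[of _ F])
qed

theorem chain_maps_homotopic:
  assumes M: "left_module R M"
    and X: "projective_resolution R M X" and Y: "projective_resolution R M Y"
    and F: "chain_map R X Y F" and G: "chain_map R X Y G"
  shows "\<exists>h. (\<forall>n. h n \<in> lmod_hom R (obj X n) (obj Y (Suc n))) \<and>
    (\<forall>x\<in>carrier (obj X 0). diff Y 0 (h 0 x) = F 0 x \<ominus>\<^bsub>obj Y 0\<^esub> G 0 x) \<and>
    (\<forall>n. \<forall>x\<in>carrier (obj X (Suc n)). diff Y (Suc n) (h (Suc n) x) =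
      F (Suc n) x \<ominus>\<^bsub>obj Y (Suc n)\<^esub> G (Suc n) x \<ominus>\<^bsub>obj Y (Suc n)\<^esub> h n (diff X n x))"
proof -
  note DX = projective_resolutionD[OF X] and DY = projective_resolutionD[OF Y]
  note CF = chain_mapD[OF F] and CG = chain_mapD[OF G]
  let ?d = "\<lambda>n x. F n x \<ominus>\<^bsub>obj Y n\<^esub> G n x"
  \<comment> \<open>On cycles the term with \<open>h\<close> after the differential vanishes, so the
    homotopy identity reads d h = F - G there. This restricted form suffices for the next step,
    where it is applied to boundaries.\<close>
  define P where "P n h \<longleftrightarrow> h \<in> lmod_hom R (obj X n) (obj Y (Suc n)) \<and>
    (\<forall>x\<in>cycles M X n. diff Y n (h x) = ?d n x) \<and>
    (n = 0 \<longrightarrow> (\<forall>x\<in>carrier (obj X 0). diff Y 0 (h x) = ?d 0 x))" for n h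
  define Q where "Q n h h' \<longleftrightarrow> (\<forall>x\<in>carrier (obj X (Suc n)).
    diff Y (Suc n) (h' x) = ?d (Suc n) x \<ominus>\<^bsub>obj Y (Suc n)\<^esub> h (diff X n x))" for n h h'
  have D: "(\<lambda>x\<in>carrier (obj X n). ?d n x) \<in> lmod_hom R (obj X n) (obj Y n)" for n
    by (rule lmod_hom_diff[OF DX(2) DY(2) CF(1) CG(1)])
  have "\<exists>h. \<forall>n. P n (h n) \<and> Q n (h n) (h (Suc n))"
  proof (rule dependent_nat_choice)
    interpret M: left_module R M by (rule M)
    have "(\<lambda>x\<in>carrier (obj X 0). ?d 0 x) ` carrier (obj X 0) \<subseteq> diff Y 0 ` carrier (obj Y (Suc 0))"
    proof (clarsimp simp: DY(6) lmod_homD(1)[OF D, simplified])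
      fix x assume x: "x \<in> carrier (obj X 0)"
      then have "?d 0 x \<in> carrier (obj Y 0)" using lmod_homD(1)[OF D x] by simp
      moreover have "aug Y (?d 0 x) = aug X x \<ominus>\<^bsub>M\<^esub> aug X x"
        using lmod_hom_minus[OF DY(2) M DY(4) lmod_homD(1)[OF CF(1) x] lmod_homD(1)[OF CG(1) x]]
          CF(2)[OF x] CG(2)[OF x] by simp
      moreover have "aug X x \<ominus>\<^bsub>M\<^esub> aug X x = \<zero>\<^bsub>M\<^esub>"
        using lmod_homD(1)[OF DX(4) x] by (simp add: a_minus_def M.M.r_neg)
      ultimately show "?d 0 x \<in> carrier (obj Y 0) \<and> aug Y (?d 0 x) = \<zero>\<^bsub>M\<^esub>" by simp
    qed
    from projective_lift[OF DX(1) DY(2) DY(2) D DY(3) this] obtain h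
      where h: "h \<in> lmod_hom R (obj X 0) (obj Y (Suc 0))"
        "\<forall>x\<in>carrier (obj X 0). diff Y 0 (h x) = (\<lambda>x\<in>carrier (obj X 0). ?d 0 x) x" ..
    then have "P 0 h" by (auto simp: P_def)
    then show "\<exists>h. P 0 h" by (rule exI[of _ h])
  next
    fix h n assume "P n h"
    then have h: "h \<in> lmod_hom R (obj X n) (obj Y (Suc n))"
      and hZ: "\<And>x. x \<in> cycles M X n \<Longrightarrow> diff Y n (h x) = ?d n x"
      by (auto simp: P_def)
    interpret Yn: left_module R "obj Y n" by (rule DY(2))
    interpret Yn1: left_module R "obj Y (Suc n)" by (rule DY(2))
    let ?X = "carrier (obj X (Suc n))"
    let ?hd = "\<lambda>x\<in>?X. h (diff X n x)"
    let ?D = "\<lambda>x\<in>?X. ?d (Suc n) x"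
    let ?g = "\<lambda>x\<in>?X. ?D x \<ominus>\<^bsub>obj Y (Suc n)\<^esub> ?hd x"
    have hd: "?hd \<in> lmod_hom R (obj X (Suc n)) (obj Y (Suc n))"
      by (rule lmod_hom_compose[OF DX(2) DX(3) h])
    have g: "?g \<in> lmod_hom R (obj X (Suc n)) (obj Y (Suc n))"
      by (rule lmod_hom_diff[OF DX(2) DY(2) D hd])
    have "?g x \<in> cycles M Y (Suc n)" if x: "x \<in> ?X" for x
    proof -
      have dx: "diff X n x \<in> carrier (obj X n)" using lmod_homD(1)[OF DX(3) x] .
      have 1: "F n (diff X n x) \<in> carrier (obj Y n)" "G n (diff X n x) \<in> carrier (obj Y n)"
        using lmod_homD(1)[OF CF(1) dx] lmod_homD(1)[OF CG(1) dx] .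
      have "diff Y n (?g x) = diff Y n (?D x) \<ominus>\<^bsub>obj Y n\<^esub> diff Y n (?hd x)"
        using lmod_hom_minus[OF DY(2) DY(2) DY(3) lmod_homD(1)[OF D x] lmod_homD(1)[OF hd x]] x by simp
      also have "diff Y n (?hd x) = ?d n (diff X n x)"
        using hZ[OF diff_cycle[OF X x]] x by simp
      also have "diff Y n (?D x) = ?d n (diff X n x)"
        using lmod_hom_minus[OF DY(2) DY(2) DY(3) lmod_homD(1)[OF CF(1) x] lmod_homD(1)[OF CG(1) x]]
          CF(3)[OF x] CG(3)[OF x] x by simp
      also have "?d n (diff X n x) \<ominus>\<^bsub>obj Y n\<^esub> ?d n (diff X n x) = \<zero>\<^bsub>obj Y n\<^esub>"
        using 1 by (simp add: a_minus_def Yn.M.r_neg)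
      finally have "diff Y n (?g x) = \<zero>\<^bsub>obj Y n\<^esub>" .
      then show ?thesis using lmod_homD(1)[OF g x] by simp
    qed
    then have "?g ` ?X \<subseteq> diff Y (Suc n) ` carrier (obj Y (Suc (Suc n)))"
      unfolding DY(6) by blast
    from projective_lift[OF DX(1) DY(2) DY(2) g DY(3) this] obtain h'
      where h': "h' \<in> lmod_hom R (obj X (Suc n)) (obj Y (Suc (Suc n)))"
        "\<forall>x\<in>?X. diff Y (Suc n) (h' x) = ?g x" ..
    have Q: "Q n h h'" using h'(2) by (simp add: Q_def)
    moreover have "diff Y (Suc n) (h' x) = ?d (Suc n) x" if x: "x \<in> cycles M X (Suc n)" for x
    proof -
      have x': "x \<in> ?X" and dx: "diff X n x = \<zero>\<^bsub>obj X n\<^esub>" using x by auto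
      have "diff Y (Suc n) (h' x) = ?d (Suc n) x \<ominus>\<^bsub>obj Y (Suc n)\<^esub> \<zero>\<^bsub>obj Y (Suc n)\<^esub>"
        using Q x' dx lmod_hom_zero[OF DX(2) DY(2) h] by (simp add: Q_def)
      then show ?thesis using lmod_homD(1)[OF D x'] x' by (simp add: a_minus_def)
    qed
    ultimately show "\<exists>h'. P (Suc n) h' \<and> Q n h h'" using h'(1) by (auto simp: P_def)
  qed
  then obtain h where h: "\<And>n. P n (h n)" "\<And>n. Q n (h n) (h (Suc n))" by blast
  then show ?thesis
    by (intro exI[of _ h]) (simp add: P_def Q_def)
qed

lemma chain_map_id: "projective_resolution R M X \<Longrightarrow> chain_map R X X (\<lambda>n. \<lambda>x\<in>carrier (obj X n). x)"
  using projective_resolutionD(2)[of R M X] lmod_homD(1)[OF projective_resolutionD(3)[of R M X]]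
  by (simp add: chain_map_def lmod_hom_id)

lemma chain_map_compose:
  assumes X: "projective_resolution R M X" and F: "chain_map R X Y F" and G: "chain_map R Y Z G"
  shows "chain_map R X Z (\<lambda>n. \<lambda>x\<in>carrier (obj X n). G n (F n x))"
  unfolding chain_map_def
proof (intro conjI allI ballI)
  note DX = projective_resolutionD[OF X]
  show "(\<lambda>x\<in>carrier (obj X n). G n (F n x)) \<in> lmod_hom R (obj X n) (obj Z n)" for n
    by (rule lmod_hom_compose[OF DX(2) chain_mapD(1)[OF F] chain_mapD(1)[OF G]])
  show "aug Z ((\<lambda>x\<in>carrier (obj X 0). G 0 (F 0 x)) x) = aug X x" if "x \<in> carrier (obj X 0)" for x
    using that chain_mapD(2)[OF F that] chain_mapD(2)[OF G] lmod_homD(1)[OF chain_mapD(1)[OF F] that]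
    by simp
  show "diff Z n ((\<lambda>x\<in>carrier (obj X (Suc n)). G (Suc n) (F (Suc n) x)) x) =
    (\<lambda>x\<in>carrier (obj X n). G n (F n x)) (diff X n x)" if "x \<in> carrier (obj X (Suc n))" for n x
    using that chain_mapD(3)[OF F that] chain_mapD(3)[OF G] lmod_homD(1)[OF chain_mapD(1)[OF F] that]
      lmod_homD(1)[OF DX(3) that] by simp
qed

text \<open>
  For the minimal resolution \<open>Y\<close>, \<open>Ext\<close> consists of all homomorphisms \<open>Y\<^sub>n \<rightarrow> N\<close>; evaluation along
  the comparison map transports this to an arbitrary resolution \<open>X\<close>.
\<close>

lemma minimal_resolution_eval:
  assumes M: "left_module R M" and N: "left_module R N"
    and X: "projective_resolution R M X" and Y: "projective_resolution R M Y"
    and minimal: "\<forall>n. \<forall>f\<in>lmod_hom R (obj Y n) N. \<forall>y\<in>carrier (obj Y (Suc n)). f (diff Y n y) = \<zero>\<^bsub>N\<^esub>"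
  shows "\<exists>F. chain_map R Y X F \<and>
    (\<forall>n. \<forall>f\<in>coboundaries R X N n. \<forall>y\<in>carrier (obj Y n). f (F n y) = \<zero>\<^bsub>N\<^esub>) \<and>
    (\<forall>n. \<forall>f\<in>cocycles R X N n. (\<forall>y\<in>carrier (obj Y n). f (F n y) = \<zero>\<^bsub>N\<^esub>) \<longrightarrow>
      f \<in> coboundaries R X N n) \<and>
    (\<forall>n. \<forall>g\<in>lmod_hom R (obj Y n) N.
      \<exists>f\<in>cocycles R X N n. \<forall>y\<in>carrier (obj Y n). f (F n y) = g y)"
proof -
  interpret N: left_module R N by (rule N)
  note DX = projective_resolutionD[OF X] and DY = projective_resolutionD[OF Y]
  have min: "f (diff Y n y) = \<zero>\<^bsub>N\<^esub>"
    if "f \<in> lmod_hom R (obj Y n) N" "y \<in> carrier (obj Y (Suc n))" for n f y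
    using minimal that by blast
  obtain F where F: "chain_map R Y X F" using comparison[OF M Y X] ..
  obtain G where G: "chain_map R X Y G" using comparison[OF M X Y] ..
  note CF = chain_mapD[OF F] and CG = chain_mapD[OF G]
  \<comment> \<open>\<open>h\<close> is a homotopy between the identity of \<open>X\<close> and
    \<open>F\<close> after \<open>G\<close>; \<open>k\<close> below does the same for
    \<open>Y\<close> and \<open>G\<close> after \<open>F\<close>.\<close>
  have "\<exists>h. (\<forall>n. h n \<in> lmod_hom R (obj X n) (obj X (Suc n))) \<and>
    (\<forall>x\<in>carrier (obj X 0). diff X 0 (h 0 x) = x \<ominus>\<^bsub>obj X 0\<^esub> F 0 (G 0 x)) \<and>
    (\<forall>n. \<forall>x\<in>carrier (obj X (Suc n)). diff X (Suc n) (h (Suc n) x) =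
      x \<ominus>\<^bsub>obj X (Suc n)\<^esub> F (Suc n) (G (Suc n) x) \<ominus>\<^bsub>obj X (Suc n)\<^esub> h n (diff X n x))"
    using chain_maps_homotopic[OF M X X chain_map_id[OF X] chain_map_compose[OF X G F]] by simp
  then obtain h where h: "\<And>n. h n \<in> lmod_hom R (obj X n) (obj X (Suc n))"
    and h0: "\<And>x. x \<in> carrier (obj X 0) \<Longrightarrow> diff X 0 (h 0 x) = x \<ominus>\<^bsub>obj X 0\<^esub> F 0 (G 0 x)"
    and hS: "\<And>n x. x \<in> carrier (obj X (Suc n)) \<Longrightarrow> diff X (Suc n) (h (Suc n) x) =
      x \<ominus>\<^bsub>obj X (Suc n)\<^esub> F (Suc n) (G (Suc n) x) \<ominus>\<^bsub>obj X (Suc n)\<^esub> h n (diff X n x)"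
    by (elim exE conjE) (rule that, auto)
  have "\<exists>h. (\<forall>n. h n \<in> lmod_hom R (obj Y n) (obj Y (Suc n))) \<and>
    (\<forall>x\<in>carrier (obj Y 0). diff Y 0 (h 0 x) = x \<ominus>\<^bsub>obj Y 0\<^esub> G 0 (F 0 x)) \<and>
    (\<forall>n. \<forall>x\<in>carrier (obj Y (Suc n)). diff Y (Suc n) (h (Suc n) x) =
      x \<ominus>\<^bsub>obj Y (Suc n)\<^esub> G (Suc n) (F (Suc n) x) \<ominus>\<^bsub>obj Y (Suc n)\<^esub> h n (diff Y n x))"
    using chain_maps_homotopic[OF M Y Y chain_map_id[OF Y] chain_map_compose[OF Y F G]] by simp
  then obtain k where k: "\<And>n. k n \<in> lmod_hom R (obj Y n) (obj Y (Suc n))"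
    and k0: "\<And>x. x \<in> carrier (obj Y 0) \<Longrightarrow> diff Y 0 (k 0 x) = x \<ominus>\<^bsub>obj Y 0\<^esub> G 0 (F 0 x)"
    and kS: "\<And>n x. x \<in> carrier (obj Y (Suc n)) \<Longrightarrow> diff Y (Suc n) (k (Suc n) x) =
      x \<ominus>\<^bsub>obj Y (Suc n)\<^esub> G (Suc n) (F (Suc n) x) \<ominus>\<^bsub>obj Y (Suc n)\<^esub> k n (diff Y n x)"
    by (elim exE conjE) (rule that, auto)
  have minus_zero_iff: "a = b" if "a \<ominus>\<^bsub>N\<^esub> b = \<zero>\<^bsub>N\<^esub>" "a \<in> carrier N" "b \<in> carrier N" for a b
    using that N.M.minus_equality[of a "\<ominus>\<^bsub>N\<^esub> b"] by (simp add: a_minus_def)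
  have a: "f (F n y) = \<zero>\<^bsub>N\<^esub>"
    if f: "f \<in> coboundaries R X N n" and y: "y \<in> carrier (obj Y n)" for n f y
  proof (cases n)
    case 0
    then show ?thesis using f lmod_homD(1)[OF CF(1) y] by auto
  next
    case (Suc m)
    then obtain g where g: "g \<in> lmod_hom R (obj X m) N"
      and f: "f = compose (carrier (obj X (Suc m))) g (diff X m)" using f by auto
    have y: "y \<in> carrier (obj Y (Suc m))" using y Suc by simp
    have "f (F n y) = g (F m (diff Y m y))"
      using CF(3)[OF y] lmod_homD(1)[OF CF(1) y] by (simp add: f Suc compose_def)
    also have "\<dots> = \<zero>\<^bsub>N\<^esub>"
      using min[OF lmod_hom_compose[OF DY(2) CF(1) g] y] lmod_homD(1)[OF DY(3) y] by simp
    finally show ?thesis .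
  qed
  \<comment> \<open>As \<open>f\<close> vanishes on the image of \<open>F\<close>, it takes the same
    value at x and at x - F G x = d h x + h d x. The cocycle condition kills the first term, so
    \<open>f\<close> is the composite of \<open>f\<close> after \<open>h\<close> with the
    differential.\<close>
  have b: "f \<in> coboundaries R X N n"
    if f: "f \<in> cocycles R X N n" and z: "\<And>y. y \<in> carrier (obj Y n) \<Longrightarrow> f (F n y) = \<zero>\<^bsub>N\<^esub>" for n f
  proof -
    have fh: "f \<in> lmod_hom R (obj X n) N"
      and fd: "\<And>x. x \<in> carrier (obj X (Suc n)) \<Longrightarrow> f (diff X n x) = \<zero>\<^bsub>N\<^esub>"
      using f by (auto simp: cocycles_def)
    interpret X: left_module R "obj X n" by (rule DX(2))
    have zG: "f (F n (G n x)) = \<zero>\<^bsub>N\<^esub>" if "x \<in> carrier (obj X n)" for x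
      using z lmod_homD(1)[OF CG(1) that] by simp
    have FG: "F n (G n x) \<in> carrier (obj X n)" if "x \<in> carrier (obj X n)" for x
      using lmod_homD(1)[OF CF(1) lmod_homD(1)[OF CG(1) that]] .
    have e: "f (x \<ominus>\<^bsub>obj X n\<^esub> F n (G n x)) = f x" if x: "x \<in> carrier (obj X n)" for x
      using lmod_hom_minus[OF DX(2) N fh x FG[OF x]] zG[OF x] lmod_homD(1)[OF fh x]
      by (simp add: a_minus_def)
    show "f \<in> coboundaries R X N n"
    proof (cases n)
      case 0
      have "f x = \<zero>\<^bsub>N\<^esub>" if x: "x \<in> carrier (obj X n)" for x
        using h0[of x] e[OF x] fd[of "h 0 x"] lmod_homD(1)[OF h, of x 0] x by (simp add: 0)
      then have "f = (\<lambda>x\<in>carrier (obj X 0). \<zero>\<^bsub>N\<^esub>)"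
        using lmod_homD(4)[OF fh] 0 by (auto intro!: extensionalityI[of f "carrier (obj X 0)"])
      then show ?thesis by (simp add: 0)
    next
      case (Suc m)
      have eq: "f x = f (h m (diff X m x))" if x: "x \<in> carrier (obj X n)" for x
      proof -
        have x': "x \<in> carrier (obj X (Suc m))" using x Suc by simp
        have hd: "h m (diff X m x) \<in> carrier (obj X n)"
          using lmod_homD(1)[OF h lmod_homD(1)[OF DX(3) x']] by (simp add: Suc)
        have "\<zero>\<^bsub>N\<^esub> = f (diff X n (h n x))" using fd[OF lmod_homD(1)[OF h x]] ..
        also have "\<dots> = f (x \<ominus>\<^bsub>obj X n\<^esub> F n (G n x) \<ominus>\<^bsub>obj X n\<^esub> h m (diff X m x))"
          using hS[OF x'] by (simp add: Suc)
        also have "\<dots> = f x \<ominus>\<^bsub>N\<^esub> f (h m (diff X m x))"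
          using lmod_hom_minus[OF DX(2) N fh _ hd] e[OF x] x FG[OF x] by simp
        finally show ?thesis
          using minus_zero_iff lmod_homD(1)[OF fh x] lmod_homD(1)[OF fh hd] by metis
      qed
      have "(\<lambda>x\<in>carrier (obj X m). f (h m x)) \<in> lmod_hom R (obj X m) N"
        by (rule lmod_hom_compose[OF DX(2) h]) (use fh Suc in simp)
      moreover have "f = compose (carrier (obj X (Suc m))) (\<lambda>x\<in>carrier (obj X m). f (h m x)) (diff X m)"
        using lmod_homD(4)[OF fh] eq lmod_homD(1)[OF DX(3), of _ m]
        by (intro extensionalityI[of f "carrier (obj X (Suc m))"]) (auto simp: Suc compose_def)
      ultimately show ?thesis unfolding Suc by auto
    qed
  qed
  \<comment> \<open>The witness is the pullback of \<open>g\<close> along \<open>G\<close>. Its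
    value at F y differs from g y by g applied to d k y + k d y, and minimality kills both terms:
    the second because \<open>g\<close> after \<open>k\<close> is again a homomorphism on
    \<open>Y\<close>.\<close>
  have c: "\<exists>f\<in>cocycles R X N n. \<forall>y\<in>carrier (obj Y n). f (F n y) = g y"
    if g: "g \<in> lmod_hom R (obj Y n) N" for n g
  proof -
    let ?f = "\<lambda>x\<in>carrier (obj X n). g (G n x)"
    have fh: "?f \<in> lmod_hom R (obj X n) N" by (rule lmod_hom_compose[OF DX(2) CG(1) g])
    have "?f (diff X n x) = \<zero>\<^bsub>N\<^esub>" if x: "x \<in> carrier (obj X (Suc n))" for x
      using CG(3)[OF x] lmod_homD(1)[OF DX(3) x] min[OF g lmod_homD(1)[OF CG(1) x]] by simp
    then have "?f \<in> cocycles R X N n" using fh by (simp add: cocycles_def)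
    moreover have "?f (F n y) = g y" if y: "y \<in> carrier (obj Y n)" for y
    proof -
      interpret Y: left_module R "obj Y n" by (rule DY(2))
      have GF: "G n (F n y) \<in> carrier (obj Y n)"
        using lmod_homD(1)[OF CG(1) lmod_homD(1)[OF CF(1) y]] .
      have gy: "g y \<in> carrier N" "g (G n (F n y)) \<in> carrier N"
        using lmod_homD(1)[OF g y] lmod_homD(1)[OF g GF] .
      have m: "g (y \<ominus>\<^bsub>obj Y n\<^esub> G n (F n y)) = g y \<ominus>\<^bsub>N\<^esub> g (G n (F n y))"
        by (rule lmod_hom_minus[OF DY(2) N g y GF])
      have "g y \<ominus>\<^bsub>N\<^esub> g (G n (F n y)) = \<zero>\<^bsub>N\<^esub>"
      proof (cases n)
        case 0
        then show ?thesis using m k0[of y] y min[OF g lmod_homD(1)[OF k y]] by simp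
      next
        case (Suc l)
        have y': "y \<in> carrier (obj Y (Suc l))" using y Suc by simp
        have kd: "k l (diff Y l y) \<in> carrier (obj Y n)"
          using lmod_homD(1)[OF k lmod_homD(1)[OF DY(3) y']] by (simp add: Suc)
        have z: "g (k l (diff Y l y)) = \<zero>\<^bsub>N\<^esub>"
          using min[of "\<lambda>x\<in>carrier (obj Y l). g (k l x)" l y] lmod_hom_compose[OF DY(2) k, of g l N] g y'
            lmod_homD(1)[OF DY(3) y'] by (simp add: Suc)
        have "\<zero>\<^bsub>N\<^esub> = g (diff Y n (k n y))" using min[OF g lmod_homD(1)[OF k y]] ..
        also have "\<dots> = g (y \<ominus>\<^bsub>obj Y n\<^esub> G n (F n y) \<ominus>\<^bsub>obj Y n\<^esub> k l (diff Y l y))"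
          using kS[OF y'] by (simp add: Suc)
        also have "\<dots> = (g y \<ominus>\<^bsub>N\<^esub> g (G n (F n y))) \<ominus>\<^bsub>N\<^esub> g (k l (diff Y l y))"
          using lmod_hom_minus[OF DY(2) N g _ kd] m y GF by simp
        also have "\<dots> = g y \<ominus>\<^bsub>N\<^esub> g (G n (F n y))"
          using z gy by (simp add: a_minus_def)
        finally show ?thesis ..
      qed
      then have "g y = g (G n (F n y))" using minus_zero_iff gy by blast
      then show ?thesis using lmod_homD(1)[OF CF(1) y] by simp
    qed
    ultimately show "\<exists>f\<in>cocycles R X N n. \<forall>y\<in>carrier (obj Y n). f (F n y) = g y" by blast
  qed
  show ?thesis
    by (intro exI[of _ F] conjI F allI ballI impI) (auto intro: a b dest: c)
qed

subsection \<open>Quotients\<close>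

lemma abelian_group_quot_module:
  assumes "abelian_group M" "additive_subgroup U M"
  shows "abelian_group (quot_module M U)"
proof -
  interpret abelian_subgroup U M by (rule abelian_subgroupI3[OF assms(2,1)])
  interpret Q: abelian_group "M Quot U"
    by (rule comm_group_abelian_groupI)
      (simp add: FactRing_def a_factorgroup_is_comm_group[unfolded A_FactGroup_def'])
  have eq: "carrier (quot_module M U) = carrier (M Quot U)" "zero (quot_module M U) = zero (M Quot U)"
    "add (quot_module M U) = add (M Quot U)"
    by (simp_all add: quot_module_def)
  show ?thesis
  proof (rule abelian_groupI, unfold eq)
    fix x assume "x \<in> carrier (M Quot U)"
    then show "\<exists>y\<in>carrier (M Quot U). y \<oplus>\<^bsub>M Quot U\<^esub> x = \<zero>\<^bsub>M Quot U\<^esub>"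
      using Q.a_inv_closed Q.l_neg by blast
  qed (simp_all add: Q.a_ac)
qed

lemma quot_module_simps:
  "carrier (quot_module M U) = (\<lambda>x. U +>\<^bsub>M\<^esub> x) ` carrier M"
  "zero (quot_module M U) = U"
  "one (quot_module M U) = U +>\<^bsub>M\<^esub> \<one>\<^bsub>M\<^esub>"
  "smult (quot_module M U) = (\<lambda>c X. \<Union>x\<in>X. U +>\<^bsub>M\<^esub> (c \<odot>\<^bsub>M\<^esub> x))"
  by (auto simp: quot_module_def FactRing_simps)

lemma quot_module_add:
  assumes "abelian_group M" "additive_subgroup U M" "x \<in> carrier M" "y \<in> carrier M"
  shows "(U +>\<^bsub>M\<^esub> x) \<oplus>\<^bsub>quot_module M U\<^esub> (U +>\<^bsub>M\<^esub> y) = U +>\<^bsub>M\<^esub> (x \<oplus>\<^bsub>M\<^esub> y)"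
proof -
  interpret abelian_subgroup U M by (rule abelian_subgroupI3[OF assms(2,1)])
  show ?thesis using assms(3,4) by (simp add: quot_module_def FactRing_def a_rcos_sum)
qed

lemma mem_a_r_cosetE:
  assumes "y \<in> U +>\<^bsub>M\<^esub> x" obtains u where "u \<in> U" "y = u \<oplus>\<^bsub>M\<^esub> x"
  using assms by (auto simp: a_r_coset_def r_coset_def)

text \<open>The union over representatives collapses to one coset because \<open>U\<close> is stable
  under \<open>c\<close>. Only one \<open>c\<close> and its own properties are assumed, so the lemma
  covers scalars of k as well as elements of a noncommutative ring.\<close>

lemma quot_module_smult:
  assumes "abelian_group M" "additive_subgroup U M" "x \<in> carrier M"
    and closed: "\<And>y. y \<in> carrier M \<Longrightarrow> c \<odot>\<^bsub>M\<^esub> y \<in> carrier M"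
    and distr: "\<And>y z. y \<in> carrier M \<Longrightarrow> z \<in> carrier M \<Longrightarrow>
      c \<odot>\<^bsub>M\<^esub> (y \<oplus>\<^bsub>M\<^esub> z) = c \<odot>\<^bsub>M\<^esub> y \<oplus>\<^bsub>M\<^esub> c \<odot>\<^bsub>M\<^esub> z"
    and sub: "\<And>u. u \<in> U \<Longrightarrow> c \<odot>\<^bsub>M\<^esub> u \<in> U"
  shows "c \<odot>\<^bsub>quot_module M U\<^esub> (U +>\<^bsub>M\<^esub> x) = U +>\<^bsub>M\<^esub> (c \<odot>\<^bsub>M\<^esub> x)"
proof -
  interpret abelian_subgroup U M by (rule abelian_subgroupI3[OF assms(2,1)])
  have "U +>\<^bsub>M\<^esub> (c \<odot>\<^bsub>M\<^esub> y) = U +>\<^bsub>M\<^esub> (c \<odot>\<^bsub>M\<^esub> x)" if y: "y \<in> U +>\<^bsub>M\<^esub> x" for y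
  proof -
    obtain u where u: "u \<in> U" "y = u \<oplus>\<^bsub>M\<^esub> x" using y by (rule mem_a_r_cosetE)
    have uM: "u \<in> carrier M" using u(1) by (rule a_Hcarr)
    have "c \<odot>\<^bsub>M\<^esub> y = c \<odot>\<^bsub>M\<^esub> u \<oplus>\<^bsub>M\<^esub> c \<odot>\<^bsub>M\<^esub> x" unfolding u(2) by (rule distr[OF uM assms(3)])
    then have "c \<odot>\<^bsub>M\<^esub> y \<in> U +>\<^bsub>M\<^esub> (c \<odot>\<^bsub>M\<^esub> x)"
      using sub[OF u(1)] by (auto simp: a_r_coset_def r_coset_def)
    then show ?thesis using a_repr_independence'[OF _ closed[OF assms(3)]] by simp
  qed
  moreover have "x \<in> U +>\<^bsub>M\<^esub> x" using assms(3) by (rule a_rcos_self)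
  ultimately show ?thesis unfolding quot_module_simps by blast
qed

lemma left_module_quot_module:
  assumes M: "left_module R M" and U: "additive_subgroup U M"
    and sub: "\<And>a u. a \<in> carrier R \<Longrightarrow> u \<in> U \<Longrightarrow> a \<odot>\<^bsub>M\<^esub> u \<in> U"
  shows "left_module R (quot_module M U)"
proof -
  interpret M: left_module R M by (rule M)
  interpret Q: abelian_group "quot_module M U"
    by (rule abelian_group_quot_module[OF M.M.abelian_group_axioms U])
  note add = quot_module_add[OF M.M.abelian_group_axioms U]
  have sm: "a \<odot>\<^bsub>quot_module M U\<^esub> (U +>\<^bsub>M\<^esub> x) = U +>\<^bsub>M\<^esub> (a \<odot>\<^bsub>M\<^esub> x)"
    if "a \<in> carrier R" "x \<in> carrier M" for a x
    by (rule quot_module_smult[OF M.M.abelian_group_axioms U])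
      (use that sub in \<open>auto simp: M.smult_closed M.smult_r_distr\<close>)
  show ?thesis
  proof unfold_locales
    fix a x assume "a \<in> carrier R" "x \<in> carrier (quot_module M U)"
    then show "a \<odot>\<^bsub>quot_module M U\<^esub> x \<in> carrier (quot_module M U)"
      using sm by (auto simp: quot_module_simps(1) M.smult_closed)
  next
    fix a x y assume "a \<in> carrier R" "x \<in> carrier (quot_module M U)" "y \<in> carrier (quot_module M U)"
    then show "a \<odot>\<^bsub>quot_module M U\<^esub> (x \<oplus>\<^bsub>quot_module M U\<^esub> y) =
      a \<odot>\<^bsub>quot_module M U\<^esub> x \<oplus>\<^bsub>quot_module M U\<^esub> a \<odot>\<^bsub>quot_module M U\<^esub> y"
      by (auto simp: quot_module_simps(1) sm add M.smult_closed M.smult_r_distr)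
  qed (auto simp: quot_module_simps(1) sm add M.smult_closed M.smult_l_distr M.smult_assoc M.smult_one)
qed

subsection \<open>Dimension\<close>

text \<open>Gaussian elimination, with \<open>B\<close> indexing the unknowns and \<open>J\<close>
  the equations: a pivot \<open>x0\<close> in equation \<open>j\<close> is eliminated from the other
  equations.\<close>

lemma homogeneous_system_nontrivial_solution:
  fixes \<phi> :: "'b \<Rightarrow> 'j \<Rightarrow> 'k::field"
  assumes "finite J" "finite B" "card J < card B"
  shows "\<exists>c. (\<exists>x\<in>B. c x \<noteq> 0) \<and> (\<forall>j\<in>J. (\<Sum>x\<in>B. c x * \<phi> x j) = 0)"
  using assms
proof (induction J arbitrary: B \<phi> rule: finite_induct)
  case empty
  then obtain x where "x \<in> B" by fastforce
  then show ?case by (intro exI[of _ "\<lambda>_. 1"]) auto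
next
  case (insert j J)
  show ?case
  proof (cases "\<exists>x0\<in>B. \<phi> x0 j \<noteq> 0")
    case False
    have "card J < card B" using insert by simp
    from insert.IH[OF insert.prems(1) this, of \<phi>] obtain c
      where c: "\<exists>x\<in>B. c x \<noteq> 0" "\<forall>i\<in>J. (\<Sum>x\<in>B. c x * \<phi> x i) = 0" by auto
    have "(\<Sum>x\<in>B. c x * \<phi> x j) = 0" using False by (intro sum.neutral) auto
    then show ?thesis using c by (intro exI[of _ c]) auto
  next
    case True
    then obtain x0 where x0: "x0 \<in> B" "\<phi> x0 j \<noteq> 0" by auto
    let ?B = "B - {x0}"
    let ?\<phi> = "\<lambda>x i. \<phi> x i - \<phi> x j / \<phi> x0 j * \<phi> x0 i"
    have "card J < card ?B" "finite ?B" using insert x0 by auto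
    from insert.IH[OF this(2,1), of ?\<phi>] obtain c
      where c: "\<exists>x\<in>?B. c x \<noteq> 0" "\<forall>i\<in>J. (\<Sum>x\<in>?B. c x * ?\<phi> x i) = 0" by auto
    \<comment> \<open>Back substitution: equation \<open>j\<close> forces the value
      \<open>- t\<close> for the pivot unknown.\<close>
    define t where "t = (\<Sum>x\<in>?B. c x * \<phi> x j) / \<phi> x0 j"
    let ?c = "c(x0 := - t)"
    have split: "(\<Sum>x\<in>B. ?c x * \<phi> x i) = (\<Sum>x\<in>?B. c x * \<phi> x i) - t * \<phi> x0 i" for i
    proof -
      have "(\<Sum>x\<in>B. ?c x * \<phi> x i) = ?c x0 * \<phi> x0 i + (\<Sum>x\<in>?B. ?c x * \<phi> x i)"
        using x0(1) insert.prems(1) by (subst sum.remove[of _ x0]) auto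
      also have "(\<Sum>x\<in>?B. ?c x * \<phi> x i) = (\<Sum>x\<in>?B. c x * \<phi> x i)" by (intro sum.cong) auto
      finally show ?thesis by simp
    qed
    have "(\<Sum>x\<in>?B. c x * ?\<phi> x i) = (\<Sum>x\<in>?B. c x * \<phi> x i) - t * \<phi> x0 i" for i
      by (simp add: t_def right_diff_distrib sum_subtractf sum_distrib_right sum_divide_distrib mult.assoc)
    then have "\<forall>i\<in>J. (\<Sum>x\<in>B. ?c x * \<phi> x i) = 0" using c(2) split by simp
    moreover have "(\<Sum>x\<in>B. ?c x * \<phi> x j) = 0" using split[of j] x0(2) by (simp add: t_def)
    moreover have "\<exists>x\<in>B. ?c x \<noteq> 0" using c(1) by auto
    ultimately show ?thesis by blast
  qed
qed

text \<open>\<open>\<Phi>\<close> is a linear isomorphism from \<open>S\<close> to the functions on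
  \<open>J\<close>. More than \<open>card J\<close> vectors admit a nontrivial combination with all
  coordinates zero, and preimages of the standard basis are independent. Linearity is asked on
  \<open>S\<close> only, so no vector space axioms have to be checked for \<open>E\<close>.\<close>

lemma vdim_eq_card:
  fixes E :: "('k::field, 'v, 'z) module_scheme" and \<Phi> :: "'v \<Rightarrow> 'j \<Rightarrow> 'k"
  assumes E: "abelian_group E" and S: "S \<subseteq> carrier E" "\<zero>\<^bsub>E\<^esub> \<in> S"
    and add: "\<And>x y. x \<in> S \<Longrightarrow> y \<in> S \<Longrightarrow> x \<oplus>\<^bsub>E\<^esub> y \<in> S"
    and smult: "\<And>c x. x \<in> S \<Longrightarrow> c \<odot>\<^bsub>E\<^esub> x \<in> S"
    and \<Phi>_add: "\<And>x y j. x \<in> S \<Longrightarrow> y \<in> S \<Longrightarrow> j \<in> J \<Longrightarrow> \<Phi> (x \<oplus>\<^bsub>E\<^esub> y) j = \<Phi> x j + \<Phi> y j"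
    and \<Phi>_smult: "\<And>c x j. x \<in> S \<Longrightarrow> j \<in> J \<Longrightarrow> \<Phi> (c \<odot>\<^bsub>E\<^esub> x) j = c * \<Phi> x j"
    and inj: "\<And>x. x \<in> S \<Longrightarrow> (\<And>j. j \<in> J \<Longrightarrow> \<Phi> x j = 0) \<Longrightarrow> x = \<zero>\<^bsub>E\<^esub>"
    and surj: "\<And>c. \<exists>x\<in>S. \<forall>j\<in>J. \<Phi> x j = c j"
    and J: "finite J"
  shows "vdim E S = enat (card J)"
proof -
  interpret abelian_group E by (rule E)
  have \<Phi>0: "\<Phi> \<zero>\<^bsub>E\<^esub> j = 0" if "j \<in> J" for j
    using \<Phi>_add[OF S(2) S(2) that] S(2) by (metis add_cancel_left_left l_zero zero_closed)
  have fs: "finsum E (\<lambda>x. c x \<odot>\<^bsub>E\<^esub> x) B \<in> S \<and>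
      (\<forall>j\<in>J. \<Phi> (finsum E (\<lambda>x. c x \<odot>\<^bsub>E\<^esub> x) B) j = (\<Sum>x\<in>B. c x * \<Phi> x j))"
    if "finite B" "B \<subseteq> S" for B c
    using that
  proof (induction B rule: finite_induct)
    case (insert x B)
    then have "x \<in> S" "B \<subseteq> S" by auto
    then have "(\<lambda>x. c x \<odot>\<^bsub>E\<^esub> x) \<in> B \<rightarrow> carrier E" "c x \<odot>\<^bsub>E\<^esub> x \<in> carrier E" "c x \<odot>\<^bsub>E\<^esub> x \<in> S"
      using smult S(1) by auto
    with insert \<open>x \<in> S\<close> show ?case by (simp add: add \<Phi>_add \<Phi>_smult)
  qed (simp add: S \<Phi>0)
  have le: "card B \<le> card J" if B: "B \<subseteq> S" "lin_indep E B" for B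
  proof (rule ccontr)
    assume "\<not> card B \<le> card J"
    moreover have fB: "finite B" using B by (simp add: lin_indep_def)
    ultimately obtain c where c: "\<exists>x\<in>B. c x \<noteq> 0" "\<forall>j\<in>J. (\<Sum>x\<in>B. c x * \<Phi> x j) = 0"
      using homogeneous_system_nontrivial_solution[of J B \<Phi>] J by auto
    have "finsum E (\<lambda>x. c x \<odot>\<^bsub>E\<^esub> x) B = \<zero>\<^bsub>E\<^esub>"
      using fs[OF fB B(1), of c] c(2) inj by simp
    then show False using B(2) c(1) by (auto simp: lin_indep_def)
  qed
  have "\<exists>x. x \<in> S \<and> (\<forall>j\<in>J. \<Phi> x j = (if i = j then 1 else 0))" for i
    using surj[of "\<lambda>j. if i = j then 1 else 0"] by (simp only: Bex_def)
  then have "\<forall>i. \<exists>x. x \<in> S \<and> (\<forall>j\<in>J. \<Phi> x j = (if i = j then 1 else 0))" ..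
  from choice[OF this] obtain e
    where e': "\<forall>i. e i \<in> S \<and> (\<forall>j\<in>J. \<Phi> (e i) j = (if i = j then 1 else 0))" ..
  have e: "e i \<in> S" "j \<in> J \<Longrightarrow> \<Phi> (e i) j = (if i = j then 1 else 0)" for i j
    using e' by simp_all
  have inj_e: "inj_on e J"
    by (rule inj_onI) (metis e(2) zero_neq_one)
  have "lin_indep E (e ` J)"
    unfolding lin_indep_def
  proof (intro conjI allI impI ballI)
    fix c x assume z: "finsum E (\<lambda>x. c x \<odot>\<^bsub>E\<^esub> x) (e ` J) = \<zero>\<^bsub>E\<^esub>" and "x \<in> e ` J"
    then obtain i where i: "i \<in> J" "x = e i" by auto
    have "0 = (\<Sum>x\<in>e ` J. c x * \<Phi> x i)"
      using fs[of "e ` J" c] z \<Phi>0[OF i(1)] J e(1) i(1) by (simp add: image_subset_iff)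
    also have "\<dots> = (\<Sum>j\<in>J. c (e j) * (if j = i then 1 else 0))"
      using inj_e i(1) e(2) by (simp add: sum.reindex)
    also have "\<dots> = c x" using i J by (simp add: if_distrib cong: if_cong)
    finally show "c x = 0" by simp
  qed (use J e(1) S(1) in auto)
  moreover have "e ` J \<subseteq> S" "card (e ` J) = card J"
    using e(1) inj_e by (auto intro: card_image)
  ultimately have "enat (card J) \<le> vdim E S"
    unfolding vdim_def by (metis (mono_tags, lifting) SUP_upper mem_Collect_eq)
  moreover have "vdim E S \<le> enat (card J)"
    unfolding vdim_def by (rule SUP_least) (use le in auto)
  ultimately show ?thesis by simp
qed

subsection \<open>Ext of a one-dimensional module\<close>

text \<open>\<open>\<tau>\<close> identifies \<open>M\<close> with k, and \<open>\<epsilon>\<close>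
  is the character through which \<open>A\<close> acts on it. \<open>Y\<close> is the minimal free
  resolution with bases \<open>B n\<close>; the aim is to read off its ranks from the arbitrary
  resolution \<open>X\<close>.\<close>

locale one_dim_ext =
  fixes A :: "('k::field, 'a, 'z) module_scheme" and M :: "('a, 'm, 'y) module_scheme"
    and X :: "('a, 'p, 'm) resolution"
    and Y :: "('a, 'i \<Rightarrow> 'a, 'm) resolution" and B :: "nat \<Rightarrow> 'i set"
    and \<epsilon> :: "'a \<Rightarrow> 'k" and \<tau> :: "'m \<Rightarrow> 'k"
  assumes M: "left_module A M"
    and X: "projective_resolution A M X" and Y: "projective_resolution A M Y"
    and objY: "\<And>n. obj Y n = free_lmod A (B n)" and finite_B: "\<And>n. finite (B n)"
    and minimal: "\<forall>n. \<forall>f\<in>lmod_hom A (obj Y n) M. \<forall>y\<in>carrier (obj Y (Suc n)). f (diff Y n y) = \<zero>\<^bsub>M\<^esub>"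
    and \<tau>_bij: "bij_betw \<tau> (carrier M) UNIV"
    and \<tau>_add: "\<And>x y. x \<in> carrier M \<Longrightarrow> y \<in> carrier M \<Longrightarrow> \<tau> (x \<oplus>\<^bsub>M\<^esub> y) = \<tau> x + \<tau> y"
    and \<tau>_smult: "\<And>a x. a \<in> carrier A \<Longrightarrow> x \<in> carrier M \<Longrightarrow> \<tau> (a \<odot>\<^bsub>M\<^esub> x) = \<epsilon> a * \<tau> x"
    and scal: "\<And>c. c \<odot>\<^bsub>A\<^esub> \<one>\<^bsub>A\<^esub> \<in> carrier A" "\<And>c. \<epsilon> (c \<odot>\<^bsub>A\<^esub> \<one>\<^bsub>A\<^esub>) = c"
begin

interpretation M: left_module A M by (rule M)

section \<open>The one-dimensional module and its groups of cocycles\<close>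

lemma \<tau>_zero: "\<tau> \<zero>\<^bsub>M\<^esub> = 0"
  using \<tau>_add[of "\<zero>\<^bsub>M\<^esub>" "\<zero>\<^bsub>M\<^esub>"] by (metis add_cancel_left_left M.M.l_zero M.M.zero_closed)

lemma \<tau>_eq_0: "x \<in> carrier M \<Longrightarrow> \<tau> x = 0 \<Longrightarrow> x = \<zero>\<^bsub>M\<^esub>"
  using inj_onD[OF bij_betw_imp_inj_on[OF \<tau>_bij], of x "\<zero>\<^bsub>M\<^esub>"] \<tau>_zero by simp

text \<open>The ring is not commutative, but it acts through \<open>\<epsilon>\<close> into a field.
  Hence pointwise multiples of homomorphisms are again homomorphisms
  (\<open>cocycles_smultI\<close>).\<close>

lemma smult_commute:
  assumes "a \<in> carrier A" "b \<in> carrier A" "x \<in> carrier M"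
  shows "a \<odot>\<^bsub>M\<^esub> (b \<odot>\<^bsub>M\<^esub> x) = b \<odot>\<^bsub>M\<^esub> (a \<odot>\<^bsub>M\<^esub> x)"
proof -
  have "\<tau> (a \<odot>\<^bsub>M\<^esub> (b \<odot>\<^bsub>M\<^esub> x)) = \<tau> (b \<odot>\<^bsub>M\<^esub> (a \<odot>\<^bsub>M\<^esub> x))"
    using assms by (simp add: \<tau>_smult M.smult_closed)
  then show ?thesis
    by (rule inj_onD[OF bij_betw_imp_inj_on[OF \<tau>_bij]]) (simp_all add: assms M.smult_closed)
qed

text \<open>Despite the name, the carrier consists of the cocycles: this is the group that
  \<open>Ext\<close> divides by the coboundaries.\<close>

definition cochains :: "nat \<Rightarrow> ('k, 'p \<Rightarrow> 'm) module" where
  "cochains n = (hom_space A (obj X n) M)\<lparr>carrier := cocycles A X M n\<rparr>"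

lemma cocycles_homD: "f \<in> cocycles A X M n \<Longrightarrow> f \<in> lmod_hom A (obj X n) M"
  by (simp add: cocycles_def)

lemma cocycles_addI:
  assumes f: "f \<in> cocycles A X M n" and g: "g \<in> cocycles A X M n"
  shows "(\<lambda>x\<in>carrier (obj X n). f x \<oplus>\<^bsub>M\<^esub> g x) \<in> cocycles A X M n"
proof -
  note DX = projective_resolutionD[OF X]
  note fh = lmod_homD[OF cocycles_homD[OF f]] and gh = lmod_homD[OF cocycles_homD[OF g]]
  have "(\<lambda>x\<in>carrier (obj X n). f x \<oplus>\<^bsub>M\<^esub> g x) \<in> lmod_hom A (obj X n) M"
    by (rule lmod_hom_restrictI[OF DX(2)])
      (simp_all add: fh(1-3) gh(1-3) M.smult_r_distr M.M.a_ac)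
  then show ?thesis using f g lmod_homD(1)[OF DX(3)] by (auto simp: cocycles_def)
qed

lemma cocycles_smultI:
  assumes f: "f \<in> cocycles A X M n" and b: "b \<in> carrier A"
  shows "(\<lambda>x\<in>carrier (obj X n). b \<odot>\<^bsub>M\<^esub> f x) \<in> cocycles A X M n"
proof -
  note DX = projective_resolutionD[OF X]
  note fh = lmod_homD[OF cocycles_homD[OF f]]
  have "(\<lambda>x\<in>carrier (obj X n). b \<odot>\<^bsub>M\<^esub> f x) \<in> lmod_hom A (obj X n) M"
    by (rule lmod_hom_restrictI[OF DX(2)])
      (simp_all add: fh(1-3) b M.smult_r_distr M.smult_closed smult_commute[OF b])
  then show ?thesis using f b lmod_homD(1)[OF DX(3)] M.smult_zero_right[OF b]
    by (auto simp: cocycles_def)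
qed

lemma zero_cocycle: "(\<lambda>x\<in>carrier (obj X n). \<zero>\<^bsub>M\<^esub>) \<in> cocycles A X M n"
proof -
  note DX = projective_resolutionD[OF X]
  have "(\<lambda>x\<in>carrier (obj X n). \<zero>\<^bsub>M\<^esub>) \<in> lmod_hom A (obj X n) M"
    by (rule lmod_hom_restrictI[OF DX(2)]) (simp_all add: M.smult_zero_right)
  then show ?thesis using lmod_homD(1)[OF DX(3)] by (auto simp: cocycles_def)
qed

lemma cochains_simps:
  "carrier (cochains n) = cocycles A X M n"
  "f \<oplus>\<^bsub>cochains n\<^esub> g = (\<lambda>x\<in>carrier (obj X n). f x \<oplus>\<^bsub>M\<^esub> g x)"
  "\<zero>\<^bsub>cochains n\<^esub> = (\<lambda>x\<in>carrier (obj X n). \<zero>\<^bsub>M\<^esub>)"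
  "c \<odot>\<^bsub>cochains n\<^esub> f = (\<lambda>x\<in>carrier (obj X n). (c \<odot>\<^bsub>A\<^esub> \<one>\<^bsub>A\<^esub>) \<odot>\<^bsub>M\<^esub> f x)"
  by (simp_all add: cochains_def hom_space_def)

lemma abelian_group_cochains: "abelian_group (cochains n)"
proof (rule abelian_groupI, unfold cochains_simps)
  fix f assume f: "f \<in> cocycles A X M n"
  note fh = lmod_homD[OF cocycles_homD[OF f]]
  show "(\<lambda>x\<in>carrier (obj X n). (\<lambda>x\<in>carrier (obj X n). \<zero>\<^bsub>M\<^esub>) x \<oplus>\<^bsub>M\<^esub> f x) = f"
    by (rule extensionalityI[OF _ fh(4)]) (simp_all add: fh)
  \<comment> \<open>Negation is taken as multiplication by -1 of the ring, so that
    \<open>cocycles_smultI\<close> provides closure.\<close>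
  have m: "\<ominus>\<^bsub>A\<^esub> \<one>\<^bsub>A\<^esub> \<in> carrier A" by simp
  have neg: "(\<ominus>\<^bsub>A\<^esub> \<one>\<^bsub>A\<^esub>) \<odot>\<^bsub>M\<^esub> y \<oplus>\<^bsub>M\<^esub> y = \<zero>\<^bsub>M\<^esub>" if y: "y \<in> carrier M" for y
    using M.smult_l_distr[of "\<ominus>\<^bsub>A\<^esub> \<one>\<^bsub>A\<^esub>" "\<one>\<^bsub>A\<^esub>" y] y
    by (simp add: M.R.l_neg M.smult_one M.smult_zero_left)
  show "\<exists>g\<in>cocycles A X M n. (\<lambda>x\<in>carrier (obj X n). g x \<oplus>\<^bsub>M\<^esub> f x) = (\<lambda>x\<in>carrier (obj X n). \<zero>\<^bsub>M\<^esub>)"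
    by (rule bexI[OF _ cocycles_smultI[OF f m]]) (auto simp: neg fh(1) intro!: restrict_ext)
next
  fix f g assume f: "f \<in> cocycles A X M n" and g: "g \<in> cocycles A X M n"
  note fh = lmod_homD[OF cocycles_homD[OF f]] and gh = lmod_homD[OF cocycles_homD[OF g]]
  show "(\<lambda>x\<in>carrier (obj X n). f x \<oplus>\<^bsub>M\<^esub> g x) = (\<lambda>x\<in>carrier (obj X n). g x \<oplus>\<^bsub>M\<^esub> f x)"
    by (auto simp: fh(1) gh(1) M.M.a_comm intro!: restrict_ext)
  fix h assume h: "h \<in> cocycles A X M n"
  note hh = lmod_homD[OF cocycles_homD[OF h]]
  show "(\<lambda>x\<in>carrier (obj X n). (\<lambda>x\<in>carrier (obj X n). f x \<oplus>\<^bsub>M\<^esub> g x) x \<oplus>\<^bsub>M\<^esub> h x) =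
    (\<lambda>x\<in>carrier (obj X n). f x \<oplus>\<^bsub>M\<^esub> (\<lambda>x\<in>carrier (obj X n). g x \<oplus>\<^bsub>M\<^esub> h x) x)"
    by (auto simp: fh(1) gh(1) hh(1) M.M.a_assoc intro!: restrict_ext)
qed (rule cocycles_addI, assumption+ | rule zero_cocycle)+

text \<open>Generators of \<open>Y\<close>, moved to \<open>X\<close> by a comparison map, detect cohomology classes.\<close>

definition test_pts :: "(nat \<Rightarrow> 'i \<Rightarrow> 'p) \<Rightarrow> bool" where
  "test_pts p \<longleftrightarrow> (\<forall>n. \<forall>\<beta>\<in>B n. p n \<beta> \<in> carrier (obj X n)) \<and>
    (\<forall>n. coboundaries A X M n = {f \<in> cocycles A X M n. \<forall>\<beta>\<in>B n. \<tau> (f (p n \<beta>)) = 0}) \<and>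
    (\<forall>n c. \<exists>f\<in>cocycles A X M n. \<forall>\<beta>\<in>B n. \<tau> (f (p n \<beta>)) = c \<beta>)"

lemma coboundaries_subset: "coboundaries A X M n \<subseteq> cocycles A X M n"
proof (cases n)
  case 0 then show ?thesis using zero_cocycle[of 0] by simp
next
  case (Suc m)
  note DX = projective_resolutionD[OF X]
  have "compose (carrier (obj X (Suc m))) h (diff X m) \<in> cocycles A X M (Suc m)"
    if h: "h \<in> lmod_hom A (obj X m) M" for h
    using lmod_hom_compose[OF DX(2) DX(3) h] lmod_homD(1)[OF DX(3)] diff_diff[OF X]
      lmod_hom_zero[OF DX(2) M h]
    by (auto simp: cocycles_def compose_def)
  then show ?thesis using Suc by auto
qed

text \<open>The points are the images of the free generators of \<open>Y\<close> under the
  comparison map. A homomorphism on a free module vanishes if it does so on generators, and its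
  values there can be prescribed.\<close>

lemma test_pts_exist: "\<exists>p. test_pts p"
proof -
  note DY = projective_resolutionD[OF Y]
  have A: "ring A" using M.R.ring_axioms .
  from minimal_resolution_eval[OF M M X Y minimal] obtain F where F: "chain_map A Y X F"
    and a: "\<forall>n. \<forall>f\<in>coboundaries A X M n. \<forall>y\<in>carrier (obj Y n). f (F n y) = \<zero>\<^bsub>M\<^esub>"
    and b: "\<forall>n. \<forall>f\<in>cocycles A X M n. (\<forall>y\<in>carrier (obj Y n). f (F n y) = \<zero>\<^bsub>M\<^esub>) \<longrightarrow>
      f \<in> coboundaries A X M n"
    and c: "\<forall>n. \<forall>g\<in>lmod_hom A (obj Y n) M.
      \<exists>f\<in>cocycles A X M n. \<forall>y\<in>carrier (obj Y n). f (F n y) = g y"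
    by (elim exE conjE)
  have u: "unit_vec A \<beta> \<in> carrier (obj Y n)" if "\<beta> \<in> B n" for \<beta> n
    unfolding objY by (rule unit_vec_carrier[OF A that])
  define p where "p n \<beta> = F n (unit_vec A \<beta>)" for n \<beta>
  have "p n \<beta> \<in> carrier (obj X n)" if "\<beta> \<in> B n" for n \<beta>
    unfolding p_def using lmod_homD(1)[OF chain_mapD(1)[OF F] u[OF that]] .
  moreover have "coboundaries A X M n = {f \<in> cocycles A X M n. \<forall>\<beta>\<in>B n. \<tau> (f (p n \<beta>)) = 0}" for n
  proof (intro equalityI subsetI)
    fix f assume f: "f \<in> coboundaries A X M n"
    have "\<tau> (f (p n \<beta>)) = 0" if "\<beta> \<in> B n" for \<beta>
      unfolding p_def by (simp only: a[rule_format, OF f u[OF that]] \<tau>_zero)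
    then show "f \<in> {f \<in> cocycles A X M n. \<forall>\<beta>\<in>B n. \<tau> (f (p n \<beta>)) = 0}"
      using subsetD[OF coboundaries_subset f] by simp
  next
    fix f assume "f \<in> {f \<in> cocycles A X M n. \<forall>\<beta>\<in>B n. \<tau> (f (p n \<beta>)) = 0}"
    then have f: "f \<in> cocycles A X M n" and z: "\<And>\<beta>. \<beta> \<in> B n \<Longrightarrow> \<tau> (f (p n \<beta>)) = 0" by auto
    note fh = cocycles_homD[OF f]
    have z': "f (F n (unit_vec A \<beta>)) = \<zero>\<^bsub>M\<^esub>" if "\<beta> \<in> B n" for \<beta>
      using \<tau>_eq_0[OF lmod_homD(1)[OF fh lmod_homD(1)[OF chain_mapD(1)[OF F] u[OF that]]]] z[OF that]
      by (simp add: p_def)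
    have fF: "(\<lambda>y\<in>carrier (obj Y n). f (F n y)) \<in> lmod_hom A (free_lmod A (B n)) M"
      using lmod_hom_compose[OF DY(2) chain_mapD(1)[OF F] fh] by (simp add: objY)
    have z0: "(\<lambda>y\<in>carrier (obj Y n). \<zero>\<^bsub>M\<^esub>) \<in> lmod_hom A (free_lmod A (B n)) M"
      unfolding objY by (rule lmod_hom_restrictI[OF left_module_free_lmod[OF A]])
        (simp_all add: M.smult_zero_right)
    have "f (F n y) = \<zero>\<^bsub>M\<^esub>" if y: "y \<in> carrier (obj Y n)" for y
      using free_lmod_hom_eqI[OF A M fF z0, of y] z' u y by (simp add: objY)
    then show "f \<in> coboundaries A X M n" by (rule b[rule_format, OF f])
  qed
  moreover have "\<exists>f\<in>cocycles A X M n. \<forall>\<beta>\<in>B n. \<tau> (f (p n \<beta>)) = c \<beta>" for n c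
  proof -
    have inv: "inv_into (carrier M) \<tau> r \<in> carrier M" "\<tau> (inv_into (carrier M) \<tau> r) = r" for r
      using \<tau>_bij by (simp_all add: bij_betw_def inv_into_into f_inv_into_f)
    from free_lmod_hom_exists[OF A M inv(1), of "B n" c] obtain g
      where g: "g \<in> lmod_hom A (free_lmod A (B n)) M"
        "\<forall>\<beta>\<in>B n. g (unit_vec A \<beta>) = inv_into (carrier M) \<tau> (c \<beta>)" ..
    have "g \<in> lmod_hom A (obj Y n) M" using g(1) by (simp add: objY)
    from c[THEN spec, THEN bspec, OF this] obtain f
      where "f \<in> cocycles A X M n" "\<forall>y\<in>carrier (obj Y n). f (F n y) = g y" ..
    then show ?thesis using g(2) u inv(2) by (intro bexI[of _ f]) (auto simp: p_def)
  qed
  ultimately have "test_pts p" unfolding test_pts_def by (intro conjI allI ballI)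
  then show ?thesis by (rule exI[of _ p])
qed

definition pts :: "nat \<Rightarrow> 'i \<Rightarrow> 'p" where "pts = (SOME p. test_pts p)"

lemma pts:
  shows "\<beta> \<in> B n \<Longrightarrow> pts n \<beta> \<in> carrier (obj X n)"
    and "coboundaries A X M n = {f \<in> cocycles A X M n. \<forall>\<beta>\<in>B n. \<tau> (f (pts n \<beta>)) = 0}"
    and "\<exists>f\<in>cocycles A X M n. \<forall>\<beta>\<in>B n. \<tau> (f (pts n \<beta>)) = c \<beta>"
proof -
  have "test_pts pts" unfolding pts_def by (rule someI_ex[OF test_pts_exist])
  then have t: "\<forall>n. \<forall>\<beta>\<in>B n. pts n \<beta> \<in> carrier (obj X n)"
    "\<forall>n. coboundaries A X M n = {f \<in> cocycles A X M n. \<forall>\<beta>\<in>B n. \<tau> (f (pts n \<beta>)) = 0}"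
    "\<forall>n c. \<exists>f\<in>cocycles A X M n. \<forall>\<beta>\<in>B n. \<tau> (f (pts n \<beta>)) = c \<beta>"
    unfolding test_pts_def by simp_all
  show "\<beta> \<in> B n \<Longrightarrow> pts n \<beta> \<in> carrier (obj X n)" using t(1) by blast
  show "coboundaries A X M n = {f \<in> cocycles A X M n. \<forall>\<beta>\<in>B n. \<tau> (f (pts n \<beta>)) = 0}"
    by (rule t(2)[rule_format])
  show "\<exists>f\<in>cocycles A X M n. \<forall>\<beta>\<in>B n. \<tau> (f (pts n \<beta>)) = c \<beta>"
    by (rule t(3)[THEN spec, THEN spec])
qed

lemma \<tau>_cochain_add:
  assumes "f \<in> cocycles A X M n" "g \<in> cocycles A X M n" "\<beta> \<in> B n"
  shows "\<tau> ((f \<oplus>\<^bsub>cochains n\<^esub> g) (pts n \<beta>)) = \<tau> (f (pts n \<beta>)) + \<tau> (g (pts n \<beta>))"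
  using pts(1)[OF assms(3)] lmod_homD(1)[OF cocycles_homD[OF assms(1)]]
    lmod_homD(1)[OF cocycles_homD[OF assms(2)]] by (simp add: cochains_simps(2) \<tau>_add)

lemma \<tau>_cochain_smult:
  assumes "f \<in> cocycles A X M n" "\<beta> \<in> B n"
  shows "\<tau> ((c \<odot>\<^bsub>cochains n\<^esub> f) (pts n \<beta>)) = c * \<tau> (f (pts n \<beta>))"
  using pts(1)[OF assms(2)] lmod_homD(1)[OF cocycles_homD[OF assms(1)]] scal
  by (simp add: cochains_simps(4) \<tau>_smult)

text \<open>The second part of \<open>pts\<close> presents coboundaries as the common zeros of
  additive functionals, which treats degree 0 and the images of differentials alike.\<close>

lemma additive_subgroup_coboundaries: "additive_subgroup (coboundaries A X M n) (cochains n)"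
proof (rule additive_subgroupI, rule group.subgroupI)
  interpret C: abelian_group "cochains n" by (rule abelian_group_cochains)
  show "Group.group (add_monoid (cochains n))" by (rule C.a_group)
  have z: "\<zero>\<^bsub>cochains n\<^esub> \<in> coboundaries A X M n"
    unfolding pts(2) cochains_simps(3) using zero_cocycle pts(1) \<tau>_zero by auto
  show "coboundaries A X M n \<noteq> {}" using z by blast
  show "coboundaries A X M n \<subseteq> carrier (add_monoid (cochains n))"
    using coboundaries_subset[of n] by (simp add: cochains_simps)
  have add: "f \<oplus>\<^bsub>cochains n\<^esub> g \<in> coboundaries A X M n"
    if "f \<in> coboundaries A X M n" "g \<in> coboundaries A X M n" for f g
    using that \<tau>_cochain_add[of f n g] cocycles_addI[of f n g] cochains_simps(2) unfolding pts(2) by auto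
  then show "f \<otimes>\<^bsub>add_monoid (cochains n)\<^esub> g \<in> coboundaries A X M n"
    if "f \<in> coboundaries A X M n" "g \<in> coboundaries A X M n" for f g
    using that by simp
  fix f assume f: "f \<in> coboundaries A X M n"
  have fc: "f \<in> carrier (cochains n)" using f coboundaries_subset[of n] by (auto simp: cochains_simps(1))
  have nc: "\<ominus>\<^bsub>cochains n\<^esub> f \<in> carrier (cochains n)" using fc by (rule C.a_inv_closed)
  have "\<tau> ((\<ominus>\<^bsub>cochains n\<^esub> f) (pts n \<beta>)) = 0" if \<beta>: "\<beta> \<in> B n" for \<beta>
  proof -
    have "\<tau> ((\<ominus>\<^bsub>cochains n\<^esub> f \<oplus>\<^bsub>cochains n\<^esub> f) (pts n \<beta>)) = 0"
      unfolding C.l_neg[OF fc] using z \<beta> by (simp add: pts(2))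
    then show ?thesis
      using \<tau>_cochain_add[OF nc[unfolded cochains_simps(1)] fc[unfolded cochains_simps(1)] \<beta>] f \<beta>
      by (simp add: pts(2))
  qed
  then show "inv\<^bsub>add_monoid (cochains n)\<^esub> f \<in> coboundaries A X M n"
    using nc unfolding pts(2) a_inv_def cochains_simps(1) by simp
qed

section \<open>Ext groups and their coordinates\<close>

lemma Ext_eq: "Ext A X M n = quot_module (cochains n) (coboundaries A X M n)"
  by (simp add: Ext_def cochains_def)

lemma abelian_group_Ext: "abelian_group (Ext A X M n)"
  unfolding Ext_eq by (rule abelian_group_quot_module[OF abelian_group_cochains additive_subgroup_coboundaries])

abbreviation cls where "cls n f \<equiv> coboundaries A X M n +>\<^bsub>cochains n\<^esub> f"

lemma Ext_simps:
  shows "carrier (Ext A X M n) = cls n ` cocycles A X M n"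
    and "\<zero>\<^bsub>Ext A X M n\<^esub> = coboundaries A X M n"
    and "f \<in> cocycles A X M n \<Longrightarrow> g \<in> cocycles A X M n \<Longrightarrow>
      cls n f \<oplus>\<^bsub>Ext A X M n\<^esub> cls n g = cls n (f \<oplus>\<^bsub>cochains n\<^esub> g)"
    and "f \<in> cocycles A X M n \<Longrightarrow> c \<odot>\<^bsub>Ext A X M n\<^esub> cls n f = cls n (c \<odot>\<^bsub>cochains n\<^esub> f)"
proof -
  note C = abelian_group_cochains and S = additive_subgroup_coboundaries
  show "carrier (Ext A X M n) = cls n ` cocycles A X M n" "\<zero>\<^bsub>Ext A X M n\<^esub> = coboundaries A X M n"
    by (simp_all add: Ext_eq quot_module_simps cochains_simps)
  show "cls n f \<oplus>\<^bsub>Ext A X M n\<^esub> cls n g = cls n (f \<oplus>\<^bsub>cochains n\<^esub> g)"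
    if "f \<in> cocycles A X M n" "g \<in> cocycles A X M n"
    unfolding Ext_eq by (rule quot_module_add[OF C S]) (use that in \<open>simp_all add: cochains_simps\<close>)
  have sm: "c \<odot>\<^bsub>cochains n\<^esub> g \<in> cocycles A X M n" if "g \<in> cocycles A X M n" for g
    unfolding cochains_simps using cocycles_smultI[OF that scal(1)] .
  show "c \<odot>\<^bsub>Ext A X M n\<^esub> cls n f = cls n (c \<odot>\<^bsub>cochains n\<^esub> f)" if "f \<in> cocycles A X M n"
    unfolding Ext_eq
  proof (rule quot_module_smult[OF C S])
    fix g h assume "g \<in> carrier (cochains n)" "h \<in> carrier (cochains n)"
    then have g: "g \<in> cocycles A X M n" and h: "h \<in> cocycles A X M n"
      by (simp_all add: cochains_simps)
    show "c \<odot>\<^bsub>cochains n\<^esub> (g \<oplus>\<^bsub>cochains n\<^esub> h) = c \<odot>\<^bsub>cochains n\<^esub> g \<oplus>\<^bsub>cochains n\<^esub> c \<odot>\<^bsub>cochains n\<^esub> h"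
      unfolding cochains_simps
      using lmod_homD(1)[OF cocycles_homD[OF g]] lmod_homD(1)[OF cocycles_homD[OF h]] scal(1)
      by (auto simp: M.smult_r_distr intro!: restrict_ext)
  next
    fix g assume "g \<in> coboundaries A X M n"
    then show "c \<odot>\<^bsub>cochains n\<^esub> g \<in> coboundaries A X M n"
      using sm[of g] \<tau>_cochain_smult[of g n _ c] unfolding pts(2) by simp
  qed (simp_all add: cochains_simps(1) that sm)
qed

text \<open>An Ext class is a set of cocycles, and any of its members may be evaluated, because
  coboundaries vanish at the test points (\<open>coord_cls\<close>).\<close>

definition coord :: "nat \<Rightarrow> ('p \<Rightarrow> 'm) set \<Rightarrow> 'i \<Rightarrow> 'k" where
  "coord n \<alpha> \<beta> = \<tau> ((SOME f. f \<in> \<alpha>) (pts n \<beta>))"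

lemma coord_cls:
  assumes f: "f \<in> cocycles A X M n" and \<beta>: "\<beta> \<in> B n"
  shows "coord n (cls n f) \<beta> = \<tau> (f (pts n \<beta>))"
proof -
  interpret abelian_subgroup "coboundaries A X M n" "cochains n"
    by (rule abelian_subgroupI3[OF additive_subgroup_coboundaries abelian_group_cochains])
  have "f \<in> cls n f" by (rule a_rcos_self) (use f in \<open>simp add: cochains_simps\<close>)
  then have "(SOME g. g \<in> cls n f) \<in> cls n f" by (rule someI[of "\<lambda>g. g \<in> cls n f"])
  then obtain u where u: "u \<in> coboundaries A X M n" "(SOME g. g \<in> cls n f) = u \<oplus>\<^bsub>cochains n\<^esub> f"
    by (rule mem_a_r_cosetE)
  show ?thesis unfolding coord_def u(2)
    using \<tau>_cochain_add[OF _ f \<beta>, of u] u(1) \<beta> by (simp add: pts(2))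
qed

lemma cls_eq_zero:
  assumes f: "f \<in> cocycles A X M n" and "\<And>\<beta>. \<beta> \<in> B n \<Longrightarrow> \<tau> (f (pts n \<beta>)) = 0"
  shows "cls n f = \<zero>\<^bsub>Ext A X M n\<^esub>"
proof -
  interpret abelian_subgroup "coboundaries A X M n" "cochains n"
    by (rule abelian_subgroupI3[OF additive_subgroup_coboundaries abelian_group_cochains])
  have "f \<in> coboundaries A X M n" using assms by (simp add: pts(2))
  then show ?thesis unfolding Ext_simps by (rule a_rcos_const)
qed

section \<open>The graded components of the Yoneda algebra\<close>

abbreviation "\<E> \<equiv> yoneda_algebra A M X"

lemma yoneda_simps:
  "carrier \<E> = {\<xi>. (\<forall>n. \<xi> n \<in> carrier (Ext A X M n)) \<and> finite {n. \<xi> n \<noteq> \<zero>\<^bsub>Ext A X M n\<^esub>}}"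
  "\<zero>\<^bsub>\<E>\<^esub> = (\<lambda>n. \<zero>\<^bsub>Ext A X M n\<^esub>)"
  "\<xi> \<oplus>\<^bsub>\<E>\<^esub> \<eta> = (\<lambda>n. \<xi> n \<oplus>\<^bsub>Ext A X M n\<^esub> \<eta> n)"
  "c \<odot>\<^bsub>\<E>\<^esub> \<xi> = (\<lambda>n. c \<odot>\<^bsub>Ext A X M n\<^esub> \<xi> n)"
  by (simp_all add: yoneda_algebra_def)

lemma abelian_group_yoneda: "abelian_group \<E>"
proof (rule abelian_groupI)
  interpret E: abelian_group "Ext A X M n" for n by (rule abelian_group_Ext)
  show "\<zero>\<^bsub>\<E>\<^esub> \<in> carrier \<E>" by (simp add: yoneda_simps)
  fix \<xi> assume \<xi>: "\<xi> \<in> carrier \<E>"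
  show "\<zero>\<^bsub>\<E>\<^esub> \<oplus>\<^bsub>\<E>\<^esub> \<xi> = \<xi>" using \<xi> by (simp add: yoneda_simps)
  have "{n. \<ominus>\<^bsub>Ext A X M n\<^esub> \<xi> n \<noteq> \<zero>\<^bsub>Ext A X M n\<^esub>} \<subseteq> {n. \<xi> n \<noteq> \<zero>\<^bsub>Ext A X M n\<^esub>}"
    using E.minus_equality[OF E.l_zero[OF E.zero_closed] E.zero_closed E.zero_closed] by force
  then have "(\<lambda>n. \<ominus>\<^bsub>Ext A X M n\<^esub> \<xi> n) \<in> carrier \<E>"
    using \<xi> finite_subset by (simp add: yoneda_simps)
  moreover have "(\<lambda>n. \<ominus>\<^bsub>Ext A X M n\<^esub> \<xi> n) \<oplus>\<^bsub>\<E>\<^esub> \<xi> = \<zero>\<^bsub>\<E>\<^esub>"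
    using \<xi> by (simp add: yoneda_simps E.l_neg)
  ultimately show "\<exists>\<eta>\<in>carrier \<E>. \<eta> \<oplus>\<^bsub>\<E>\<^esub> \<xi> = \<zero>\<^bsub>\<E>\<^esub>" by blast
  fix \<eta> assume \<eta>: "\<eta> \<in> carrier \<E>"
  have "{n. \<xi> n \<oplus>\<^bsub>Ext A X M n\<^esub> \<eta> n \<noteq> \<zero>\<^bsub>Ext A X M n\<^esub>} \<subseteq>
    {n. \<xi> n \<noteq> \<zero>\<^bsub>Ext A X M n\<^esub>} \<union> {n. \<eta> n \<noteq> \<zero>\<^bsub>Ext A X M n\<^esub>}" by auto
  then have "finite {n. \<xi> n \<oplus>\<^bsub>Ext A X M n\<^esub> \<eta> n \<noteq> \<zero>\<^bsub>Ext A X M n\<^esub>}"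
    by (rule finite_subset) (use \<xi> \<eta> in \<open>simp add: yoneda_simps\<close>)
  then show "\<xi> \<oplus>\<^bsub>\<E>\<^esub> \<eta> \<in> carrier \<E>"
    using \<xi> \<eta> by (simp add: yoneda_simps)
  show "\<xi> \<oplus>\<^bsub>\<E>\<^esub> \<eta> = \<eta> \<oplus>\<^bsub>\<E>\<^esub> \<xi>" using \<xi> \<eta> by (simp add: yoneda_simps E.a_comm)
  fix \<zeta> assume \<zeta>: "\<zeta> \<in> carrier \<E>"
  show "\<xi> \<oplus>\<^bsub>\<E>\<^esub> \<eta> \<oplus>\<^bsub>\<E>\<^esub> \<zeta> = \<xi> \<oplus>\<^bsub>\<E>\<^esub> (\<eta> \<oplus>\<^bsub>\<E>\<^esub> \<zeta>)"
    using \<xi> \<eta> \<zeta> by (simp add: yoneda_simps E.a_assoc)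
qed

definition homog :: "nat \<Rightarrow> ('p \<Rightarrow> 'm) \<Rightarrow> nat \<Rightarrow> ('p \<Rightarrow> 'm) set" where
  "homog n f = (\<lambda>m. if m = n then cls n f else \<zero>\<^bsub>Ext A X M m\<^esub>)"

lemma yoneda_component_eq: "yoneda_component A M X n = homog n ` cocycles A X M n"
proof (intro equalityI subsetI)
  fix \<xi> assume \<xi>: "\<xi> \<in> yoneda_component A M X n"
  then have "\<xi> n \<in> carrier (Ext A X M n)" by (simp add: yoneda_component_def yoneda_simps(1))
  then obtain f where f: "f \<in> cocycles A X M n" "\<xi> n = cls n f" unfolding Ext_simps(1) by (rule imageE)
  have "\<xi> = homog n f"
  proof
    show "\<xi> m = homog n f m" for m using \<xi> f(2) by (simp add: homog_def yoneda_component_def)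
  qed
  then show "\<xi> \<in> homog n ` cocycles A X M n" using f(1) by simp
next
  interpret E: abelian_group "Ext A X M n" for n by (rule abelian_group_Ext)
  fix \<xi> assume "\<xi> \<in> homog n ` cocycles A X M n"
  then obtain f where f: "f \<in> cocycles A X M n" "\<xi> = homog n f" by (rule imageE)
  have "finite {m. homog n f m \<noteq> \<zero>\<^bsub>Ext A X M m\<^esub>}"
    by (rule finite_subset[of _ "{n}"]) (simp_all add: homog_def subset_iff)
  moreover have "cls n f \<in> carrier (Ext A X M n)" unfolding Ext_simps(1) using f(1) by (rule imageI)
  then have "homog n f m \<in> carrier (Ext A X M m)" for m
    by (simp add: homog_def)
  ultimately show "\<xi> \<in> yoneda_component A M X n"
    unfolding f(2) by (simp add: yoneda_component_def yoneda_simps(1)) (simp add: homog_def)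
qed

lemma cocycles_smult_closed: "f \<in> cocycles A X M n \<Longrightarrow> c \<odot>\<^bsub>cochains n\<^esub> f \<in> cocycles A X M n"
  unfolding cochains_simps using cocycles_smultI scal(1) by blast

lemma cocycles_add_closed:
  "f \<in> cocycles A X M n \<Longrightarrow> g \<in> cocycles A X M n \<Longrightarrow> f \<oplus>\<^bsub>cochains n\<^esub> g \<in> cocycles A X M n"
  unfolding cochains_simps by (rule cocycles_addI)

lemma cls_zero_cocycle: "cls n (\<lambda>x\<in>carrier (obj X n). \<zero>\<^bsub>M\<^esub>) = \<zero>\<^bsub>Ext A X M n\<^esub>"
  by (rule cls_eq_zero[OF zero_cocycle]) (simp add: pts(1) \<tau>_zero)

lemma Ext_smult_zero: "c \<odot>\<^bsub>Ext A X M n\<^esub> \<zero>\<^bsub>Ext A X M n\<^esub> = \<zero>\<^bsub>Ext A X M n\<^esub>"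
proof -
  have "cls n (c \<odot>\<^bsub>cochains n\<^esub> (\<lambda>x\<in>carrier (obj X n). \<zero>\<^bsub>M\<^esub>)) = \<zero>\<^bsub>Ext A X M n\<^esub>"
    by (rule cls_eq_zero[OF cocycles_smult_closed[OF zero_cocycle]])
      (simp add: \<tau>_cochain_smult[OF zero_cocycle] pts(1) \<tau>_zero)
  then show ?thesis using Ext_simps(4)[OF zero_cocycle, where c = c] by (simp only: cls_zero_cocycle)
qed

lemma homog_zero: "homog n (\<lambda>x\<in>carrier (obj X n). \<zero>\<^bsub>M\<^esub>) = \<zero>\<^bsub>\<E>\<^esub>"
  unfolding homog_def yoneda_simps cls_zero_cocycle by (intro ext) simp

lemma homog_add:
  assumes "f \<in> cocycles A X M n" "g \<in> cocycles A X M n"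
  shows "homog n f \<oplus>\<^bsub>\<E>\<^esub> homog n g = homog n (f \<oplus>\<^bsub>cochains n\<^esub> g)"
proof -
  interpret E: abelian_group "Ext A X M n" for n by (rule abelian_group_Ext)
  show ?thesis unfolding yoneda_simps homog_def
    by (rule ext) (simp add: Ext_simps(3)[OF assms])
qed

lemma homog_smult:
  assumes "f \<in> cocycles A X M n"
  shows "c \<odot>\<^bsub>\<E>\<^esub> homog n f = homog n (c \<odot>\<^bsub>cochains n\<^esub> f)"
  unfolding yoneda_simps homog_def
  by (rule ext) (simp add: Ext_simps(4)[OF assms] Ext_smult_zero)

lemma coord_homog:
  "f \<in> cocycles A X M n \<Longrightarrow> \<beta> \<in> B n \<Longrightarrow> coord n (homog n f n) \<beta> = \<tau> (f (pts n \<beta>))"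
  by (simp add: homog_def coord_cls)

text \<open>The values at the test points identify the component of degree \<open>n\<close> with the
  functions from \<open>B n\<close> to k.\<close>

theorem vdim_yoneda_component:
  "vdim (yoneda_algebra A M X) (yoneda_component A M X n) = enat (card (B n))"
proof (rule vdim_eq_card[where \<Phi> = "\<lambda>\<xi>. coord n (\<xi> n)"])
  show "abelian_group \<E>" by (rule abelian_group_yoneda)
  show "yoneda_component A M X n \<subseteq> carrier \<E>" unfolding yoneda_component_def by (rule Collect_restrict)
  show "finite (B n)" by (rule finite_B)
  show "\<zero>\<^bsub>\<E>\<^esub> \<in> yoneda_component A M X n"
    unfolding yoneda_component_eq homog_zero[symmetric, of n] by (rule imageI[OF zero_cocycle])
  show "\<exists>\<xi>\<in>yoneda_component A M X n. \<forall>\<beta>\<in>B n. coord n (\<xi> n) \<beta> = c \<beta>" for c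
  proof -
    from pts(3)[of n c] obtain f where f: "f \<in> cocycles A X M n" "\<forall>\<beta>\<in>B n. \<tau> (f (pts n \<beta>)) = c \<beta>" ..
    then show ?thesis unfolding yoneda_component_eq by (intro bexI[OF _ imageI[OF f(1)]]) (simp add: coord_homog)
  qed
next
  fix \<xi> assume "\<xi> \<in> yoneda_component A M X n"
  then obtain f where f: "f \<in> cocycles A X M n" and \<xi>: "\<xi> = homog n f"
    unfolding yoneda_component_eq by (rule imageE)
  show "c \<odot>\<^bsub>\<E>\<^esub> \<xi> \<in> yoneda_component A M X n" for c
    unfolding \<xi> homog_smult[OF f] yoneda_component_eq by (rule imageI[OF cocycles_smult_closed[OF f]])
  show "coord n ((c \<odot>\<^bsub>\<E>\<^esub> \<xi>) n) \<beta> = c * coord n (\<xi> n) \<beta>" if "\<beta> \<in> B n" for c \<beta>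
    unfolding \<xi> homog_smult[OF f] coord_homog[OF cocycles_smult_closed[OF f] that] coord_homog[OF f that]
    by (rule \<tau>_cochain_smult[OF f that])
  show "\<xi> = \<zero>\<^bsub>\<E>\<^esub>" if z: "\<And>\<beta>. \<beta> \<in> B n \<Longrightarrow> coord n (\<xi> n) \<beta> = 0"
  proof -
    have "cls n f = \<zero>\<^bsub>Ext A X M n\<^esub>"
      by (rule cls_eq_zero[OF f]) (use z coord_homog[OF f] \<xi> in simp)
    then show ?thesis unfolding \<xi> homog_def yoneda_simps by (intro ext) simp
  qed
  fix \<eta> assume "\<eta> \<in> yoneda_component A M X n"
  then obtain g where g: "g \<in> cocycles A X M n" and \<eta>: "\<eta> = homog n g"
    unfolding yoneda_component_eq by (rule imageE)
  show "\<xi> \<oplus>\<^bsub>\<E>\<^esub> \<eta> \<in> yoneda_component A M X n"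
    unfolding \<xi> \<eta> homog_add[OF f g] yoneda_component_eq by (rule imageI[OF cocycles_add_closed[OF f g]])
  show "coord n ((\<xi> \<oplus>\<^bsub>\<E>\<^esub> \<eta>) n) \<beta> = coord n (\<xi> n) \<beta> + coord n (\<eta> n) \<beta>" if "\<beta> \<in> B n" for \<beta>
    unfolding \<xi> \<eta> homog_add[OF f g] coord_homog[OF cocycles_add_closed[OF f g] that]
      coord_homog[OF f that] coord_homog[OF g that]
    by (rule \<tau>_cochain_add[OF f g that])
qed

end

section \<open>Monomial algebras and their minimal resolution\<close>

subsection \<open>The tensor algebra\<close>

lemma tensor_algebra_simps:
  "f \<in> carrier (tensor_algebra s) \<longleftrightarrow> finite {w. f w \<noteq> 0} \<and> {w. f w \<noteq> 0} \<subseteq> words s"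
  "(f \<otimes>\<^bsub>tensor_algebra s\<^esub> g) w = (\<Sum>i\<le>length w. f (take i w) * g (drop i w))"
  "\<one>\<^bsub>tensor_algebra s\<^esub> = mon []"
  "\<zero>\<^bsub>tensor_algebra s\<^esub> = (\<lambda>w. 0)"
  "f \<oplus>\<^bsub>tensor_algebra s\<^esub> g = (\<lambda>w. f w + g w)"
  "c \<odot>\<^bsub>tensor_algebra s\<^esub> f = (\<lambda>w. c * f w)"
  by (simp_all add: tensor_algebra_def mon_def fun_eq_iff)

lemma carrierT_supp: "f \<in> carrier (tensor_algebra s) \<Longrightarrow> f w \<noteq> 0 \<Longrightarrow> w \<in> words s"
  unfolding tensor_algebra_simps by blast

lemma carrierT_mono:
  assumes "f \<in> carrier (tensor_algebra s)" "\<And>w. g w \<noteq> 0 \<Longrightarrow> f w \<noteq> 0"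
  shows "g \<in> carrier (tensor_algebra s)"
proof -
  have "{w. g w \<noteq> 0} \<subseteq> {w. f w \<noteq> 0}" using assms(2) by blast
  then show ?thesis using assms(1) finite_subset[of "{w. g w \<noteq> 0}"] unfolding tensor_algebra_simps
    by (metis (no_types, lifting) subset_trans)
qed

lemma carrierT_add:
  assumes "f \<in> carrier (tensor_algebra s)" "g \<in> carrier (tensor_algebra s)"
  shows "f \<oplus>\<^bsub>tensor_algebra s\<^esub> g \<in> carrier (tensor_algebra s)"
proof -
  have "{w. f w + g w \<noteq> 0} \<subseteq> {w. f w \<noteq> 0} \<union> {w. g w \<noteq> 0}" by auto
  then show ?thesis using assms finite_subset[of "{w. f w + g w \<noteq> 0}"] unfolding tensor_algebra_simps
    by (metis (no_types, lifting) finite_UnI le_sup_iff subset_trans)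
qed

lemma carrierT_mult:
  assumes "f \<in> carrier (tensor_algebra s)" "g \<in> carrier (tensor_algebra s)"
  shows "f \<otimes>\<^bsub>tensor_algebra s\<^esub> g \<in> carrier (tensor_algebra s)"
proof -
  let ?S = "{w. (f \<otimes>\<^bsub>tensor_algebra s\<^esub> g) w \<noteq> 0}"
  let ?P = "(\<lambda>(u, v). u @ v) ` ({w. f w \<noteq> 0} \<times> {w. g w \<noteq> 0})"
  have sub: "?S \<subseteq> ?P"
  proof
    fix w assume "w \<in> ?S"
    then have "(\<Sum>i\<le>length w. f (take i w) * g (drop i w)) \<noteq> 0" by (simp add: tensor_algebra_simps)
    then obtain i where "f (take i w) * g (drop i w) \<noteq> 0" by (meson sum.neutral)
    then have "(take i w, drop i w) \<in> {w. f w \<noteq> 0} \<times> {w. g w \<noteq> 0}" by simp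
    from imageI[OF this, of "\<lambda>(u, v). u @ v"] show "w \<in> ?P" by simp
  qed
  have "finite ?P" using assms by (simp add: tensor_algebra_simps)
  moreover have "?P \<subseteq> words s"
    using carrierT_supp[OF assms(1)] carrierT_supp[OF assms(2)] by (auto simp: in_lists_conv_set)
  ultimately show ?thesis
    unfolding tensor_algebra_simps(1) by (intro conjI finite_subset[OF sub] subset_trans[OF sub])
qed

lemma mon_carrier: "w \<in> words s \<Longrightarrow> mon w \<in> carrier (tensor_algebra s)"
proof -
  assume w: "w \<in> words s"
  have "{u. (mon w :: nat list \<Rightarrow> 'a) u \<noteq> 0} = {w}" by (auto simp: mon_def)
  then show ?thesis using w by (simp add: tensor_algebra_simps)
qed

text \<open>Both sides sum over pairs of cut positions j \<le> i of the word; the two sums are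
  exchanged and the inner index is shifted by j.\<close>

lemma conv_assoc:
  fixes f g h :: "nat list \<Rightarrow> 'k::field"
  shows "f \<otimes>\<^bsub>tensor_algebra s\<^esub> g \<otimes>\<^bsub>tensor_algebra s\<^esub> h =
    f \<otimes>\<^bsub>tensor_algebra s\<^esub> (g \<otimes>\<^bsub>tensor_algebra s\<^esub> h)"
proof
  fix w :: "nat list"
  let ?n = "length w"
  let ?F = "\<lambda>i j. f (take j w) * g (take (i - j) (drop j w)) * h (drop i w)"
  have "(f \<otimes>\<^bsub>tensor_algebra s\<^esub> g \<otimes>\<^bsub>tensor_algebra s\<^esub> h) w =
    (\<Sum>i\<in>{..?n}. \<Sum>j\<in>{j \<in> {..?n}. j \<le> i}. ?F i j)"
    unfolding tensor_algebra_simps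
  proof (rule sum.cong[OF refl])
    fix i assume "i \<in> {..?n}"
    then have i: "i \<le> ?n" by simp
    then have S: "{..length (take i w)} = {j \<in> {..?n}. j \<le> i}" by auto
    show "(\<Sum>j\<le>length (take i w). f (take j (take i w)) * g (drop j (take i w))) * h (drop i w) =
      (\<Sum>j\<in>{j \<in> {..?n}. j \<le> i}. ?F i j)"
      unfolding S sum_distrib_right
      by (rule sum.cong[OF refl]) (simp add: min_def drop_take)
  qed
  also have "\<dots> = (\<Sum>j\<in>{..?n}. \<Sum>i\<in>{i \<in> {..?n}. j \<le> i}. ?F i j)"
    by (rule sum.swap_restrict) simp_all
  also have "\<dots> = (f \<otimes>\<^bsub>tensor_algebra s\<^esub> (g \<otimes>\<^bsub>tensor_algebra s\<^esub> h)) w"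
    unfolding tensor_algebra_simps
  proof (rule sum.cong[OF refl])
    fix j assume "j \<in> {..?n}"
    then have j: "j \<le> ?n" by simp
    have "(\<Sum>i\<in>{i \<in> {..?n}. j \<le> i}. ?F i j) = (\<Sum>l\<in>{..?n - j}. ?F (l + j) j)"
      by (rule sum.reindex_bij_witness[of _ "\<lambda>l. l + j" "\<lambda>i. i - j"]) (use j in auto)
    then show "(\<Sum>i\<in>{i \<in> {..?n}. j \<le> i}. ?F i j) =
      f (take j w) * (\<Sum>l\<le>length (drop j w). g (take l (drop j w)) * h (drop l (drop j w)))"
      by (simp add: sum_distrib_left mult.assoc)
  qed
  finally show "(f \<otimes>\<^bsub>tensor_algebra s\<^esub> g \<otimes>\<^bsub>tensor_algebra s\<^esub> h) w =
    (f \<otimes>\<^bsub>tensor_algebra s\<^esub> (g \<otimes>\<^bsub>tensor_algebra s\<^esub> h)) w" .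
qed

text \<open>Only the cut that leaves exactly \<open>v\<close> on the right can contribute.\<close>

lemma mult_mon:
  fixes f :: "nat list \<Rightarrow> 'k::field"
  shows "(f \<otimes>\<^bsub>tensor_algebra s\<^esub> mon v) w = (if suffix v w then f (take (length w - length v) w) else 0)"
proof -
  have eq: "f (take i w) * mon v (drop i w) =
    (if i = length w - length v then (if suffix v w then f (take (length w - length v) w) else 0) else 0)"
    if "i \<le> length w" for i
  proof (cases "drop i w = v")
    case True
    then have "i = length w - length v" "suffix v w" using that suffix_drop by auto
    then show ?thesis using True by (simp add: mon_def)
  next
    case False
    have "\<not> (suffix v w \<and> i = length w - length v)"
      using False by (auto simp: suffix_def)
    then show ?thesis using False by (auto simp: mon_def)
  qed
  have "(f \<otimes>\<^bsub>tensor_algebra s\<^esub> mon v) w = (\<Sum>i\<le>length w. if i = length w - length v then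
      (if suffix v w then f (take (length w - length v) w) else 0) else 0)"
    unfolding tensor_algebra_simps by (rule sum.cong[OF refl]) (simp add: eq)
  then show ?thesis by simp
qed

lemma mon_mult_mon: "mon u \<otimes>\<^bsub>tensor_algebra s\<^esub> mon v = (mon (u @ v) :: nat list \<Rightarrow> 'k::field)"
proof
  fix w show "(mon u \<otimes>\<^bsub>tensor_algebra s\<^esub> mon v) w = (mon (u @ v) :: nat list \<Rightarrow> 'k) w"
    unfolding mult_mon by (auto simp: mon_def suffix_def)
qed

lemma ring_tensor_algebra: "ring (tensor_algebra s :: ('k::field, nat list \<Rightarrow> 'k) module)"
proof (rule ringI)
  let ?T = "tensor_algebra s :: ('k, nat list \<Rightarrow> 'k) module"
  show "abelian_group ?T"
  proof (rule abelian_groupI)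
    show "\<zero>\<^bsub>?T\<^esub> \<in> carrier ?T" by (simp add: tensor_algebra_simps)
    fix f assume f: "f \<in> carrier ?T"
    have "(\<lambda>w. - f w) \<in> carrier ?T" by (rule carrierT_mono[OF f]) simp
    moreover have "(\<lambda>w. - f w) \<oplus>\<^bsub>?T\<^esub> f = \<zero>\<^bsub>?T\<^esub>" by (simp add: tensor_algebra_simps)
    ultimately show "\<exists>g\<in>carrier ?T. g \<oplus>\<^bsub>?T\<^esub> f = \<zero>\<^bsub>?T\<^esub>" by (intro bexI[of _ "\<lambda>w. - f w"])
  qed (simp_all add: carrierT_add[unfolded tensor_algebra_simps(5)] tensor_algebra_simps(4,5) add_ac)
  show "Group.monoid ?T"
  proof (rule monoidI)
    show "\<one>\<^bsub>?T\<^esub> \<in> carrier ?T" unfolding tensor_algebra_simps(3) by (rule mon_carrier) simp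
    fix f :: "nat list \<Rightarrow> 'k"
    show "f \<otimes>\<^bsub>?T\<^esub> \<one>\<^bsub>?T\<^esub> = f"
      by (rule ext) (simp add: tensor_algebra_simps(3) mult_mon)
    show "\<one>\<^bsub>?T\<^esub> \<otimes>\<^bsub>?T\<^esub> f = f"
    proof
      fix w
      have "(\<one>\<^bsub>?T\<^esub> \<otimes>\<^bsub>?T\<^esub> f) w = (\<Sum>i\<le>length w. if i = 0 then f w else 0)"
        unfolding tensor_algebra_simps(2) by (rule sum.cong[OF refl]) (auto simp: tensor_algebra_simps(3) mon_def)
      then show "(\<one>\<^bsub>?T\<^esub> \<otimes>\<^bsub>?T\<^esub> f) w = f w" by simp
    qed
  qed (simp_all add: carrierT_mult conv_assoc)
  fix f g h :: "nat list \<Rightarrow> 'k"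
  show "(f \<oplus>\<^bsub>?T\<^esub> g) \<otimes>\<^bsub>?T\<^esub> h = f \<otimes>\<^bsub>?T\<^esub> h \<oplus>\<^bsub>?T\<^esub> g \<otimes>\<^bsub>?T\<^esub> h"
    by (rule ext) (simp add: tensor_algebra_simps distrib_right sum.distrib)
  show "h \<otimes>\<^bsub>?T\<^esub> (f \<oplus>\<^bsub>?T\<^esub> g) = h \<otimes>\<^bsub>?T\<^esub> f \<oplus>\<^bsub>?T\<^esub> h \<otimes>\<^bsub>?T\<^esub> g"
    by (rule ext) (simp add: tensor_algebra_simps distrib_left sum.distrib)
qed

lemma ring_quot_module:
  assumes "ideal I R" shows "ring (quot_module R I)"
proof -
  interpret ideal I R by fact
  interpret Q: ring "R Quot I" by (rule quotient_is_ring)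
  have eq: "carrier (quot_module R I) = carrier (R Quot I)" "mult (quot_module R I) = mult (R Quot I)"
    "one (quot_module R I) = one (R Quot I)" "add (quot_module R I) = add (R Quot I)"
    by (simp_all add: quot_module_def)
  show ?thesis
  proof (rule ringI)
    show "abelian_group (quot_module R I)"
      by (rule abelian_group_quot_module) (rule local.abelian_group_axioms, rule is_additive_subgroup)
    show "Group.monoid (quot_module R I)"
      by (rule monoidI) (simp_all add: eq Q.m_assoc)
  qed (simp_all add: eq Q.l_distr Q.r_distr)
qed

subsection \<open>Monomial algebras\<close>

locale mono_alg =
  fixes s :: nat and I :: "(nat list \<Rightarrow> 'k::field) set" and R :: "nat list set"
  assumes R_words: "R \<subseteq> words s" and R_finite: "finite R" and R_len: "\<And>r. r \<in> R \<Longrightarrow> length r \<ge> 2"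
    and I_def: "I = Idl\<^bsub>tensor_algebra s\<^esub> (mon ` R)"
begin

abbreviation T where "T \<equiv> tensor_algebra s :: ('k, nat list \<Rightarrow> 'k) module"

text \<open>\<open>sublist\<close> means a contiguous factor, so among the words of the alphabet
  these are the monomials in \<open>I\<close> (\<open>mon_in_I\<close>).\<close>

definition bad :: "nat list \<Rightarrow> bool" where "bad w \<longleftrightarrow> (\<exists>r\<in>R. sublist r w)"

lemma bad_mono: "bad w \<Longrightarrow> sublist w u \<Longrightarrow> bad u"
  unfolding bad_def using sublist_order.order.trans by blast

lemma bad_append: "bad w \<Longrightarrow> bad (w @ v)" "bad v \<Longrightarrow> bad (w @ v)"
  by (rule bad_mono, assumption, simp)+

text \<open>The degree condition on the relations enters here: the empty word and the letters remain
  nonzero in the algebra.\<close>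

lemma not_bad_small: "length w < 2 \<Longrightarrow> \<not> bad w"
  unfolding bad_def using R_len sublist_length_le by fastforce

definition J :: "(nat list \<Rightarrow> 'k) set" where "J = {f \<in> carrier T. \<forall>w. f w \<noteq> 0 \<longrightarrow> bad w}"

interpretation T: ring T by (rule ring_tensor_algebra)

lemma a_inv_T: "f \<in> carrier T \<Longrightarrow> \<ominus>\<^bsub>T\<^esub> f = (\<lambda>w. - f w)"
proof (rule T.minus_equality)
  assume f: "f \<in> carrier T"
  show "(\<lambda>w. - f w) \<oplus>\<^bsub>T\<^esub> f = \<zero>\<^bsub>T\<^esub>" by (simp add: tensor_algebra_simps)
  show "(\<lambda>w. - f w) \<in> carrier T" by (rule carrierT_mono[OF f]) simp
qed

lemma ideal_J: "ideal J T"
proof (rule idealI)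
  show "ring T" by (rule ring_tensor_algebra)
  show "subgroup J (add_monoid T)"
  proof (rule group.subgroupI)
    show "Group.group (add_monoid T)" by (rule T.a_group)
    show "J \<subseteq> carrier (add_monoid T)" by (auto simp: J_def)
    have "\<zero>\<^bsub>T\<^esub> \<in> J" by (simp add: J_def tensor_algebra_simps)
    then show "J \<noteq> {}" by blast
  next
    fix f assume f: "f \<in> J"
    then have fT: "f \<in> carrier T" by (simp add: J_def)
    have "\<ominus>\<^bsub>T\<^esub> f \<in> J" using f T.a_inv_closed[OF fT] by (simp add: J_def a_inv_T[OF fT])
    then show "inv\<^bsub>add_monoid T\<^esub> f \<in> J" by (simp add: a_inv_def)
  next
    fix f g assume f: "f \<in> J" and g: "g \<in> J"
    have "bad w" if "(f \<oplus>\<^bsub>T\<^esub> g) w \<noteq> 0" for w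
    proof -
      have "f w \<noteq> 0 \<or> g w \<noteq> 0" using that by (auto simp: tensor_algebra_simps)
      then show ?thesis using f g by (auto simp: J_def)
    qed
    then show "f \<otimes>\<^bsub>add_monoid T\<^esub> g \<in> J" using f g T.a_closed by (simp add: J_def)
  qed
next
  fix f g assume f: "f \<in> J" and g: "g \<in> carrier T"
  have fT: "f \<in> carrier T" and fb: "\<And>w. f w \<noteq> 0 \<Longrightarrow> bad w" using f by (auto simp: J_def)
  have "bad w" if nz: "(g \<otimes>\<^bsub>T\<^esub> f) w \<noteq> 0" for w
  proof -
    have "(\<Sum>i\<le>length w. g (take i w) * f (drop i w)) \<noteq> 0" using nz by (simp add: tensor_algebra_simps)
    then obtain i where "g (take i w) * f (drop i w) \<noteq> 0" by (meson sum.neutral)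
    then have "bad (drop i w)" using fb by simp
    then show ?thesis using bad_append(2)[of "drop i w" "take i w"] by simp
  qed
  then show "g \<otimes>\<^bsub>T\<^esub> f \<in> J" using carrierT_mult[OF g fT] by (simp add: J_def)
  have "bad w" if nz: "(f \<otimes>\<^bsub>T\<^esub> g) w \<noteq> 0" for w
  proof -
    have "(\<Sum>i\<le>length w. f (take i w) * g (drop i w)) \<noteq> 0" using nz by (simp add: tensor_algebra_simps)
    then obtain i where "f (take i w) * g (drop i w) \<noteq> 0" by (meson sum.neutral)
    then have "bad (take i w)" using fb by simp
    then show ?thesis using bad_append(1)[of "take i w" "drop i w"] by simp
  qed
  then show "f \<otimes>\<^bsub>T\<^esub> g \<in> J" using carrierT_mult[OF fT g] by (simp add: J_def)
qed

lemma monR: "mon ` R \<subseteq> carrier T"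
  using R_words mon_carrier by blast

lemma ideal_I: "ideal I T"
  unfolding I_def by (rule T.genideal_ideal[OF monR])

text \<open>A generated ideal is hard to test for membership; its description by supports is not.
  For the nontrivial inclusion the support is peeled off word by word, each bad word being p r q for
  a relation r.\<close>

lemma I_eq_J: "I = J"
proof
  have "(mon r :: nat list \<Rightarrow> 'k) \<in> J" if r: "r \<in> R" for r
  proof -
    have "r \<in> words s" using r R_words by blast
    moreover have "bad r" using r unfolding bad_def by blast
    ultimately show ?thesis by (simp add: J_def mon_carrier) (simp add: mon_def)
  qed
  then show "I \<subseteq> J" unfolding I_def by (intro T.genideal_minimal[OF ideal_J]) blast
next
  interpret I: ideal I T by (rule ideal_I)
  have monI: "(\<lambda>u. if u = w then c else 0) \<in> I" if w: "w \<in> words s" "bad w" for w and c :: 'k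
  proof -
    obtain p r q where r: "r \<in> R" and weq: "w = p @ r @ q"
      using w(2) unfolding bad_def sublist_def by blast
    have pq: "p \<in> words s" "q \<in> words s" using w(1) weq by auto
    have "mon r \<in> I" unfolding I_def using T.genideal_self[OF monR] r by blast
    then have "mon p \<otimes>\<^bsub>T\<^esub> mon r \<otimes>\<^bsub>T\<^esub> mon q \<in> I"
      using I.I_r_closed[OF I.I_l_closed[OF _ mon_carrier[OF pq(1)]] mon_carrier[OF pq(2)]] by blast
    then have mw: "mon w \<in> I" by (simp add: mon_mult_mon weq)
    \<comment> \<open>Ideals are closed under ring multiplication, so the scalar enters as a
      multiple of the unit.\<close>
    have c: "c \<odot>\<^bsub>T\<^esub> mon [] \<in> carrier T"
      by (rule carrierT_mono[OF mon_carrier[of "[]"]]) (auto simp: tensor_algebra_simps)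
    have "c \<odot>\<^bsub>T\<^esub> mon [] \<otimes>\<^bsub>T\<^esub> mon w = (\<lambda>u. if u = w then c else 0)"
    proof
      fix u show "(c \<odot>\<^bsub>T\<^esub> mon [] \<otimes>\<^bsub>T\<^esub> mon w) u = (if u = w then c else 0)"
        unfolding mult_mon by (auto simp: tensor_algebra_simps mon_def suffix_def)
    qed
    then show ?thesis using I.I_l_closed[OF mw c] by simp
  qed
  have "f \<in> I" if "finite S" "f \<in> J" "{w. f w \<noteq> 0} \<subseteq> S" for S f
    using that
  proof (induction S arbitrary: f rule: finite_induct)
    case empty
    then have "f = \<zero>\<^bsub>T\<^esub>" by (auto simp: tensor_algebra_simps)
    then show ?case by simp
  next
    case (insert w S)
    show ?case
    proof (cases "f w = 0")
      case True then show ?thesis using insert by blast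
    next
      case False
      have fT: "f \<in> carrier T" and "bad w" using insert.prems(1) False by (auto simp: J_def)
      then have "(\<lambda>u. if u = w then f w else 0) \<in> I"
        using monI carrierT_supp[OF fT False] by blast
      moreover have "f(w := 0) \<in> I"
      proof (rule insert.IH)
        show "{u. (f(w := 0)) u \<noteq> 0} \<subseteq> S" using insert.prems(2) by auto
        have "f(w := 0) \<in> carrier T" by (rule carrierT_mono[OF fT]) (auto split: if_splits)
        then show "f(w := 0) \<in> J" using insert.prems(1) by (simp add: J_def)
      qed
      ultimately have "(\<lambda>u. if u = w then f w else 0) \<oplus>\<^bsub>T\<^esub> f(w := 0) \<in> I" by simp
      moreover have "(\<lambda>u. if u = w then f w else 0) \<oplus>\<^bsub>T\<^esub> f(w := 0) = f"
        by (auto simp: tensor_algebra_simps)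
      ultimately show ?thesis by simp
    qed
  qed
  then show "J \<subseteq> I" unfolding J_def using tensor_algebra_simps(1) by blast
qed

lemma mon_in_I: "mon w \<in> I \<longleftrightarrow> w \<in> words s \<and> bad w"
  unfolding I_eq_J J_def using mon_carrier[of w s] carrierT_supp[of "mon w" s w]
  by (auto simp: mon_def split: if_splits)

end

context mono_alg
begin

lemma I_memD: "u \<in> I \<Longrightarrow> \<not> bad w \<Longrightarrow> u w = 0"
  unfolding I_eq_J J_def by blast

lemma I_memI: "u \<in> carrier T \<Longrightarrow> (\<And>w. u w \<noteq> 0 \<Longrightarrow> bad w) \<Longrightarrow> u \<in> I"
  unfolding I_eq_J J_def by blast

interpretation T: ring T by (rule ring_tensor_algebra)
interpretation I: ideal I T by (rule ideal_I)

abbreviation A where "A \<equiv> monomial_algebra s I"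

section \<open>Coefficients of elements of the monomial algebra\<close>

definition el :: "(nat list \<Rightarrow> 'k) \<Rightarrow> (nat list \<Rightarrow> 'k) set" where "el f = I +>\<^bsub>T\<^esub> f"

text \<open>The coordinates in the basis of nonzero monomials. Elements of \<open>I\<close> vanish
  at good words, so the chosen representative is immaterial there, and bad words get 0.\<close>

definition cf :: "(nat list \<Rightarrow> 'k) set \<Rightarrow> nat list \<Rightarrow> 'k" where
  "cf a = (\<lambda>w. if bad w then 0 else (SOME f. f \<in> a) w)"

definition mu :: "nat list \<Rightarrow> (nat list \<Rightarrow> 'k) set" where "mu w = el (mon w)"

text \<open>The augmentation of the algebra, with kernel \<open>aug_ideal s I\<close>
  (\<open>aug_ideal_eq\<close>).\<close>

definition eps :: "(nat list \<Rightarrow> 'k) set \<Rightarrow> 'k" where "eps a = cf a []"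

lemma ring_A: "ring A"
  unfolding monomial_algebra_def by (rule ring_quot_module[OF ideal_I])

lemma A_simps:
  shows "carrier A = el ` carrier T" "\<zero>\<^bsub>A\<^esub> = I" "\<one>\<^bsub>A\<^esub> = el (mon [])"
    and "f \<in> carrier T \<Longrightarrow> g \<in> carrier T \<Longrightarrow> el f \<oplus>\<^bsub>A\<^esub> el g = el (\<lambda>w. f w + g w)"
    and "f \<in> carrier T \<Longrightarrow> g \<in> carrier T \<Longrightarrow> el f \<otimes>\<^bsub>A\<^esub> el g = el (f \<otimes>\<^bsub>T\<^esub> g)"
    and "f \<in> carrier T \<Longrightarrow> c \<odot>\<^bsub>A\<^esub> el f = el (\<lambda>w. c * f w)"
proof -
  have S: "additive_subgroup I T" by (rule I.is_additive_subgroup)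
  show "carrier A = el ` carrier T" "\<zero>\<^bsub>A\<^esub> = I" "\<one>\<^bsub>A\<^esub> = el (mon [])"
    by (simp_all add: monomial_algebra_def quot_module_simps el_def[abs_def] tensor_algebra_simps(3))
  show "el f \<oplus>\<^bsub>A\<^esub> el g = el (\<lambda>w. f w + g w)" if "f \<in> carrier T" "g \<in> carrier T"
    using quot_module_add[OF T.abelian_group_axioms S that]
    by (simp only: monomial_algebra_def el_def tensor_algebra_simps(5))
  show "el f \<otimes>\<^bsub>A\<^esub> el g = el (f \<otimes>\<^bsub>T\<^esub> g)" if "f \<in> carrier T" "g \<in> carrier T"
    using I.rcoset_mult_add[OF that]
    by (simp add: monomial_algebra_def el_def quot_module_def FactRing_def)
  have sm: "c \<odot>\<^bsub>T\<^esub> f \<in> carrier T" if "f \<in> carrier T" for c f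
    by (rule carrierT_mono[OF that]) (simp add: tensor_algebra_simps(6))
  show "c \<odot>\<^bsub>A\<^esub> el f = el (\<lambda>w. c * f w)" if f: "f \<in> carrier T"
    unfolding monomial_algebra_def el_def tensor_algebra_simps(6)[symmetric, of c f s]
  proof (rule quot_module_smult[OF T.abelian_group_axioms S f])
    fix u assume u: "u \<in> I"
    show "c \<odot>\<^bsub>T\<^esub> u \<in> I"
    proof (rule I_memI[OF sm[OF I.a_Hcarr[OF u]]])
      fix w assume "(c \<odot>\<^bsub>T\<^esub> u) w \<noteq> 0"
      then show "bad w" using I_memD[OF u, of w] unfolding tensor_algebra_simps(6) by fastforce
    qed
  qed (simp_all add: sm, simp add: tensor_algebra_simps(5,6) distrib_left)
qed

lemma cf_el:
  assumes f: "f \<in> carrier T" shows "cf (el f) = (\<lambda>w. if bad w then 0 else f w)"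
proof
  fix w
  have "f \<in> el f" unfolding el_def by (rule I.a_rcos_self[OF f])
  then have "(SOME g. g \<in> el f) \<in> el f" by (rule someI[of "\<lambda>g. g \<in> el f"])
  then obtain u where u: "u \<in> I" "(SOME g. g \<in> el f) = u \<oplus>\<^bsub>T\<^esub> f"
    unfolding el_def by (rule mem_a_r_cosetE)
  have "u w = 0" if "\<not> bad w" using I_memD[OF u(1) that] .
  then show "cf (el f) w = (if bad w then 0 else f w)"
    by (simp add: cf_def u(2) tensor_algebra_simps(5))
qed

lemma el_eqI:
  assumes f: "f \<in> carrier T" and g: "g \<in> carrier T" and eq: "\<And>w. \<not> bad w \<Longrightarrow> f w = g w"
  shows "el f = el g"
proof -
  let ?d = "\<lambda>w. f w - g w"
  have "(\<lambda>w. - g w) \<in> carrier T" by (rule carrierT_mono[OF g]) simp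
  from carrierT_add[OF f this] have "?d \<in> carrier T" by (simp add: tensor_algebra_simps(5))
  moreover have "bad w" if "?d w \<noteq> 0" for w using eq[of w] that by auto
  ultimately have "?d \<in> I" by (rule I_memI)
  moreover have "f = ?d \<oplus>\<^bsub>T\<^esub> g" by (simp add: tensor_algebra_simps(5))
  ultimately have "f \<in> I +>\<^bsub>T\<^esub> g" by (auto simp: a_r_coset_def r_coset_def)
  from I.a_repr_independence'[OF this g] show ?thesis by (simp add: el_def)
qed

lemma A_el: "a \<in> carrier A \<Longrightarrow> \<exists>f. f \<in> carrier T \<and> a = el f"
  by (auto simp: A_simps(1))

lemma el_A: "f \<in> carrier T \<Longrightarrow> el f \<in> carrier A"
  by (simp add: A_simps(1))

lemma A_eqI:
  assumes "a \<in> carrier A" "b \<in> carrier A" "\<And>w. cf a w = cf b w" shows "a = b"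
proof -
  obtain f where f: "f \<in> carrier T" "a = el f" using A_el[OF assms(1)] by blast
  obtain g where g: "g \<in> carrier T" "b = el g" using A_el[OF assms(2)] by blast
  have "f w = g w" if "\<not> bad w" for w
    using assms(3)[of w] that by (simp add: f g cf_el)
  then show ?thesis unfolding f g by (rule el_eqI[OF f(1) g(1)])
qed

lemma cf_add:
  assumes "a \<in> carrier A" "b \<in> carrier A" shows "cf (a \<oplus>\<^bsub>A\<^esub> b) w = cf a w + cf b w"
proof -
  obtain f where f: "f \<in> carrier T" "a = el f" using A_el[OF assms(1)] by blast
  obtain g where g: "g \<in> carrier T" "b = el g" using A_el[OF assms(2)] by blast
  show ?thesis using carrierT_add[OF f(1) g(1)]
    by (simp add: f g A_simps(4) cf_el tensor_algebra_simps(5))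
qed

lemma zero_A: "\<zero>\<^bsub>A\<^esub> = el (\<lambda>w. 0)"
  unfolding A_simps el_def using I.a_rcos_const[OF I.zero_closed] by (simp add: tensor_algebra_simps(4))

lemma zero_T: "(\<lambda>w. 0) \<in> carrier T"
  using T.zero_closed by (simp add: tensor_algebra_simps(4))

lemma cf_zero: "cf \<zero>\<^bsub>A\<^esub> w = 0"
  unfolding zero_A cf_el[OF zero_T] by simp

lemma cf_bad: "bad w \<Longrightarrow> cf a w = 0"
  by (simp add: cf_def)

lemma cf_words: "a \<in> carrier A \<Longrightarrow> cf a w \<noteq> 0 \<Longrightarrow> w \<in> words s"
proof -
  assume a: "a \<in> carrier A" and nz: "cf a w \<noteq> 0"
  obtain f where f: "f \<in> carrier T" "a = el f" using A_el[OF a] by blast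
  have "f w \<noteq> 0" using nz by (auto simp: f(2) cf_el[OF f(1)] split: if_splits)
  then show ?thesis by (rule carrierT_supp[OF f(1)])
qed

lemma cf_exists:
  assumes "finite {w. g w \<noteq> 0}" "\<And>w. g w \<noteq> 0 \<Longrightarrow> w \<in> words s \<and> \<not> bad w"
  shows "\<exists>a. a \<in> carrier A \<and> cf a = g"
proof -
  have g: "g \<in> carrier T" using assms by (auto simp: tensor_algebra_simps(1))
  have "cf (el g) = g" using assms(2) by (auto simp: cf_el[OF g] fun_eq_iff)
  then show ?thesis using el_A[OF g] by blast
qed

lemma cf_finite: "a \<in> carrier A \<Longrightarrow> finite {w. cf a w \<noteq> 0}"
proof -
  assume "a \<in> carrier A"
  then obtain f where f: "f \<in> carrier T" "a = el f" using A_el by blast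
  have "{w. cf a w \<noteq> 0} \<subseteq> {w. f w \<noteq> 0}" by (auto simp: f cf_el)
  moreover have "finite {w. f w \<noteq> 0}" using f(1) by (simp add: tensor_algebra_simps(1))
  ultimately show ?thesis by (rule finite_subset)
qed

lemma mu_A: "w \<in> words s \<Longrightarrow> mu w \<in> carrier A"
  unfolding mu_def by (intro el_A mon_carrier)

text \<open>Right multiplication by a monomial keeps distinct words distinct or sends them to zero.
  This is why annihilators of monomials are spanned by words.\<close>

lemma cf_mult_mu:
  assumes a: "a \<in> carrier A" and v: "v \<in> words s"
  shows "cf (a \<otimes>\<^bsub>A\<^esub> mu v) w = (if suffix v w \<and> \<not> bad w then cf a (take (length w - length v) w) else 0)"
proof -
  obtain f where f: "f \<in> carrier T" "a = el f" using A_el[OF a] by blast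
  have m: "f \<otimes>\<^bsub>T\<^esub> mon v \<in> carrier T" by (rule carrierT_mult[OF f(1) mon_carrier[OF v]])
  have "bad w" if "bad (take (length w - length v) w)"
    using bad_append(1)[OF that, of "drop (length w - length v) w"] by simp
  then show ?thesis
    unfolding f(2) mu_def A_simps(5)[OF f(1) mon_carrier[OF v]] cf_el[OF m] cf_el[OF f(1)] mult_mon by auto
qed

lemma eps_mult: "a \<in> carrier A \<Longrightarrow> b \<in> carrier A \<Longrightarrow> eps (a \<otimes>\<^bsub>A\<^esub> b) = eps a * eps b"
proof -
  assume "a \<in> carrier A" "b \<in> carrier A"
  then obtain f g where f: "f \<in> carrier T" "a = el f" and g: "g \<in> carrier T" "b = el g" using A_el by metis
  have nb: "\<not> bad []" by (rule not_bad_small) simp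
  show ?thesis unfolding eps_def f(2) g(2) A_simps(5)[OF f(1) g(1)]
      cf_el[OF carrierT_mult[OF f(1) g(1)]] cf_el[OF f(1)] cf_el[OF g(1)]
    using nb by (simp add: tensor_algebra_simps(2))
qed

lemma eps_add: "a \<in> carrier A \<Longrightarrow> b \<in> carrier A \<Longrightarrow> eps (a \<oplus>\<^bsub>A\<^esub> b) = eps a + eps b"
  by (simp add: eps_def cf_add)

lemma mon_Nil_T: "mon [] \<in> carrier T" by (rule mon_carrier) simp

lemma scal_one: "c \<odot>\<^bsub>A\<^esub> \<one>\<^bsub>A\<^esub> \<in> carrier A" "eps (c \<odot>\<^bsub>A\<^esub> \<one>\<^bsub>A\<^esub>) = c"
proof -
  have c: "(\<lambda>w. c * mon [] w) \<in> carrier T" by (rule carrierT_mono[OF mon_Nil_T]) simp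
  have e: "c \<odot>\<^bsub>A\<^esub> \<one>\<^bsub>A\<^esub> = el (\<lambda>w. c * mon [] w)"
    unfolding A_simps(3) by (rule A_simps(6)[OF mon_Nil_T])
  show "c \<odot>\<^bsub>A\<^esub> \<one>\<^bsub>A\<^esub> \<in> carrier A" unfolding e by (rule el_A[OF c])
  show "eps (c \<odot>\<^bsub>A\<^esub> \<one>\<^bsub>A\<^esub>) = c" unfolding e eps_def cf_el[OF c]
    using not_bad_small[of "[]"] by (simp add: mon_def)
qed

lemma eps_mu: "w \<in> words s \<Longrightarrow> w \<noteq> [] \<Longrightarrow> eps (mu w) = 0"
  unfolding mu_def eps_def by (simp only: cf_el[OF mon_carrier]) (simp add: mon_def)

subsection \<open>The trivial module\<close>

interpretation A: ring A by (rule ring_A)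

abbreviation Reg where "Reg \<equiv> regular_module A"
abbreviation N where "N \<equiv> trivial_module s I"

lemma left_module_Reg: "left_module A Reg"
proof -
  have s: "carrier Reg = carrier A" "add Reg = add A" "zero Reg = zero A" "smult Reg = mult A"
    by (simp_all add: regular_module_def)
  interpret abelian_group Reg
  proof (rule abelian_groupI, unfold s)
    show "\<exists>y\<in>carrier A. y \<oplus>\<^bsub>A\<^esub> x = \<zero>\<^bsub>A\<^esub>" if "x \<in> carrier A" for x
      using A.l_neg[OF that] A.a_inv_closed[OF that] by blast
  qed (simp_all add: A.a_ac)
  show ?thesis
    by unfold_locales (simp_all add: s A.l_distr A.r_distr A.m_assoc)
qed

interpretation Reg: left_module A Reg by (rule left_module_Reg)

lemma Reg_simps: "carrier Reg = carrier A" "x \<oplus>\<^bsub>Reg\<^esub> y = x \<oplus>\<^bsub>A\<^esub> y" "\<zero>\<^bsub>Reg\<^esub> = \<zero>\<^bsub>A\<^esub>"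
  "a \<odot>\<^bsub>Reg\<^esub> x = a \<otimes>\<^bsub>A\<^esub> x"
  by (simp_all add: regular_module_def)

lemma aug_ideal_eq: "aug_ideal s I = {a \<in> carrier A. eps a = 0}"
proof -
  have nb: "\<not> bad []" by (rule not_bad_small) simp
  have "eps (el f) = f []" if "f \<in> carrier T" for f
    using nb by (simp add: eps_def cf_el[OF that])
  then show ?thesis unfolding aug_ideal_def A_simps(1) el_def[abs_def] by auto
qed

lemma additive_subgroup_aug: "additive_subgroup (aug_ideal s I) Reg"
proof (rule additive_subgroupI, rule group.subgroupI)
  show "Group.group (add_monoid Reg)" by (rule Reg.M.a_group)
  show "aug_ideal s I \<subseteq> carrier (add_monoid Reg)" by (auto simp: aug_ideal_eq Reg_simps)
  have "\<zero>\<^bsub>A\<^esub> \<in> aug_ideal s I" by (simp add: aug_ideal_eq eps_def cf_zero)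
  then show "aug_ideal s I \<noteq> {}" by blast
next
  fix a assume a: "a \<in> aug_ideal s I"
  then have aA: "a \<in> carrier Reg" "eps a = 0" by (auto simp: aug_ideal_eq Reg_simps)
  have n: "\<ominus>\<^bsub>Reg\<^esub> a \<in> carrier A" using Reg.M.a_inv_closed[OF aA(1)] by (simp add: Reg_simps)
  have "eps (\<ominus>\<^bsub>Reg\<^esub> a \<oplus>\<^bsub>A\<^esub> a) = 0"
    using Reg.M.l_neg[OF aA(1)] by (simp add: Reg_simps eps_def cf_zero)
  then have "eps (\<ominus>\<^bsub>Reg\<^esub> a) = 0" using n aA by (simp add: eps_add Reg_simps)
  then show "inv\<^bsub>add_monoid Reg\<^esub> a \<in> aug_ideal s I" using n by (simp add: a_inv_def aug_ideal_eq)
next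
  fix a b assume "a \<in> aug_ideal s I" "b \<in> aug_ideal s I"
  then show "a \<otimes>\<^bsub>add_monoid Reg\<^esub> b \<in> aug_ideal s I"
    by (simp add: aug_ideal_eq Reg_simps eps_add)
qed

lemma left_module_N: "left_module A N"
  unfolding trivial_module_def
  by (rule left_module_quot_module[OF left_module_Reg additive_subgroup_aug])
    (simp add: aug_ideal_eq Reg_simps eps_mult)

interpretation U: abelian_subgroup "aug_ideal s I" Reg
  by (rule abelian_subgroupI3[OF additive_subgroup_aug Reg.M.abelian_group_axioms])

definition pr :: "(nat list \<Rightarrow> 'k) set \<Rightarrow> (nat list \<Rightarrow> 'k) set set" where
  "pr a = aug_ideal s I +>\<^bsub>Reg\<^esub> a"

definition tau :: "(nat list \<Rightarrow> 'k) set set \<Rightarrow> 'k" where "tau Y = eps (SOME a. a \<in> Y)"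

lemma tau_pr: assumes a: "a \<in> carrier A" shows "tau (pr a) = eps a"
proof -
  have "a \<in> pr a" unfolding pr_def by (rule U.a_rcos_self) (simp add: Reg_simps a)
  then have "(SOME b. b \<in> pr a) \<in> pr a" by (rule someI[of "\<lambda>b. b \<in> pr a"])
  then obtain u where u: "u \<in> aug_ideal s I" "(SOME b. b \<in> pr a) = u \<oplus>\<^bsub>Reg\<^esub> a"
    unfolding pr_def by (rule mem_a_r_cosetE)
  show ?thesis unfolding tau_def u(2) using u(1) a by (simp add: Reg_simps aug_ideal_eq eps_add)
qed

lemma N_simps:
  shows "carrier N = pr ` carrier A" "\<zero>\<^bsub>N\<^esub> = pr \<zero>\<^bsub>A\<^esub>"
    and "a \<in> carrier A \<Longrightarrow> b \<in> carrier A \<Longrightarrow> pr a \<oplus>\<^bsub>N\<^esub> pr b = pr (a \<oplus>\<^bsub>A\<^esub> b)"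
    and "a \<in> carrier A \<Longrightarrow> b \<in> carrier A \<Longrightarrow> a \<odot>\<^bsub>N\<^esub> pr b = pr (a \<otimes>\<^bsub>A\<^esub> b)"
proof -
  show "carrier N = pr ` carrier A"
    by (simp add: trivial_module_def quot_module_simps pr_def[abs_def] Reg_simps)
  have "\<zero>\<^bsub>A\<^esub> \<in> aug_ideal s I" by (simp add: aug_ideal_eq eps_def cf_zero)
  from U.a_rcos_const[OF this] show "\<zero>\<^bsub>N\<^esub> = pr \<zero>\<^bsub>A\<^esub>"
    by (simp add: trivial_module_def quot_module_simps pr_def)
  show "pr a \<oplus>\<^bsub>N\<^esub> pr b = pr (a \<oplus>\<^bsub>A\<^esub> b)" if "a \<in> carrier A" "b \<in> carrier A"
    using quot_module_add[OF Reg.M.abelian_group_axioms additive_subgroup_aug, of a b] that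
    by (simp add: trivial_module_def pr_def Reg_simps)
  show "a \<odot>\<^bsub>N\<^esub> pr b = pr (a \<otimes>\<^bsub>A\<^esub> b)" if "a \<in> carrier A" "b \<in> carrier A"
    unfolding trivial_module_def pr_def Reg_simps(4)[symmetric]
    by (rule quot_module_smult[OF Reg.M.abelian_group_axioms additive_subgroup_aug])
      (use that in \<open>simp_all add: Reg_simps A.r_distr aug_ideal_eq eps_mult\<close>)
qed

lemma pr_eq_iff:
  assumes "a \<in> carrier A" "b \<in> carrier A" shows "pr a = pr b \<longleftrightarrow> eps a = eps b"
proof
  show "eps a = eps b" if "pr a = pr b" using that tau_pr assms by metis
  assume e: "eps a = eps b"
  let ?d = "a \<ominus>\<^bsub>A\<^esub> b"
  have d: "?d \<in> carrier A" using assms by simp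
  have ab: "a = ?d \<oplus>\<^bsub>A\<^esub> b" using assms by (simp add: a_minus_def A.a_assoc A.l_neg)
  have "eps a = eps ?d + eps b" using eps_add[OF d assms(2)] ab by simp
  then have "?d \<in> aug_ideal s I" using e d by (simp add: aug_ideal_eq)
  then have "a \<in> pr b" using ab unfolding pr_def a_r_coset_def r_coset_def by (auto simp: Reg_simps)
  from U.a_repr_independence'[OF this[unfolded pr_def]] show "pr a = pr b"
    using assms(2) by (simp add: pr_def Reg_simps)
qed

lemma tau_bij: "bij_betw tau (carrier N) UNIV"
proof (rule bij_betwI')
  fix x y assume "x \<in> carrier N" "y \<in> carrier N"
  then obtain a b where "a \<in> carrier A" "x = pr a" "b \<in> carrier A" "y = pr b" by (auto simp: N_simps(1))
  then show "tau x = tau y \<longleftrightarrow> x = y" by (simp add: tau_pr pr_eq_iff)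
next
  fix c :: 'k
  show "\<exists>x\<in>carrier N. c = tau x"
    by (rule bexI[of _ "pr (c \<odot>\<^bsub>A\<^esub> \<one>\<^bsub>A\<^esub>)"]) (simp_all add: tau_pr scal_one N_simps(1))
qed simp

lemma tau_add: "x \<in> carrier N \<Longrightarrow> y \<in> carrier N \<Longrightarrow> tau (x \<oplus>\<^bsub>N\<^esub> y) = tau x + tau y"
  by (auto simp: N_simps tau_pr eps_add)

lemma tau_smult: "a \<in> carrier A \<Longrightarrow> x \<in> carrier N \<Longrightarrow> tau (a \<odot>\<^bsub>N\<^esub> x) = eps a * tau x"
  by (auto simp: N_simps tau_pr eps_mult)

end

subsection \<open>The minimal resolution\<close>

context mono_alg
begin

interpretation A: ring A by (rule ring_A)

text \<open>
  A path \<open>v\<^sub>0 \<rightarrow> \<dots> \<rightarrow> v\<^sub>n\<close> starting at a letter is the list \<open>[v\<^sub>n, \<dots>, v\<^sub>0]\<close>; it indexes a free generator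
  in homological degree \<open>n + 1\<close>, and the empty list is the generator in degree \<open>0\<close>. The annihilator
  of \<open>v\<^sub>n\<close> (or \<open>A\<^sub>+\<close>, for the empty list) is spanned by the words satisfying
  \<open>kill\<close>, and it is the direct sum of the left ideals generated by the words in \<open>nxt\<close>.
\<close>

fun kill :: "nat list list \<Rightarrow> nat list \<Rightarrow> bool" where
  "kill [] u \<longleftrightarrow> u \<noteq> []"
| "kill (m # _) u \<longleftrightarrow> bad (u @ m)"

definition nxt :: "nat list list \<Rightarrow> nat list set" where
  "nxt \<beta> = {w \<in> words s. \<not> bad w \<and> kill \<beta> w \<and> (\<forall>w'. strict_suffix w' w \<longrightarrow> \<not> kill \<beta> w')}"

primrec paths :: "nat \<Rightarrow> nat list list set" where
  "paths 0 = {[]}"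
| "paths (Suc n) = {w # \<beta> | w \<beta>. \<beta> \<in> paths n \<and> w \<in> nxt \<beta>}"

declare paths.simps [simp del]

section \<open>Minimal killing words and finiteness of the generating sets\<close>

lemma kill_mono: "kill \<beta> w \<Longrightarrow> suffix w u \<Longrightarrow> kill \<beta> u"
  by (cases \<beta>) (auto simp: suffix_def intro: bad_append)

lemma nxt_words: "w \<in> nxt \<beta> \<Longrightarrow> w \<in> words s"
  by (simp add: nxt_def)

text \<open>Suffixes of one word are comparable, so two minimal ones coincide. This makes the sum of
  the left ideals generated by \<open>nxt \<beta>\<close> direct.\<close>

lemma nxt_unique:
  assumes "w \<in> nxt \<beta>" "w' \<in> nxt \<beta>" "suffix w u" "suffix w' u" shows "w = w'"
proof (rule ccontr)
  assume "w \<noteq> w'"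
  then have "strict_suffix w w' \<or> strict_suffix w' w"
    using suffix_same_cases[OF assms(3,4)] by (auto simp: strict_suffix_def)
  then show False using assms(1,2) by (auto simp: nxt_def)
qed

text \<open>Passing to shorter killing suffixes must end. This makes the left ideals exhaust the
  annihilator.\<close>

lemma nxt_exists:
  assumes "kill \<beta> u" "u \<in> words s" "\<not> bad u"
  shows "\<exists>w\<in>nxt \<beta>. suffix w u"
  using assms
proof (induction "length u" arbitrary: u rule: less_induct)
  case less
  show ?case
  proof (cases "\<exists>w'. strict_suffix w' u \<and> kill \<beta> w'")
    case True
    then obtain w' where w': "strict_suffix w' u" "kill \<beta> w'" by blast
    have sfx: "suffix w' u" using w'(1) by (simp add: strict_suffix_def)
    have "length w' < length u" using w'(1) by (rule suffix_length_less)
    moreover have "w' \<in> words s" using sfx less.prems(2) by (auto simp: suffix_def)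
    moreover have "\<not> bad w'" using bad_mono[of w' u] less.prems(3) sfx by blast
    ultimately obtain w where "w \<in> nxt \<beta>" "suffix w w'" using less.hyps w'(2) by blast
    then show ?thesis using sfx by (intro bexI[of _ w]) (auto simp: suffix_def)
  next
    case False
    then have "u \<in> nxt \<beta>" using less.prems by (simp add: nxt_def)
    then show ?thesis by blast
  qed
qed

lemma nxt_Nil: "nxt [] = {[i] | i. i < s}"
proof (intro equalityI subsetI)
  fix w assume w: "w \<in> nxt []"
  obtain x v where xv: "w = x # v" using w by (cases w) (auto simp: nxt_def)
  have "strict_suffix v w" using xv by (simp add: strict_suffix_def suffix_def)
  then have "v = []" using w unfolding nxt_def by simp
  then show "w \<in> {[i] | i. i < s}" using xv w by (auto simp: nxt_def)
next
  fix w assume "w \<in> {[i] | i. i < s}"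
  then obtain i where "w = [i]" "i < s" by blast
  then show "w \<in> nxt []"
    using not_bad_small[of "[i]"] by (auto simp: nxt_def strict_suffix_def suffix_Cons)
qed

text \<open>A relation inside \<open>w @ m\<close> must begin at the first letter of
  \<open>w\<close>, since otherwise \<open>w\<close> without that letter would still kill
  \<open>m\<close>. It cannot end inside the good word \<open>w\<close>, so \<open>w\<close> is a
  prefix of it. Finiteness of \<open>R\<close> then bounds the graph.\<close>

lemma nxt_subset_prefixes:
  assumes "\<not> bad m" shows "nxt (m # \<gamma>) \<subseteq> (\<Union>r\<in>R. set (prefixes r))"
proof
  fix w assume w: "w \<in> nxt (m # \<gamma>)"
  have nbm: "\<not> bad m" and nbw: "\<not> bad w" and bd: "bad (w @ m)"
    and min: "\<And>w'. strict_suffix w' w \<Longrightarrow> \<not> bad (w' @ m)"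
    using assms w by (auto simp: nxt_def)
  obtain r p q where r: "r \<in> R" and eq: "w @ m = p @ r @ q"
    using bd unfolding bad_def sublist_def by blast
  obtain x v where xv: "w = x # v" using nbm bd by (cases w) auto
  have "p = []"
  proof (rule ccontr)
    assume "p \<noteq> []"
    then obtain y p' where "p = y # p'" by (cases p) auto
    then have "v @ m = p' @ r @ q" using eq xv by simp
    then have "bad (v @ m)" using r unfolding bad_def by (metis sublist_appendI)
    moreover have "strict_suffix v w" using xv by (simp add: strict_suffix_def suffix_def)
    ultimately show False using min by blast
  qed
  then have eq: "w @ m = r @ q" using eq by simp
  have "prefix w r"
  proof -
    have "prefix w (r @ q)" using eq by (metis prefixI)
    moreover have "prefix r (r @ q)" by simp
    ultimately consider "prefix w r" | "prefix r w" using prefix_same_cases by blast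
    then show ?thesis
    proof cases
      case 2
      then have "bad w" using r unfolding bad_def by (metis prefix_imp_sublist)
      then show ?thesis using nbw by blast
    qed
  qed
  then show "w \<in> (\<Union>r\<in>R. set (prefixes r))" using r by auto
qed

lemma finite_nxt:
  assumes "\<beta> = [] \<or> \<not> bad (hd \<beta>)" shows "finite (nxt \<beta>)"
proof (cases \<beta>)
  case Nil
  then show ?thesis by (simp add: nxt_Nil)
next
  case (Cons m \<gamma>)
  then have "nxt \<beta> \<subseteq> (\<Union>r\<in>R. set (prefixes r))" using assms nxt_subset_prefixes by simp
  moreover have "finite (\<Union>r\<in>R. set (prefixes r))" using R_finite by simp
  ultimately show ?thesis by (rule finite_subset)
qed

lemma paths_good: "\<beta> \<in> paths n \<Longrightarrow> \<beta> = [] \<or> \<not> bad (hd \<beta>)"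
  by (cases n) (auto simp: nxt_def paths.simps)

lemma finite_nxt': "\<beta> \<in> paths n \<Longrightarrow> finite (nxt \<beta>)"
  by (rule finite_nxt[OF paths_good])

lemma finite_paths: "finite (paths n)"
proof (induction n)
  case (Suc n)
  have "paths (Suc n) = (\<Union>\<beta>\<in>paths n. (\<lambda>w. w # \<beta>) ` nxt \<beta>)" by (auto simp: paths.simps)
  then show ?case using Suc finite_nxt' by simp
qed (simp add: paths.simps)

text \<open>The annihilator of the head of \<open>\<beta>\<close> read off from supports
  (\<open>killed_Cons_iff\<close>), or the augmentation ideal for the empty list
  (\<open>killed_Nil_iff\<close>).\<close>

definition killed :: "nat list list \<Rightarrow> (nat list \<Rightarrow> 'k) set \<Rightarrow> bool" where
  "killed \<beta> a \<longleftrightarrow> (\<forall>u. cf a u \<noteq> 0 \<longrightarrow> kill \<beta> u)"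

lemma cf_finsum:
  assumes "finite S" "\<And>w. w \<in> S \<Longrightarrow> F w \<in> carrier A"
  shows "cf (finsum A F S) u = (\<Sum>w\<in>S. cf (F w) u)"
  using assms
proof (induction S rule: finite_induct)
  case (insert w S)
  have F: "F \<in> S \<rightarrow> carrier A" "F w \<in> carrier A" using insert.prems by auto
  show ?case
    using insert F by (simp add: cf_add[OF F(2) A.finsum_closed[OF F(1)]])
qed (simp add: cf_zero)

lemma killed_Cons_iff:
  assumes a: "a \<in> carrier A" and w: "w \<in> words s"
  shows "killed (w # \<beta>) a \<longleftrightarrow> a \<otimes>\<^bsub>A\<^esub> mu w = \<zero>\<^bsub>A\<^esub>"
proof
  assume k: "killed (w # \<beta>) a"
  show "a \<otimes>\<^bsub>A\<^esub> mu w = \<zero>\<^bsub>A\<^esub>"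
  proof (rule A_eqI)
    fix u
    have "cf (a \<otimes>\<^bsub>A\<^esub> mu w) u = 0"
    proof (cases "suffix w u \<and> \<not> bad u")
      case True
      then obtain v where v: "u = v @ w" by (auto simp: suffix_def)
      then have "cf a v = 0" using k True by (auto simp: killed_def)
      then show ?thesis using v by (simp add: cf_mult_mu[OF a w])
    next
      case False
      then show ?thesis by (auto simp: cf_mult_mu[OF a w])
    qed
    then show "cf (a \<otimes>\<^bsub>A\<^esub> mu w) u = cf \<zero>\<^bsub>A\<^esub> u" by (simp add: cf_zero)
  qed (use a mu_A[OF w] in auto)
next
  assume z: "a \<otimes>\<^bsub>A\<^esub> mu w = \<zero>\<^bsub>A\<^esub>"
  show "killed (w # \<beta>) a"
    unfolding killed_def
  proof (intro allI impI)
    fix u assume "cf a u \<noteq> 0"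
    moreover have "cf (a \<otimes>\<^bsub>A\<^esub> mu w) (u @ w) = 0" unfolding z by (rule cf_zero)
    ultimately show "kill (w # \<beta>) u" by (simp add: cf_mult_mu[OF a w] suffix_def split: if_splits)
  qed
qed

lemma killed_Nil_iff: "killed [] a \<longleftrightarrow> eps a = 0"
  by (auto simp: killed_def eps_def)

abbreviation nsum :: "nat list list \<Rightarrow> (nat list \<Rightarrow> (nat list \<Rightarrow> 'k) set) \<Rightarrow> (nat list \<Rightarrow> 'k) set" where
  "nsum \<beta> c \<equiv> finsum A (\<lambda>w. c w \<otimes>\<^bsub>A\<^esub> mu w) (nxt \<beta>)"

lemma nsum_term_closed: "w \<in> nxt \<beta> \<Longrightarrow> c w \<in> carrier A \<Longrightarrow> c w \<otimes>\<^bsub>A\<^esub> mu w \<in> carrier A"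
  by (intro A.m_closed mu_A nxt_words)

text \<open>By \<open>nxt_unique\<close> a word ends in at most one of the generators, so a single
  summand contributes to its coefficient.\<close>

lemma cf_nsum:
  assumes fin: "finite (nxt \<beta>)" and c: "\<And>w. w \<in> nxt \<beta> \<Longrightarrow> c w \<in> carrier A"
    and w: "w \<in> nxt \<beta>" "suffix w u"
  shows "cf (nsum \<beta> c) u = cf (c w \<otimes>\<^bsub>A\<^esub> mu w) u"
proof -
  have "cf (nsum \<beta> c) u = (\<Sum>w\<in>nxt \<beta>. cf (c w \<otimes>\<^bsub>A\<^esub> mu w) u)"
    by (rule cf_finsum[OF fin]) (intro nsum_term_closed c)
  also have "\<dots> = (\<Sum>v\<in>nxt \<beta>. if v = w then cf (c w \<otimes>\<^bsub>A\<^esub> mu w) u else 0)"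
  proof (rule sum.cong[OF refl])
    fix v assume v: "v \<in> nxt \<beta>"
    show "cf (c v \<otimes>\<^bsub>A\<^esub> mu v) u = (if v = w then cf (c w \<otimes>\<^bsub>A\<^esub> mu w) u else 0)"
    proof (cases "v = w")
      case False
      then have "\<not> suffix v u" using nxt_unique[OF v w(1) _ w(2)] by blast
      then show ?thesis using False by (simp add: cf_mult_mu[OF c[OF v] nxt_words[OF v]])
    qed simp
  qed
  also have "\<dots> = cf (c w \<otimes>\<^bsub>A\<^esub> mu w) u" using fin w(1) by simp
  finally show ?thesis .
qed

lemma cf_nsum_0:
  assumes fin: "finite (nxt \<beta>)" and c: "\<And>w. w \<in> nxt \<beta> \<Longrightarrow> c w \<in> carrier A"
    and "\<And>w. w \<in> nxt \<beta> \<Longrightarrow> \<not> suffix w u"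
  shows "cf (nsum \<beta> c) u = 0"
proof -
  have "cf (nsum \<beta> c) u = (\<Sum>w\<in>nxt \<beta>. cf (c w \<otimes>\<^bsub>A\<^esub> mu w) u)"
    by (rule cf_finsum[OF fin]) (intro nsum_term_closed c)
  also have "\<dots> = 0"
    by (rule sum.neutral) (use assms(3) in \<open>simp add: cf_mult_mu[OF c nxt_words]\<close>)
  finally show ?thesis .
qed

lemma killed_nsum:
  assumes "finite (nxt \<beta>)" "\<And>w. w \<in> nxt \<beta> \<Longrightarrow> c w \<in> carrier A"
  shows "killed \<beta> (nsum \<beta> c)"
  unfolding killed_def
proof (intro allI impI)
  fix u assume "cf (nsum \<beta> c) u \<noteq> 0"
  moreover have "cf (nsum \<beta> c) u = 0" if "\<not> (\<exists>w\<in>nxt \<beta>. suffix w u)"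
    by (rule cf_nsum_0[OF assms(1)], rule assms(2), assumption) (use that in blast)
  ultimately obtain w where w: "w \<in> nxt \<beta>" "suffix w u" by blast
  then have "kill \<beta> w" by (simp add: nxt_def)
  then show "kill \<beta> u" using w(2) by (rule kill_mono)
qed

lemma killed_imp_nsum:
  assumes fin: "finite (nxt \<beta>)" and a: "a \<in> carrier A" and k: "killed \<beta> a"
  shows "\<exists>c. (\<forall>w. c w \<in> carrier A) \<and> a = nsum \<beta> c"
proof -
  \<comment> \<open>The coefficient of \<open>w\<close> collects the words of \<open>a\<close>
    ending in \<open>w\<close>, with that ending removed.\<close>
  have "\<exists>x. x \<in> carrier A \<and> cf x = (\<lambda>v. cf a (v @ w))" for w
  proof (rule cf_exists)
    have "finite ((\<lambda>v. v @ w) -` {u. cf a u \<noteq> 0})"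
      by (rule finite_vimageI[OF cf_finite[OF a]]) (simp add: inj_def)
    then show "finite {v. cf a (v @ w) \<noteq> 0}" by (simp add: vimage_def)
    fix v assume nz: "cf a (v @ w) \<noteq> 0"
    show "v \<in> words s \<and> \<not> bad v"
      using cf_words[OF a nz] cf_bad[of "v @ w" a] bad_append(1)[of v w] nz by auto
  qed
  then have "\<forall>w. \<exists>x. x \<in> carrier A \<and> cf x = (\<lambda>v. cf a (v @ w))" ..
  from choice[OF this] obtain c where c: "\<forall>w. c w \<in> carrier A \<and> cf (c w) = (\<lambda>v. cf a (v @ w))" ..
  have cA: "c w \<in> carrier A" for w using c by simp
  have "a = nsum \<beta> c"
  proof (rule A_eqI[OF a])
    show "nsum \<beta> c \<in> carrier A"
      by (intro A.finsum_closed Pi_I nsum_term_closed cA)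
    fix u
    show "cf a u = cf (nsum \<beta> c) u"
    proof (cases "\<exists>w\<in>nxt \<beta>. suffix w u")
      case True
      then obtain w where w: "w \<in> nxt \<beta>" "suffix w u" by blast
      then obtain v where v: "u = v @ w" by (auto simp: suffix_def)
      have "cf (nsum \<beta> c) u = cf (c w \<otimes>\<^bsub>A\<^esub> mu w) u" by (rule cf_nsum[OF fin cA w])
      also have "\<dots> = cf a u"
        using c v cf_bad[of u a] by (simp add: cf_mult_mu[OF cA nxt_words[OF w(1)]] suffix_def)
      finally show ?thesis ..
    next
      case False
      then have "cf (nsum \<beta> c) u = 0" by (intro cf_nsum_0[OF fin cA]) blast
      moreover have "cf a u = 0"
      proof (rule ccontr)
        assume nz: "cf a u \<noteq> 0"
        then have "kill \<beta> u" "u \<in> words s" "\<not> bad u"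
          using k cf_words[OF a nz] cf_bad[of u a] by (auto simp: killed_def)
        then show False using nxt_exists False by blast
      qed
      ultimately show ?thesis by simp
    qed
  qed
  then show ?thesis using cA by blast
qed

text \<open>The summands have disjoint supports, so the sum vanishes only if each of them does.
  Kernels of differentials thereby split into annihilators of single monomials.\<close>

lemma nsum_eq_zero_iff:
  assumes fin: "finite (nxt \<beta>)" and c: "\<And>w. w \<in> nxt \<beta> \<Longrightarrow> c w \<in> carrier A"
  shows "nsum \<beta> c = \<zero>\<^bsub>A\<^esub> \<longleftrightarrow> (\<forall>w\<in>nxt \<beta>. killed (w # \<beta>) (c w))"
proof
  assume z: "nsum \<beta> c = \<zero>\<^bsub>A\<^esub>"
  show "\<forall>w\<in>nxt \<beta>. killed (w # \<beta>) (c w)"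
  proof
    fix w assume w: "w \<in> nxt \<beta>"
    have "c w \<otimes>\<^bsub>A\<^esub> mu w = \<zero>\<^bsub>A\<^esub>"
    proof (rule A_eqI)
      fix u
      show "cf (c w \<otimes>\<^bsub>A\<^esub> mu w) u = cf \<zero>\<^bsub>A\<^esub> u"
      proof (cases "suffix w u")
        case True
        have "cf (nsum \<beta> c) u = cf (c w \<otimes>\<^bsub>A\<^esub> mu w) u"
          by (rule cf_nsum[OF fin _ w True]) (rule c)
        then show ?thesis using z by simp
      next
        case False
        then show ?thesis by (simp add: cf_mult_mu[OF c[OF w] nxt_words[OF w]] cf_zero)
      qed
    qed (use c[OF w] mu_A[OF nxt_words[OF w]] in auto)
    then show "killed (w # \<beta>) (c w)" using killed_Cons_iff[OF c[OF w] nxt_words[OF w]] by simp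
  qed
next
  assume k: "\<forall>w\<in>nxt \<beta>. killed (w # \<beta>) (c w)"
  have "nsum \<beta> c = finsum A (\<lambda>w. \<zero>\<^bsub>A\<^esub>) (nxt \<beta>)"
    by (rule A.finsum_cong') (use k killed_Cons_iff[OF c nxt_words] in auto)
  then show "nsum \<beta> c = \<zero>\<^bsub>A\<^esub>" by simp
qed

section \<open>The free complex and its exactness\<close>

abbreviation FF where "FF n \<equiv> free_lmod A (paths n)"

text \<open>On generators this sends \<open>w # \<beta>\<close> to \<open>mu w\<close> times
  \<open>\<beta>\<close>. Written on coordinate functions, the value at \<open>\<beta>\<close>
  gathers the coordinates of all its one-step extensions.\<close>

definition dmap :: "nat \<Rightarrow> (nat list list \<Rightarrow> (nat list \<Rightarrow> 'k) set) \<Rightarrow> nat list list \<Rightarrow> (nat list \<Rightarrow> 'k) set" where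
  "dmap n f \<beta> = (if \<beta> \<in> paths n then nsum \<beta> (\<lambda>w. f (w # \<beta>)) else \<zero>\<^bsub>A\<^esub>)"

definition res :: "((nat list \<Rightarrow> 'k) set, nat list list \<Rightarrow> (nat list \<Rightarrow> 'k) set, (nat list \<Rightarrow> 'k) set set) resolution" where
  "res = \<lparr>obj = FF, diff = (\<lambda>n. \<lambda>f\<in>carrier (FF (Suc n)). dmap n f),
     aug = (\<lambda>f\<in>carrier (FF 0). pr (f []))\<rparr>"

lemma FF_carrier_iff:
  "f \<in> carrier (FF n) \<longleftrightarrow> (\<forall>\<beta>. f \<beta> \<in> carrier A) \<and> (\<forall>\<beta>. \<beta> \<notin> paths n \<longrightarrow> f \<beta> = \<zero>\<^bsub>A\<^esub>)"
proof -
  have "finite {\<beta>. f \<beta> \<noteq> \<zero>\<^bsub>A\<^esub>}" if "{\<beta>. f \<beta> \<noteq> \<zero>\<^bsub>A\<^esub>} \<subseteq> paths n"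
    by (rule finite_subset[OF that finite_paths])
  then show ?thesis unfolding free_lmod_def by auto
qed

lemma FF_simps: "(f \<oplus>\<^bsub>FF n\<^esub> g) = (\<lambda>\<beta>. f \<beta> \<oplus>\<^bsub>A\<^esub> g \<beta>)" "(a \<odot>\<^bsub>FF n\<^esub> f) = (\<lambda>\<beta>. a \<otimes>\<^bsub>A\<^esub> f \<beta>)"
  "\<zero>\<^bsub>FF n\<^esub> = (\<lambda>\<beta>. \<zero>\<^bsub>A\<^esub>)"
  by (simp_all add: free_lmod_def)

lemma left_module_FF: "left_module A (FF n)"
  by (rule left_module_free_lmod[OF ring_A])

lemma nsum_closed: "(\<And>w. w \<in> nxt \<beta> \<Longrightarrow> c w \<in> carrier A) \<Longrightarrow> nsum \<beta> c \<in> carrier A"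
  by (intro A.finsum_closed Pi_I nsum_term_closed)

lemma dmap_hom: "(\<lambda>f\<in>carrier (FF (Suc n)). dmap n f) \<in> lmod_hom A (FF (Suc n)) (FF n)"
proof (rule lmod_hom_restrictI[OF left_module_FF])
  fix f assume f: "f \<in> carrier (FF (Suc n))"
  then have fA: "f \<beta> \<in> carrier A" for \<beta> by (simp add: FF_carrier_iff)
  show "dmap n f \<in> carrier (FF n)"
    using nsum_closed fA by (simp add: FF_carrier_iff dmap_def)
  fix a assume a: "a \<in> carrier A"
  show "dmap n (a \<odot>\<^bsub>FF (Suc n)\<^esub> f) = a \<odot>\<^bsub>FF n\<^esub> dmap n f"
  proof
    fix \<beta>
    show "dmap n (a \<odot>\<^bsub>FF (Suc n)\<^esub> f) \<beta> = (a \<odot>\<^bsub>FF n\<^esub> dmap n f) \<beta>"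
    proof (cases "\<beta> \<in> paths n")
      case True
      have "nsum \<beta> (\<lambda>w. a \<otimes>\<^bsub>A\<^esub> f (w # \<beta>)) = finsum A (\<lambda>w. a \<otimes>\<^bsub>A\<^esub> (f (w # \<beta>) \<otimes>\<^bsub>A\<^esub> mu w)) (nxt \<beta>)"
        by (rule A.finsum_cong') (use a fA mu_A nxt_words in \<open>auto simp: A.m_assoc\<close>)
      also have "\<dots> = a \<otimes>\<^bsub>A\<^esub> nsum \<beta> (\<lambda>w. f (w # \<beta>))"
        by (rule A.finsum_rdistr[symmetric]) (use finite_nxt'[OF True] a fA mu_A nxt_words in auto)
      finally show ?thesis using True by (simp add: dmap_def FF_simps)
    qed (use a in \<open>simp add: dmap_def FF_simps\<close>)
  qed
next
  fix f g assume f: "f \<in> carrier (FF (Suc n))" and g: "g \<in> carrier (FF (Suc n))"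
  then have fA: "f \<beta> \<in> carrier A" and gA: "g \<beta> \<in> carrier A" for \<beta> by (simp_all add: FF_carrier_iff)
  show "dmap n (f \<oplus>\<^bsub>FF (Suc n)\<^esub> g) = dmap n f \<oplus>\<^bsub>FF n\<^esub> dmap n g"
  proof
    fix \<beta>
    show "dmap n (f \<oplus>\<^bsub>FF (Suc n)\<^esub> g) \<beta> = (dmap n f \<oplus>\<^bsub>FF n\<^esub> dmap n g) \<beta>"
    proof (cases "\<beta> \<in> paths n")
      case True
      have "nsum \<beta> (\<lambda>w. f (w # \<beta>) \<oplus>\<^bsub>A\<^esub> g (w # \<beta>)) =
        finsum A (\<lambda>w. f (w # \<beta>) \<otimes>\<^bsub>A\<^esub> mu w \<oplus>\<^bsub>A\<^esub> g (w # \<beta>) \<otimes>\<^bsub>A\<^esub> mu w) (nxt \<beta>)"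
        by (rule A.finsum_cong') (use fA gA mu_A nxt_words in \<open>auto simp: A.l_distr\<close>)
      also have "\<dots> = nsum \<beta> (\<lambda>w. f (w # \<beta>)) \<oplus>\<^bsub>A\<^esub> nsum \<beta> (\<lambda>w. g (w # \<beta>))"
        by (rule A.finsum_addf) (use fA gA mu_A nxt_words in auto)
      finally show ?thesis using True by (simp add: dmap_def FF_simps)
    qed (simp add: dmap_def FF_simps)
  qed
qed

text \<open>Image and kernel (\<open>dmap_kernel\<close>) are described by the same coordinatewise
  condition \<open>killed\<close>, and exactness is the coincidence of the two descriptions.\<close>

lemma dmap_image:
  "dmap n ` carrier (FF (Suc n)) = {g \<in> carrier (FF n). \<forall>\<beta>\<in>paths n. killed \<beta> (g \<beta>)}"
proof (intro equalityI subsetI)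
  fix g assume "g \<in> dmap n ` carrier (FF (Suc n))"
  then obtain f where f: "f \<in> carrier (FF (Suc n))" and g: "g = dmap n f" by (rule imageE)
  have "g \<in> carrier (FF n)" using lmod_homD(1)[OF dmap_hom f] f g by simp
  moreover have "killed \<beta> (g \<beta>)" if "\<beta> \<in> paths n" for \<beta>
  proof -
    have "killed \<beta> (nsum \<beta> (\<lambda>w. f (w # \<beta>)))"
      by (rule killed_nsum[OF finite_nxt'[OF that]]) (use f in \<open>simp add: FF_carrier_iff\<close>)
    then show ?thesis using that by (simp add: g dmap_def)
  qed
  ultimately show "g \<in> {g \<in> carrier (FF n). \<forall>\<beta>\<in>paths n. killed \<beta> (g \<beta>)}" by simp
next
  fix g assume "g \<in> {g \<in> carrier (FF n). \<forall>\<beta>\<in>paths n. killed \<beta> (g \<beta>)}"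
  then have g: "g \<in> carrier (FF n)" and k: "\<And>\<beta>. \<beta> \<in> paths n \<Longrightarrow> killed \<beta> (g \<beta>)" by auto
  have gA: "g \<beta> \<in> carrier A" for \<beta> using g by (simp add: FF_carrier_iff)
  have "\<forall>\<beta>\<in>paths n. \<exists>c. (\<forall>w. c w \<in> carrier A) \<and> g \<beta> = nsum \<beta> c"
    by (intro ballI killed_imp_nsum finite_nxt' gA k)
  from bchoice[OF this] obtain c
    where c: "\<forall>\<beta>\<in>paths n. (\<forall>w. c \<beta> w \<in> carrier A) \<and> g \<beta> = nsum \<beta> (c \<beta>)" ..
  define f where "f \<gamma> = (if \<gamma> \<in> paths (Suc n) then c (tl \<gamma>) (hd \<gamma>) else \<zero>\<^bsub>A\<^esub>)" for \<gamma>
  have "f \<gamma> \<in> carrier A" for \<gamma>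
    using c by (auto simp: f_def paths.simps)
  then have f: "f \<in> carrier (FF (Suc n))" by (auto simp: FF_carrier_iff f_def)
  have "dmap n f = g"
  proof
    fix \<beta>
    show "dmap n f \<beta> = g \<beta>"
    proof (cases "\<beta> \<in> paths n")
      case True
      have "nsum \<beta> (\<lambda>w. f (w # \<beta>)) = nsum \<beta> (c \<beta>)"
      proof (rule A.finsum_cong')
        show "f (w # \<beta>) \<otimes>\<^bsub>A\<^esub> mu w = c \<beta> w \<otimes>\<^bsub>A\<^esub> mu w" if "w \<in> nxt \<beta>" for w
          using True that by (simp add: f_def paths.simps)
      qed (use c True mu_A nxt_words in auto)
      then show ?thesis using True c by (simp add: dmap_def)
    qed (use g in \<open>simp add: dmap_def FF_carrier_iff\<close>)
  qed
  then show "g \<in> dmap n ` carrier (FF (Suc n))" using f by blast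
qed

lemma dmap_kernel:
  assumes g: "g \<in> carrier (FF (Suc n))"
  shows "dmap n g = \<zero>\<^bsub>FF n\<^esub> \<longleftrightarrow> (\<forall>\<beta>\<in>paths (Suc n). killed \<beta> (g \<beta>))"
proof -
  have gA: "g \<beta> \<in> carrier A" for \<beta> using g by (simp add: FF_carrier_iff)
  have "dmap n g = \<zero>\<^bsub>FF n\<^esub> \<longleftrightarrow> (\<forall>\<beta>\<in>paths n. nsum \<beta> (\<lambda>w. g (w # \<beta>)) = \<zero>\<^bsub>A\<^esub>)"
    by (auto simp: FF_simps dmap_def fun_eq_iff)
  also have "\<dots> \<longleftrightarrow> (\<forall>\<beta>\<in>paths n. \<forall>w\<in>nxt \<beta>. killed (w # \<beta>) (g (w # \<beta>)))"
    by (intro ball_cong refl nsum_eq_zero_iff finite_nxt' gA)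
  also have "\<dots> \<longleftrightarrow> (\<forall>\<beta>\<in>paths (Suc n). killed \<beta> (g \<beta>))" by (auto simp: paths.simps)
  finally show ?thesis .
qed

lemma res_simps: "obj res n = FF n" "diff res n = (\<lambda>f\<in>carrier (FF (Suc n)). dmap n f)"
  "aug res = (\<lambda>f\<in>carrier (FF 0). pr (f []))"
  by (simp_all add: res_def)

theorem projective_resolution_res: "projective_resolution A N res"
proof -
  interpret N: left_module A N by (rule left_module_N)
  have a: "(\<lambda>f\<in>carrier (FF 0). pr (f [])) \<in> lmod_hom A (FF 0) N"
    by (rule lmod_hom_restrictI[OF left_module_FF]) (simp_all add: FF_carrier_iff FF_simps N_simps)
  have s: "pr (f []) = \<zero>\<^bsub>N\<^esub> \<longleftrightarrow> killed [] (f [])" if "f \<in> carrier (FF 0)" for f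
  proof -
    have "f [] \<in> carrier A" using that by (simp add: FF_carrier_iff)
    then show ?thesis unfolding N_simps(2) by (simp add: pr_eq_iff killed_Nil_iff eps_def cf_zero)
  qed
  have surj: "(\<lambda>f\<in>carrier (FF 0). pr (f [])) ` carrier (FF 0) = carrier N"
  proof
    show "(\<lambda>f\<in>carrier (FF 0). pr (f [])) ` carrier (FF 0) \<subseteq> carrier N"
      using lmod_homD(1)[OF a] by blast
    show "carrier N \<subseteq> (\<lambda>f\<in>carrier (FF 0). pr (f [])) ` carrier (FF 0)"
    proof
      fix x assume "x \<in> carrier N"
      then obtain b where b: "b \<in> carrier A" "x = pr b" by (auto simp: N_simps(1))
      let ?f = "\<lambda>\<beta>. if \<beta> = [] then b else \<zero>\<^bsub>A\<^esub>"
      have "?f \<in> carrier (FF 0)" unfolding FF_carrier_iff using b by (simp add: paths.simps)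
      then show "x \<in> (\<lambda>f\<in>carrier (FF 0). pr (f [])) ` carrier (FF 0)"
        using b(2) by (intro image_eqI[of _ _ ?f]) simp_all
    qed
  qed
  have im: "(\<lambda>f\<in>carrier (FF (Suc n)). dmap n f) ` carrier (FF (Suc n)) =
    {g \<in> carrier (FF n). \<forall>\<beta>\<in>paths n. killed \<beta> (g \<beta>)}" for n
    unfolding dmap_image[symmetric] by (rule image_cong) simp_all
  have p0: "(\<forall>\<beta>\<in>paths 0. killed \<beta> (g \<beta>)) \<longleftrightarrow> killed [] (g [])" for g
    by (simp add: paths.simps(1))
  have e0: "(\<lambda>f\<in>carrier (FF (Suc 0)). dmap 0 f) ` carrier (FF (Suc 0)) =
    {x \<in> carrier (FF 0). (\<lambda>f\<in>carrier (FF 0). pr (f [])) x = \<zero>\<^bsub>N\<^esub>}"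
    unfolding im p0 by (rule Collect_cong) (simp add: s cong: conj_cong)
  have e: "(\<lambda>f\<in>carrier (FF (Suc (Suc n))). dmap (Suc n) f) ` carrier (FF (Suc (Suc n))) =
    {x \<in> carrier (FF (Suc n)). (\<lambda>f\<in>carrier (FF (Suc n)). dmap n f) x = \<zero>\<^bsub>FF n\<^esub>}" for n
    unfolding im by (rule Collect_cong) (simp add: dmap_kernel cong: conj_cong)
  show ?thesis unfolding projective_resolution_def res_simps One_nat_def
    by (intro conjI allI projective_free_lmod[OF ring_A] dmap_hom a surj e0 e)
qed

text \<open>A generator goes to a nonempty monomial times a generator, and nonempty monomials act as
  zero on k.\<close>

lemma res_minimal:
  assumes f: "f \<in> lmod_hom A (obj res n) N" and y: "y \<in> carrier (obj res (Suc n))"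
  shows "f (diff res n y) = \<zero>\<^bsub>N\<^esub>"
proof -
  interpret N: left_module A N by (rule left_module_N)
  let ?fd = "\<lambda>y\<in>carrier (FF (Suc n)). f ((\<lambda>y\<in>carrier (FF (Suc n)). dmap n y) y)"
  have f': "f \<in> lmod_hom A (FF n) N" using f by (simp add: res_simps)
  have fd: "?fd \<in> lmod_hom A (FF (Suc n)) N"
    by (rule lmod_hom_compose[OF left_module_FF dmap_hom f'])
  have z: "(\<lambda>y\<in>carrier (FF (Suc n)). \<zero>\<^bsub>N\<^esub>) \<in> lmod_hom A (FF (Suc n)) N"
    by (rule lmod_hom_restrictI[OF left_module_FF]) (simp_all add: N.smult_zero_right)
  have "?fd (unit_vec A j) = (\<lambda>y\<in>carrier (FF (Suc n)). \<zero>\<^bsub>N\<^esub>) (unit_vec A j)"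
    if j: "j \<in> paths (Suc n)" for j
  proof -
    obtain w \<beta> where w: "j = w # \<beta>" "\<beta> \<in> paths n" "w \<in> nxt \<beta>" using j by (auto simp: paths.simps)
    have wA: "mu w \<in> carrier A" using mu_A[OF nxt_words[OF w(3)]] .
    have u: "unit_vec A j \<in> carrier (FF (Suc n))" by (rule unit_vec_carrier[OF ring_A j])
    have u\<beta>: "unit_vec A \<beta> \<in> carrier (FF n)" by (rule unit_vec_carrier[OF ring_A w(2)])
    have "dmap n (unit_vec A j) = mu w \<odot>\<^bsub>FF n\<^esub> unit_vec A \<beta>"
    proof
      fix \<gamma>
      have "nsum \<gamma> (\<lambda>v. unit_vec A j (v # \<gamma>)) = (if \<gamma> = \<beta> then mu w else \<zero>\<^bsub>A\<^esub>)" if \<gamma>: "\<gamma> \<in> paths n"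
      proof (cases "\<gamma> = \<beta>")
        case True
        have "nsum \<beta> (\<lambda>v. unit_vec A j (v # \<beta>)) = finsum A (\<lambda>v. if w = v then mu v else \<zero>\<^bsub>A\<^esub>) (nxt \<beta>)"
          by (rule A.finsum_cong') (use mu_A nxt_words in \<open>auto simp: unit_vec_def w(1)\<close>)
        also have "\<dots> = mu w"
          by (rule A.finsum_singleton) (use w(3) finite_nxt'[OF w(2)] mu_A nxt_words in auto)
        finally show ?thesis using True by simp
      next
        case False
        have "nsum \<gamma> (\<lambda>v. unit_vec A j (v # \<gamma>)) = finsum A (\<lambda>v. \<zero>\<^bsub>A\<^esub>) (nxt \<gamma>)"
          by (rule A.finsum_cong') (use False mu_A nxt_words in \<open>auto simp: unit_vec_def w(1)\<close>)
        then show ?thesis using False by simp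
      qed
      then show "dmap n (unit_vec A j) \<gamma> = (mu w \<odot>\<^bsub>FF n\<^esub> unit_vec A \<beta>) \<gamma>"
        using w(2) wA by (auto simp: dmap_def FF_simps unit_vec_def)
    qed
    then have "f (dmap n (unit_vec A j)) = mu w \<odot>\<^bsub>N\<^esub> f (unit_vec A \<beta>)"
      using lmod_homD(3)[OF f' wA u\<beta>] by simp
    also have "\<dots> = \<zero>\<^bsub>N\<^esub>"
    proof -
      have fu: "f (unit_vec A \<beta>) \<in> carrier N" by (rule lmod_homD(1)[OF f' u\<beta>])
      \<comment> \<open>The empty word kills neither the empty list nor a good monomial.\<close>
      have "w \<noteq> []" using w(3) not_bad_small[of "[]"] paths_good[OF w(2)] by (cases \<beta>) (auto simp: nxt_def)
      then have "eps (mu w) = 0" by (rule eps_mu[OF nxt_words[OF w(3)]])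
      then have "tau (mu w \<odot>\<^bsub>N\<^esub> f (unit_vec A \<beta>)) = 0" using tau_smult[OF wA fu] by simp
      moreover have "tau \<zero>\<^bsub>N\<^esub> = 0" unfolding N_simps(2) by (simp add: tau_pr eps_def cf_zero)
      ultimately show ?thesis
        by (intro inj_onD[OF bij_betw_imp_inj_on[OF tau_bij]]) (simp_all add: N.smult_closed wA fu)
    qed
    finally show ?thesis using u by simp
  qed
  from free_lmod_hom_eqI[OF ring_A left_module_N fd z this] y
  show ?thesis by (simp add: res_simps)
qed

theorem vdim_Ext_trivial:
  assumes "projective_resolution A N X"
  shows "vdim (yoneda_algebra A N X) (yoneda_component A N X n) = enat (card (paths n))"
proof -
  interpret one_dim_ext A N X res paths eps tau
  proof (rule one_dim_ext.intro)
    show "\<forall>n. \<forall>f\<in>lmod_hom A (obj res n) N. \<forall>y\<in>carrier (obj res (Suc n)). f (diff res n y) = \<zero>\<^bsub>N\<^esub>"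
      by (intro allI ballI res_minimal)
  qed (rule left_module_N assms projective_resolution_res finite_paths tau_bij res_simps(1) scal_one |
      (rule tau_add tau_smult, assumption, assumption))+
  show ?thesis by (rule vdim_yoneda_component)
qed

end

section \<open>Growth of the number of walks\<close>

locale fin_digraph =
  fixes V :: "'v set" and E :: "('v \<times> 'v) set"
  assumes finite_V: "finite V" and E_sub: "E \<subseteq> V \<times> V"
begin

primrec nwalks :: "nat \<Rightarrow> 'v \<Rightarrow> nat" where
  "nwalks 0 v = 1"
| "nwalks (Suc n) v = (\<Sum>u\<in>E `` {v}. nwalks n u)"

text \<open>Lengths run up to \<open>n - 1\<close> because a walk of length i is a generator of
  degree i + 1; \<open>n\<close> is thus the top degree counted
  (\<open>sum_card_paths\<close>).\<close>

definition twalks :: "nat \<Rightarrow> 'v \<Rightarrow> nat" where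
  "twalks n v = (\<Sum>i<n. nwalks i v)"

lemma finite_succ: "finite (E `` {v})"
  by (rule finite_subset[OF _ finite_V]) (use E_sub in auto)

lemma twalks_0: "twalks 0 v = 0"
  by (simp add: twalks_def)

lemma twalks_Suc: "twalks (Suc n) v = 1 + (\<Sum>u\<in>E `` {v}. twalks n u)"
proof -
  have "twalks (Suc n) v = nwalks 0 v + (\<Sum>i<n. nwalks (Suc i) v)"
    unfolding twalks_def by (rule sum.lessThan_Suc_shift)
  also have "(\<Sum>i<n. nwalks (Suc i) v) = (\<Sum>u\<in>E `` {v}. \<Sum>i<n. nwalks i u)"
    by (simp add: sum.swap[of _ _ "{..<n}"])
  finally show ?thesis by (simp add: twalks_def)
qed

lemma twalks_mono: "m \<le> n \<Longrightarrow> twalks m v \<le> twalks n v"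
  unfolding twalks_def by (rule sum_mono2) auto

lemma nwalks_edge: "(v, u) \<in> E \<Longrightarrow> nwalks n u \<le> nwalks (Suc n) v"
  using member_le_sum[of u "E `` {v}" "nwalks n"] finite_succ by simp

text \<open>Prepending a fixed path of length \<open>k\<close> embeds the walks from
  \<open>u\<close> into those from \<open>v\<close>.\<close>

lemma nwalks_path: "(v, u) \<in> E ^^ k \<Longrightarrow> nwalks n u \<le> nwalks (n + k) v"
proof (induction k arbitrary: u n)
  case (Suc k)
  then obtain y where y: "(v, y) \<in> E ^^ k" "(y, u) \<in> E" by auto
  have "nwalks n u \<le> nwalks (Suc n) y" using y(2) by (rule nwalks_edge)
  also have "\<dots> \<le> nwalks (Suc n + k) v" using y(1) by (rule Suc.IH)
  finally show ?case by simp
qed simp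

lemma twalks_edge: "(v, u) \<in> E \<Longrightarrow> twalks n u \<le> twalks (Suc n) v"
  using member_le_sum[of u "E `` {v}" "twalks n"] finite_succ by (simp add: twalks_Suc)

lemma twalks_path: "(v, u) \<in> E ^^ k \<Longrightarrow> twalks n u \<le> twalks (n + k) v"
proof (induction k arbitrary: u n)
  case (Suc k)
  then obtain y where y: "(v, y) \<in> E ^^ k" "(y, u) \<in> E" by auto
  have "twalks n u \<le> twalks (Suc n) y" using y(2) by (rule twalks_edge)
  also have "\<dots> \<le> twalks (Suc n + k) v" using y(1) by (rule Suc.IH)
  finally show ?case by simp
qed simp

lemma nwalks_loop: "(v, v) \<in> E ^^ a \<Longrightarrow> nwalks m v \<le> nwalks (m + b * a) v"
proof (induction b)
  case (Suc b)
  have "nwalks (m + b * a) v \<le> nwalks (m + b * a + a) v" using Suc.prems by (rule nwalks_path)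
  then show ?case using Suc by (simp add: algebra_simps)
qed simp

text \<open>Repeating each of the two closed walks, of lengths \<open>p + 1\<close> and \<open>q + 1\<close>, pads both to the same
  length; as they start with different edges, the number of walks doubles.\<close>

lemma nwalks_exponential:
  assumes "(v, u1) \<in> E" "(u1, v) \<in> E ^^ p" "(v, u2) \<in> E" "(u2, v) \<in> E ^^ q" "u1 \<noteq> u2"
  shows "2 ^ k \<le> nwalks (k * (Suc p * Suc q)) v"
proof (induction k)
  case (Suc k)
  define m where "m = k * (Suc p * Suc q)"
  have l1: "(v, v) \<in> E ^^ Suc p" using assms(1,2) by (rule relpow_Suc_I2)
  have l2: "(v, v) \<in> E ^^ Suc q" using assms(3,4) by (rule relpow_Suc_I2)
  \<comment> \<open>Either padding adds p + q + p q steps, one less than (p + 1)(q + 1); the missing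
    step is the first edge, at which the two families of walks differ.\<close>
  have "nwalks m v \<le> nwalks (m + q * Suc p) v" by (rule nwalks_loop[OF l1])
  also have "\<dots> \<le> nwalks (m + q * Suc p + p) u1" using assms(2) by (rule nwalks_path)
  finally have 1: "nwalks m v \<le> nwalks (m + (p + q + p * q)) u1" by (simp add: algebra_simps)
  have "nwalks m v \<le> nwalks (m + p * Suc q) v" by (rule nwalks_loop[OF l2])
  also have "\<dots> \<le> nwalks (m + p * Suc q + q) u2" using assms(4) by (rule nwalks_path)
  finally have 2: "nwalks m v \<le> nwalks (m + (p + q + p * q)) u2" by (simp add: algebra_simps)
  have "2 * nwalks m v \<le> (\<Sum>u\<in>{u1, u2}. nwalks (m + (p + q + p * q)) u)" using 1 2 assms(5) by simp
  also have "\<dots> \<le> (\<Sum>u\<in>E `` {v}. nwalks (m + (p + q + p * q)) u)"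
    using assms(1,3) finite_succ by (intro sum_mono2) auto
  also have "\<dots> = nwalks (Suc (m + (p + q + p * q))) v" by simp
  also have "Suc (m + (p + q + p * q)) = Suc k * (Suc p * Suc q)" by (simp add: m_def algebra_simps)
  finally show ?case using Suc by (simp add: m_def)
qed simp

subsection \<open>Circuits\<close>

lemma circuit_rotate:
  assumes "circuit V E n f"
  shows "circuit V E n (\<lambda>j. f ((i + j) mod n))"
    and "circuit_class n (\<lambda>j. f ((i + j) mod n)) = circuit_class n f"
proof -
  have n: "n \<ge> 1" and fn: "f n = f 0" and inj: "inj_on f {..<n}"
    and fV: "\<And>i. i \<le> n \<Longrightarrow> f i \<in> V" and fE: "\<And>i. i < n \<Longrightarrow> (f i, f (Suc i)) \<in> E"
    using assms by (auto simp: circuit_def walk_def)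
  have modf: "f (Suc i mod n) = f (Suc i)" if "i < n" for i
    using that fn by (cases "Suc i = n") auto
  have edge: "(f ((i + j) mod n), f ((i + Suc j) mod n)) \<in> E" for j
  proof -
    have "(i + j) mod n < n" using n by simp
    then have "(f ((i + j) mod n), f (Suc ((i + j) mod n) mod n)) \<in> E"
      using fE[of "(i + j) mod n"] modf[of "(i + j) mod n"] by simp
    then show ?thesis by (simp add: mod_Suc_eq)
  qed
  have "inj_on (\<lambda>j. f ((i + j) mod n)) {..<n}"
  proof (rule inj_onI)
    fix a b assume a: "a \<in> {..<n}" and b: "b \<in> {..<n}" and eq: "f ((i + a) mod n) = f ((i + b) mod n)"
    have "(i + a) mod n = (i + b) mod n" using inj_onD[OF inj eq] n by simp
    have ne: "(i + x) mod n \<noteq> (i + y) mod n" if "x < y" "y < n" for x y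
    proof
      assume "(i + x) mod n = (i + y) mod n"
      then have "n dvd (i + y) - (i + x)" using that(1) mod_eq_dvd_iff_nat[of "i + x" "i + y" n] by simp
      then have "n dvd y - x" by simp
      then show False using nat_dvd_not_less[of "y - x" n] that by simp
    qed
    then show "a = b" using a b ne[of a b] ne[of b a] \<open>(i + a) mod n = (i + b) mod n\<close>
      by (cases a b rule: linorder_cases) auto
  qed
  then show "circuit V E n (\<lambda>j. f ((i + j) mod n))"
    using n edge fV by (simp add: circuit_def walk_def less_imp_le)
  let ?L = "map f [0..<n]"
  have L: "map (\<lambda>j. f ((i + j) mod n)) [0..<n] = rotate i ?L"
    by (rule nth_equalityI) (simp_all add: nth_rotate)
  \<comment> \<open>Rotating by \<open>(n - 1) * i\<close> undoes the rotation by \<open>i\<close>,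
    as together they shift by a multiple of \<open>n\<close>.\<close>
  have "rotate j ?L = rotate (j + (n - 1) * i) (rotate i ?L)" for j
  proof -
    have "j + (n - 1) * i + i = j + i * n" using n by (cases n) (auto simp: algebra_simps)
    then have "rotate (j + (n - 1) * i) (rotate i ?L) = rotate (j + i * n) ?L" by (simp only: rotate_rotate)
    also have "\<dots> = rotate j ?L" by (subst (1 2) rotate_conv_mod) simp
    finally show ?thesis ..
  qed
  then show "circuit_class n (\<lambda>j. f ((i + j) mod n)) = circuit_class n f"
    unfolding circuit_class_def L by (auto simp: rotate_rotate) 
qed

lemma class_vertices_eq: "class_vertices (circuit_class n f) = f ` {..<n}"
proof -
  have "set (rotate j (map f [0..<n])) = f ` {..<n}" for j by (simp add: atLeast0LessThan)
  then show ?thesis unfolding class_vertices_def circuit_class_def by auto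
qed

lemma circuit_in_circuits: "circuit V E n f \<Longrightarrow> circuit_class n f \<in> circuits V E"
  unfolding circuits_def by blast

lemma circuit_vertexE:
  assumes "circuit V E n f" "x \<in> f ` {..<n}"
  obtains g where "circuit V E n g" "g 0 = x" "circuit_class n g = circuit_class n f"
proof -
  obtain i where i: "i < n" "x = f i" using assms(2) by auto
  show thesis
    using that[of "\<lambda>j. f ((i + j) mod n)"] circuit_rotate[OF assms(1), of i] i by simp
qed

lemma finite_circuits: "finite (circuits V E)"
proof -
  let ?L = "{xs. set xs \<subseteq> V \<and> length xs \<le> card V}"
  have "circuits V E \<subseteq> (\<lambda>xs. {rotate j xs | j. True}) ` ?L"
  proof
    fix c assume "c \<in> circuits V E"
    then obtain n f where f: "circuit V E n f" and c: "c = circuit_class n f" by (auto simp: circuits_def)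
    have sub: "f ` {..<n} \<subseteq> V" and inj: "inj_on f {..<n}"
      using f by (auto simp: circuit_def walk_def)
    have "n = card (f ` {..<n})" using inj by (simp add: card_image)
    also have "\<dots> \<le> card V" using sub finite_V by (rule card_mono[rotated])
    finally have "map f [0..<n] \<in> ?L" using sub by auto
    then show "c \<in> (\<lambda>xs. {rotate j xs | j. True}) ` ?L" unfolding c circuit_class_def by (rule imageI)
  qed
  then show ?thesis using finite_lists_length_le[OF finite_V] finite_subset by blast
qed

lemma circuit_length: "circuit V E n f \<Longrightarrow> 1 \<le> n \<and> n \<le> card V"
proof -
  assume f: "circuit V E n f"
  have sub: "f ` {..<n} \<subseteq> V" and inj: "inj_on f {..<n}" and n: "1 \<le> n"
    using f by (auto simp: circuit_def walk_def)
  have "n = card (f ` {..<n})" using inj by (simp add: card_image)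
  also have "\<dots> \<le> card V" using sub finite_V by (rule card_mono[rotated])
  finally show ?thesis using n by simp
qed

lemma walk_relpow:
  assumes "walk V E N w" "i \<le> j" "enat j \<le> N"
  shows "(w i, w j) \<in> E ^^ (j - i)"
proof -
  have e: "(w k, w (Suc k)) \<in> E" if "k < j" for k
    using assms(1,3) that unfolding walk_def by (meson enat_ord_simps(2) less_le_trans)
  show ?thesis
    by (subst relpow_fun_conv, rule exI[of _ "\<lambda>k. w (i + k)"]) (use assms(2) e in auto)
qed

lemma walk_rtrancl:
  assumes "walk V E N w" "i \<le> j" "enat j \<le> N" shows "(w i, w j) \<in> E\<^sup>*"
  using relpow_imp_rtrancl[OF walk_relpow[OF assms]] .

lemma circuit_walk: "circuit V E n f \<Longrightarrow> walk V E (enat n) f"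
  by (simp add: circuit_def)

lemma circuit_rtrancl:
  assumes f: "circuit V E n f" and "i \<le> n" "j \<le> n" shows "(f i, f j) \<in> E\<^sup>*"
proof -
  have "(f i, f n) \<in> E\<^sup>*" "(f 0, f j) \<in> E\<^sup>*"
    using walk_rtrancl[OF circuit_walk[OF f]] assms(2,3) by simp_all
  moreover have "f n = f 0" using f by (simp add: circuit_def)
  ultimately show ?thesis by simp
qed

lemma circuit_edge: "circuit V E n f \<Longrightarrow> i < n \<Longrightarrow> (f i, f (Suc i)) \<in> E"
  by (simp add: circuit_def walk_def)

text \<open>A shortest path from \<open>u\<close> back to \<open>v\<close> closes up to a circuit.\<close>

lemma circuit_through_edge:
  assumes "(v, u) \<in> E" "(u, v) \<in> E\<^sup>*"
  obtains n f where "circuit V E n f" "f 0 = v" "f 1 = u"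
proof -
  define k where "k = (LEAST k. (u, v) \<in> E ^^ k)"
  have "\<exists>k. (u, v) \<in> E ^^ k" using assms(2) by (simp add: rtrancl_power)
  then have k: "(u, v) \<in> E ^^ k" unfolding k_def by (rule LeastI_ex)
  have kmin: "k \<le> l" if "(u, v) \<in> E ^^ l" for l unfolding k_def using that by (rule Least_le)
  obtain g where g: "g 0 = u" "g k = v" "\<And>i. i < k \<Longrightarrow> (g i, g (Suc i)) \<in> E"
    using k unfolding relpow_fun_conv by blast
  have path: "(g i, g j) \<in> E ^^ (j - i)" if "i \<le> j" "j \<le> k" for i j
    by (subst relpow_fun_conv, rule exI[of _ "\<lambda>l. g (i + l)"]) (use that g(3) in auto)
  have ne: "g i \<noteq> g j" if "i < j" "j \<le> k" for i j
  proof
    assume eq: "g i = g j"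
    have "(u, g i) \<in> E ^^ i" using path[of 0 i] that g(1) by simp
    moreover have "(g i, v) \<in> E ^^ (k - j)" using path[of j k] that g(2) eq by simp
    ultimately have "(u, v) \<in> E ^^ (i + (k - j))" by (rule relpow_trans)
    then show False using kmin[of "i + (k - j)"] that by simp
  qed
  define f where "f = case_nat v g"
  have f0: "f 0 = v" and fS: "f (Suc i) = g i" for i by (simp_all add: f_def)
  have fE: "(f i, f (Suc i)) \<in> E" if "i < Suc k" for i
    using that assms(1) g by (cases i) (auto simp: f0 fS)
  have "f i \<in> V" if "i \<le> Suc k" for i
  proof (cases "i < Suc k")
    case True then show ?thesis using fE[OF True] E_sub by auto
  next
    case False
    then have "i = Suc k" using that by simp
    then show ?thesis using fE[of k] E_sub by auto
  qed
  moreover have "inj_on f {..<Suc k}"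
  proof -
    have neq: "f i \<noteq> f j" if ij: "i < j" "j < Suc k" for i j
    proof (cases i)
      case 0
      obtain j' where "j = Suc j'" using ij by (cases j) auto
      then show ?thesis using ne[of j' k] ij 0 g(2) by (auto simp: f0 fS)
    next
      case (Suc i')
      obtain j' where "j = Suc j'" using ij by (cases j) auto
      then show ?thesis using ne[of i' j'] ij Suc by (auto simp: fS)
    qed
    show ?thesis
    proof (rule inj_onI)
      fix i j assume "i \<in> {..<Suc k}" "j \<in> {..<Suc k}" "f i = f j"
      then show "i = j" using neq[of i j] neq[of j i] by (cases i j rule: linorder_cases) auto
    qed
  qed
  ultimately have "circuit V E (Suc k) f"
    using fE g(2) by (simp add: circuit_def walk_def f0 fS)
  then show thesis using f0 fS[of 0] g(1) by (intro that[of "Suc k" f]) simp_all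
qed

lemma circuit_at:
  assumes "(v, v) \<in> E\<^sup>+"
  obtains n f where "circuit V E n f" "f 0 = v"
proof -
  obtain u where "(v, u) \<in> E" "(u, v) \<in> E\<^sup>*" using tranclD[OF assms] by blast
  then show thesis by (rule circuit_through_edge) (rule that)
qed

text \<open>The local form of \<open>circuits_disjoint\<close>
  (\<open>circuits_disjoint_iff_usucc\<close>): at most one edge out of a vertex stays in its strong
  component. This suits recursions on the first edge of a walk.\<close>

definition usucc :: bool where
  "usucc \<longleftrightarrow> (\<forall>v u1 u2. (v, u1) \<in> E \<and> (v, u2) \<in> E \<and> (u1, v) \<in> E\<^sup>* \<and> (u2, v) \<in> E\<^sup>* \<longrightarrow> u1 = u2)"

lemma usuccD:
  "usucc \<Longrightarrow> (v, u1) \<in> E \<Longrightarrow> (v, u2) \<in> E \<Longrightarrow> (u1, v) \<in> E\<^sup>* \<Longrightarrow> (u2, v) \<in> E\<^sup>* \<Longrightarrow> u1 = u2"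
  unfolding usucc_def by blast

text \<open>The vertex lists are rotations of each other; the vertices being distinct and the base
  points equal, the rotation is trivial.\<close>

lemma same_class_same_circuit:
  assumes f: "circuit V E n f" and g: "circuit V E m g" and 0: "f 0 = g 0"
    and eq: "circuit_class n f = circuit_class m g"
  shows "f 1 = g 1"
proof -
  have n: "n \<ge> 1" "inj_on f {..<n}" "f n = f 0" using f by (auto simp: circuit_def)
  have m: "m \<ge> 1" "g m = g 0" using g by (auto simp: circuit_def)
  have "map g [0..<m] \<in> circuit_class m g"
    unfolding circuit_class_def by (rule CollectI, rule exI[of _ 0]) simp
  then have "map g [0..<m] \<in> circuit_class n f" using eq by simp
  then obtain j where j: "map g [0..<m] = rotate j (map f [0..<n])" unfolding circuit_class_def by blast
  have len: "m = n" using arg_cong[OF j, of length] by simp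
  have "g 0 = rotate j (map f [0..<n]) ! 0" using m(1) by (subst j[symmetric]) simp
  also have "\<dots> = f (j mod n)" using n(1) by (simp add: nth_rotate)
  finally have "f 0 = f (j mod n)" using 0 by simp
  then have "j mod n = 0" using inj_onD[OF n(2), of 0 "j mod n"] n(1) by simp
  then have gf: "map g [0..<m] = map f [0..<n]" using j by (subst (asm) rotate_conv_mod) simp
  show ?thesis
  \<comment> \<open>The list of a loop has a single entry, so its vertex at position 1 comes from
    the closing condition.\<close>
  proof (cases "n = 1")
    case True then show ?thesis using n(3) m(2) len 0 by simp
  next
    case False
    then have "1 < n" using n(1) by simp
    then show ?thesis using arg_cong[OF gf, of "\<lambda>xs. xs ! 1"] len by simp
  qed
qed

text \<open>Two returning edges at \<open>v\<close> extend to circuits with different second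
  vertices, hence of different classes. Conversely, two circuits restarted at a common vertex are
  forced to agree step by step, and as neither repeats a vertex early, their lengths agree
  too.\<close>

lemma circuits_disjoint_iff_usucc: "circuits_disjoint V E \<longleftrightarrow> usucc"
proof
  assume D: "circuits_disjoint V E"
  show usucc unfolding usucc_def
  proof (intro allI impI)
    fix v u1 u2 assume *: "(v, u1) \<in> E \<and> (v, u2) \<in> E \<and> (u1, v) \<in> E\<^sup>* \<and> (u2, v) \<in> E\<^sup>*"
    obtain n f where f: "circuit V E n f" "f 0 = v" "f 1 = u1" using circuit_through_edge * by metis
    obtain m g where g: "circuit V E m g" "g 0 = v" "g 1 = u2" using circuit_through_edge * by metis
    have "f 0 \<in> f ` {..<n}" "g 0 \<in> g ` {..<m}"
      using circuit_length[OF f(1)] circuit_length[OF g(1)] by (intro imageI, simp)+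
    then have "v \<in> class_vertices (circuit_class n f)" "v \<in> class_vertices (circuit_class m g)"
      using f(2) g(2) by (simp_all add: class_vertices_eq)
    then have "circuit_class n f = circuit_class m g"
      using D circuit_in_circuits[OF f(1)] circuit_in_circuits[OF g(1)] unfolding circuits_disjoint_def by blast
    then show "u1 = u2" using same_class_same_circuit[OF f(1) g(1)] f g by simp
  qed
next
  assume U: usucc
  show "circuits_disjoint V E"
    unfolding circuits_disjoint_def
  proof (intro ballI impI)
    fix c c' assume c: "c \<in> circuits V E" and c': "c' \<in> circuits V E" and ne: "c \<noteq> c'"
    show "class_vertices c \<inter> class_vertices c' = {}"
    proof (rule ccontr)
      assume "class_vertices c \<inter> class_vertices c' \<noteq> {}"
      then obtain x where x: "x \<in> class_vertices c" "x \<in> class_vertices c'" by blast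
      obtain n f0 where f0: "circuit V E n f0" "c = circuit_class n f0" using c by (auto simp: circuits_def)
      obtain m g0 where g0: "circuit V E m g0" "c' = circuit_class m g0" using c' by (auto simp: circuits_def)
      obtain f where f: "circuit V E n f" "f 0 = x" "circuit_class n f = c"
        using circuit_vertexE[OF f0(1)] x(1) f0(2) by (metis class_vertices_eq)
      obtain g where g: "circuit V E m g" "g 0 = x" "circuit_class m g = c'"
        using circuit_vertexE[OF g0(1)] x(2) g0(2) by (metis class_vertices_eq)
      have eq: "f i = g i" if "i \<le> n" "i \<le> m" for i
        using that
      proof (induction i)
        case (Suc i)
        then have i: "i < n" "i < m" "f i = g i" by auto
        show ?case
          using usuccD[OF U circuit_edge[OF f(1) i(1)] circuit_edge[OF g(1) i(2), folded i(3)]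
              circuit_rtrancl[OF f(1)] circuit_rtrancl[OF g(1), of "Suc i" i, folded i(3)]] i by simp
      qed (simp add: f(2) g(2))
      have nf: "n \<ge> 1" "inj_on f {..<n}" "f n = f 0" and mg: "m \<ge> 1" "inj_on g {..<m}" "g m = g 0"
        using f(1) g(1) by (auto simp: circuit_def)
      have "n = m"
      proof (cases n m rule: linorder_cases)
        case less
        then have "g n = g 0" using eq[of n] nf(3) f(2) g(2) by simp
        then show ?thesis using inj_onD[OF mg(2), of n 0] less mg(1) nf(1) by simp
      next
        case greater
        then have "f m = f 0" using eq[of m] mg(3) f(2) g(2) by simp
        then show ?thesis using inj_onD[OF nf(2), of m 0] greater nf(1) mg(1) by simp
      qed
      then have "map f [0..<n] = map g [0..<m]" using eq by simp
      then have "c = c'" using f(3) g(3) unfolding circuit_class_def by simp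
      then show False using ne by simp
    qed
  qed
qed

lemma not_usucc_growth:
  assumes "\<not> usucc"
  shows "\<exists>v\<in>V. \<exists>L\<ge>1. \<forall>k. 2 ^ k \<le> nwalks (k * L) v"
proof -
  obtain v u1 u2 where *: "(v, u1) \<in> E" "(v, u2) \<in> E" "(u1, v) \<in> E\<^sup>*" "(u2, v) \<in> E\<^sup>*" "u1 \<noteq> u2"
    using assms unfolding usucc_def by blast
  obtain p q where "(u1, v) \<in> E ^^ p" "(u2, v) \<in> E ^^ q" using *(3,4) by (auto simp: rtrancl_power)
  then have "2 ^ k \<le> nwalks (k * (Suc p * Suc q)) v" for k using nwalks_exponential * by blast
  moreover have "v \<in> V" using *(1) E_sub by auto
  ultimately show ?thesis by (intro bexI[of _ v] exI[of _ "Suc p * Suc q"]) auto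
qed

section \<open>Circuits contained in a walk\<close>

lemma circuits_in_walk_subset: "circuits_in_walk V E N w \<subseteq> circuits V E"
  unfolding circuits_in_walk_def using circuit_in_circuits by blast

lemma finite_circuits_in_walk: "finite (circuits_in_walk V E N w)"
  by (rule finite_subset[OF circuits_in_walk_subset finite_circuits])

lemma circuits_in_walkI:
  "circuit V E n (\<lambda>j. w (i + j)) \<Longrightarrow> enat (i + n) \<le> N \<Longrightarrow>
    circuit_class n (\<lambda>j. w (i + j)) \<in> circuits_in_walk V E N w"
  unfolding circuits_in_walk_def by blast

lemma circuits_in_walkE:
  assumes "c \<in> circuits_in_walk V E N w"
  obtains i n where "circuit V E n (\<lambda>j. w (i + j))" "enat (i + n) \<le> N" "c = circuit_class n (\<lambda>j. w (i + j))"
  using assms unfolding circuits_in_walk_def by blast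

text \<open>The circuits of \<open>w\<close> reappear in the concatenation shifted by
  \<open>n\<close>. The last clause is for a prefix that is itself a circuit and is to be added to
  the count.\<close>

lemma walk_appendE:
  assumes f: "walk V E (enat n) f" and w: "walk V E N w" and fw: "f n = w 0"
  obtains M h where "walk V E M h" "h 0 = f 0" "circuits_in_walk V E N w \<subseteq> circuits_in_walk V E M h"
    "circuit V E n f \<Longrightarrow> circuit_class n f \<in> circuits_in_walk V E M h"
proof -
  define h where "h i = (if i < n then f i else w (i - n))" for i
  have h1: "h i = f i" if "i \<le> n" for i using that fw by (auto simp: h_def)
  have h2: "h (n + i) = w i" for i by (simp add: h_def)
  have fV: "f i \<in> V" if "i \<le> n" for i using f that by (simp add: walk_def)
  have fE: "(f i, f (Suc i)) \<in> E" if "i < n" for i using f that by (simp add: walk_def)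
  have wV: "w i \<in> V" if "enat i \<le> N" for i using w that by (simp add: walk_def)
  have wE: "(w i, w (Suc i)) \<in> E" if "enat i < N" for i using w that by (simp add: walk_def)
  have shift: "enat (n + i) \<le> enat n + N \<longleftrightarrow> enat i \<le> N" "enat (n + i) < enat n + N \<longleftrightarrow> enat i < N" for i
    by (cases N; simp)+
  have "walk V E (enat n + N) h" unfolding walk_def
  proof (intro conjI allI impI)
    fix i assume i: "enat i \<le> enat n + N"
    show "h i \<in> V"
    proof (cases "i < n")
      case True then show ?thesis using h1 fV by simp
    next
      case False
      then obtain k where "i = n + k" using le_Suc_ex linorder_not_less by blast
      then show ?thesis using i wV[of k] by (simp add: h2 shift)
    qed
  next
    fix i assume i: "enat i < enat n + N"
    show "(h i, h (Suc i)) \<in> E"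
    proof (cases "i < n")
      case True then show ?thesis using h1[of i] h1[of "Suc i"] fE by simp
    next
      case False
      then obtain k where k: "i = n + k" using le_Suc_ex linorder_not_less by blast
      then show ?thesis using i wE[of k] h2[of k] h2[of "Suc k"] by (simp add: shift)
    qed
  qed
  moreover have "h 0 = f 0" using h1[of 0] by simp
  moreover have "circuits_in_walk V E N w \<subseteq> circuits_in_walk V E (enat n + N) h"
  proof
    fix c assume "c \<in> circuits_in_walk V E N w"
    then obtain i m where c: "circuit V E m (\<lambda>j. w (i + j))" "enat (i + m) \<le> N"
      "c = circuit_class m (\<lambda>j. w (i + j))" by (rule circuits_in_walkE)
    have eq: "(\<lambda>j. w (i + j)) = (\<lambda>j. h ((n + i) + j))"
      using h2 by (simp add: add.assoc)
    have "enat ((n + i) + m) \<le> enat n + N" using c(2) shift(1)[of "i + m"] by (simp add: add.assoc)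
    then show "c \<in> circuits_in_walk V E (enat n + N) h"
      using circuits_in_walkI[of m h "n + i" "enat n + N"] c(1,3) by (simp add: eq)
  qed
  moreover have "circuit_class n f \<in> circuits_in_walk V E (enat n + N) h" if c: "circuit V E n f"
  proof -
    have "circuit V E n (\<lambda>j. h (0 + j))"
      using c h1 unfolding circuit_def walk_def by (auto simp: inj_on_def)
    from circuits_in_walkI[OF this, of "enat n + N"]
    have "circuit_class n (\<lambda>j. h (0 + j)) \<in> circuits_in_walk V E (enat n + N) h" by (cases N) auto
    moreover have "map (\<lambda>j. h (0 + j)) [0..<n] = map f [0..<n]" using h1 by simp
    ultimately show ?thesis unfolding circuit_class_def by (simp only:)
  qed
  ultimately show thesis by (rule that)
qed

lemma path_walkE:
  assumes "v \<in> V" "(v, u) \<in> E\<^sup>*"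
  obtains n f where "walk V E (enat n) f" "f 0 = v" "f n = u"
proof -
  obtain n where "(v, u) \<in> E ^^ n" using assms(2) by (auto simp: rtrancl_power)
  then obtain f where f: "f 0 = v" "f n = u" "\<And>i. i < n \<Longrightarrow> (f i, f (Suc i)) \<in> E"
    unfolding relpow_fun_conv by blast
  have "f i \<in> V" if "i \<le> n" for i
  proof (cases i)
    case (Suc k)
    then show ?thesis using f(3)[of k] that E_sub by auto
  qed (use f(1) assms(1) in simp)
  then have "walk V E (enat n) f" using f(3) by (simp add: walk_def)
  then show thesis using f(1,2) by (rule that)
qed

lemma walk_extend_left:
  assumes "v \<in> V" "(v, w 0) \<in> E\<^sup>*" "walk V E N w"
  obtains M h where "walk V E M h" "h 0 = v" "circuits_in_walk V E N w \<subseteq> circuits_in_walk V E M h"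
proof -
  obtain n f where f: "walk V E (enat n) f" "f 0 = v" "f n = w 0"
    using path_walkE[OF assms(1,2)] by blast
  obtain M h where "walk V E M h" "h 0 = f 0" "circuits_in_walk V E N w \<subseteq> circuits_in_walk V E M h"
    using walk_appendE[OF f(1) assms(3) f(3)] by blast
  then show thesis using f(2) by (intro that) simp_all
qed

section \<open>Upper bound: strong components and their exits\<close>

lemma reach_card_less:
  assumes "v \<in> V" "(v, u) \<in> E\<^sup>*" "(u, v) \<notin> E\<^sup>*"
  shows "card (E\<^sup>* `` {u}) < card (E\<^sup>* `` {v})"
proof (rule psubset_card_mono)
  have "E\<^sup>* `` {v} \<subseteq> V"
  proof
    fix x assume "x \<in> E\<^sup>* `` {v}"
    then have "(v, x) \<in> E\<^sup>*" by simp
    then show "x \<in> V" using assms(1) by (cases rule: rtranclE) (use E_sub in auto)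
  qed
  then show "finite (E\<^sup>* `` {v})" using finite_V by (rule finite_subset)
  show "E\<^sup>* `` {u} \<subset> E\<^sup>* `` {v}"
  proof
    show "E\<^sup>* `` {u} \<subseteq> E\<^sup>* `` {v}" using assms(2) rtrancl_trans by fastforce
    show "E\<^sup>* `` {u} \<noteq> E\<^sup>* `` {v}" using assms(3) by auto
  qed
qed

text \<open>The endpoints of edges leaving the strong component of \<open>v\<close>, where
  \<open>x\<close> ranges over the component. Fewer vertices are reachable from an exit than from
  \<open>v\<close>, which drives the induction in \<open>upper_growth\<close>.\<close>

definition exits :: "'v \<Rightarrow> 'v set" where
  "exits v = {u. \<exists>x. (v, x) \<in> E\<^sup>* \<and> (x, v) \<in> E\<^sup>* \<and> (x, u) \<in> E \<and> (u, v) \<notin> E\<^sup>*}"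

lemma exits_V: "u \<in> exits v \<Longrightarrow> u \<in> V"
  unfolding exits_def using E_sub by blast

lemma exits_reach: "u \<in> exits v \<Longrightarrow> (v, u) \<in> E\<^sup>* \<and> (u, v) \<notin> E\<^sup>*"
  unfolding exits_def using rtrancl_into_rtrancl by fastforce

lemma finite_exits: "finite (exits v)"
  by (rule finite_subset[OF _ finite_V]) (use exits_V in blast)

text \<open>Walks inside the strong component of \<open>v\<close> are forced, so a walk of length \<open>n\<close> leaves the component
  at one of \<open>n\<close> times through one of finitely many exits.\<close>

lemma twalks_component:
  assumes U: usucc and x: "(v, x) \<in> E\<^sup>*" "(x, v) \<in> E\<^sup>*"
  shows "twalks n x \<le> n * (1 + (\<Sum>u\<in>exits v. twalks n u))"
  using x
proof (induction n arbitrary: x)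
  case 0 then show ?case by (simp add: twalks_0)
next
  case (Suc n)
  let ?S = "\<lambda>n. 1 + (\<Sum>u\<in>exits v. twalks n u)"
  let ?I = "{u \<in> E `` {x}. (u, v) \<in> E\<^sup>*}"
  have sub: "E `` {x} \<subseteq> exits v \<union> ?I" using Suc.prems unfolding exits_def by blast
  have fI: "finite ?I" by (rule finite_subset[OF _ finite_succ[of x]]) blast
  have "(\<Sum>u\<in>E `` {x}. twalks n u) \<le> (\<Sum>u\<in>exits v \<union> ?I. twalks n u)"
    using sub finite_exits fI by (intro sum_mono2) auto
  also have "\<dots> = (\<Sum>u\<in>exits v. twalks n u) + (\<Sum>u\<in>?I. twalks n u)"
    using finite_exits fI by (intro sum.union_disjoint) (auto simp: exits_def)
  finally have 1: "twalks (Suc n) x \<le> ?S n + (\<Sum>u\<in>?I. twalks n u)"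
    by (simp add: twalks_Suc)
  \<comment> \<open>At most one successor stays in the component, so the induction hypothesis is
    used at most once. Hence the factor grows linearly in \<open>n\<close>.\<close>
  have 2: "(\<Sum>u\<in>?I. twalks n u) \<le> n * ?S n"
  proof (cases "?I = {}")
    case False
    then obtain y where y: "y \<in> ?I" by blast
    have "?I = {y}"
    proof (intro equalityI subsetI)
      fix z assume z: "z \<in> ?I"
      have "(z, x) \<in> E\<^sup>*" "(y, x) \<in> E\<^sup>*" using y z Suc.prems(1) rtrancl_trans by fast+
      then have "z = y" using usuccD[OF U] y z by blast
      then show "z \<in> {y}" by simp
    qed (use y in simp)
    moreover have "(v, y) \<in> E\<^sup>*" "(y, v) \<in> E\<^sup>*"
      using Suc.prems(1) y by (auto intro: rtrancl_into_rtrancl)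
    ultimately show ?thesis using Suc.IH[of y] by simp
  next
    case True
    show ?thesis unfolding True by simp
  qed
  have "?S n \<le> ?S (Suc n)" by (simp add: sum_mono twalks_mono)
  then have "?S n + n * ?S n \<le> Suc n * ?S (Suc n)"
    by (simp only: mult_Suc) (intro add_mono mult_le_mono; simp)
  then show ?case using 1 2 by linarith
qed

text \<open>Here the component is the single vertex \<open>v\<close>, so all successors are exits
  and no factor \<open>n\<close> arises.\<close>

lemma twalks_noncyclic:
  assumes "(v, v) \<notin> E\<^sup>+"
  shows "twalks n v \<le> 1 + (\<Sum>u\<in>exits v. twalks n u)"
proof (cases n)
  case (Suc m)
  have "E `` {v} \<subseteq> exits v"
  proof
    fix u assume "u \<in> E `` {v}"
    then have e: "(v, u) \<in> E" by simp
    have "(u, v) \<notin> E\<^sup>*" using assms rtrancl_into_trancl2[OF e] by blast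
    then show "u \<in> exits v" unfolding exits_def using e by blast
  qed
  then have "(\<Sum>u\<in>E `` {v}. twalks m u) \<le> (\<Sum>u\<in>exits v. twalks m u)"
    using finite_exits by (intro sum_mono2) auto
  also have "\<dots> \<le> (\<Sum>u\<in>exits v. twalks n u)" using Suc by (intro sum_mono twalks_mono) simp
  finally show ?thesis by (simp add: Suc twalks_Suc)
qed (simp add: twalks_0)

text \<open>The base \<open>n + 1\<close> is at least 1, so a bound may be weakened to any larger
  exponent (\<open>sum_poly_bound\<close>).\<close>

definition poly_bound :: "'v \<Rightarrow> nat \<Rightarrow> bool" where
  "poly_bound v d \<longleftrightarrow> (\<exists>C. \<forall>n. twalks n v \<le> C * (n + 1) ^ d)"

lemma sum_poly_bound:
  assumes "finite S" "\<And>u. u \<in> S \<Longrightarrow> poly_bound u (d u)" "\<And>u. u \<in> S \<Longrightarrow> d u \<le> e"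
  shows "\<exists>C. \<forall>n. (\<Sum>u\<in>S. twalks n u) \<le> C * (n + 1) ^ e"
proof -
  have "\<forall>u\<in>S. \<exists>C. \<forall>n. twalks n u \<le> C * (n + 1) ^ d u"
    using assms(2) unfolding poly_bound_def by blast
  from bchoice[OF this] obtain C where C: "\<And>u n. u \<in> S \<Longrightarrow> twalks n u \<le> C u * (n + 1) ^ d u" by blast
  have "(\<Sum>u\<in>S. twalks n u) \<le> (\<Sum>u\<in>S. C u) * (n + 1) ^ e" for n
  proof -
    have "(\<Sum>u\<in>S. twalks n u) \<le> (\<Sum>u\<in>S. C u * (n + 1) ^ e)"
    proof (rule sum_mono)
      fix u assume u: "u \<in> S"
      have "(n + 1) ^ d u \<le> (n + 1) ^ e" using assms(3)[OF u] by (intro power_increasing) simp_all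
      then have "C u * (n + 1) ^ d u \<le> C u * (n + 1) ^ e" by (rule mult_le_mono2)
      then show "twalks n u \<le> C u * (n + 1) ^ e" using C[OF u, of n] by linarith
    qed
    then show ?thesis by (simp add: sum_distrib_right)
  qed
  then show ?thesis by blast
qed

text \<open>Exponent and witnessing walk are built together, which spares a separate comparison with
  the maximal number of circuits. The exponent is the largest one among the exits, plus 1 if
  \<open>v\<close> lies on a circuit.\<close>

lemma upper_growth:
  assumes U: usucc and "v \<in> V"
  shows "\<exists>d N w. walk V E N w \<and> w 0 = v \<and> d \<le> card (circuits_in_walk V E N w) \<and> poly_bound v d"
  using assms(2)
proof (induction "card (E\<^sup>* `` {v})" arbitrary: v rule: less_induct)
  case less
  have "\<forall>u\<in>exits v. \<exists>d. poly_bound u d \<and>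
    (\<exists>N w. walk V E N w \<and> w 0 = u \<and> d \<le> card (circuits_in_walk V E N w))"
  proof
    fix u assume u: "u \<in> exits v"
    from less.hyps[OF reach_card_less[OF less.prems] exits_V[OF u]] exits_reach[OF u]
    show "\<exists>d. poly_bound u d \<and> (\<exists>N w. walk V E N w \<and> w 0 = u \<and> d \<le> card (circuits_in_walk V E N w))"
      by blast
  qed
  from bchoice[OF this] obtain d where d: "\<And>u. u \<in> exits v \<Longrightarrow> poly_bound u (d u)"
    and dw: "\<And>u. u \<in> exits v \<Longrightarrow>
      \<exists>N w. walk V E N w \<and> w 0 = u \<and> d u \<le> card (circuits_in_walk V E N w)" by blast
  \<comment> \<open>Without exits the sum over exits is empty, so 0 is the right default.\<close>
  define e where "e = (if exits v = {} then 0 else Max (d ` exits v))"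
  have de: "d u \<le> e" if "u \<in> exits v" for u
    using that finite_exits by (auto simp: e_def)
  obtain C where C: "\<And>n. (\<Sum>u\<in>exits v. twalks n u) \<le> C * (n + 1) ^ e"
    using sum_poly_bound[OF finite_exits d de] by blast
  have S: "1 + (\<Sum>u\<in>exits v. twalks n u) \<le> (1 + C) * (n + 1) ^ e" for n
  proof -
    have "1 \<le> (n + 1) ^ e" by simp
    then have "1 + (\<Sum>u\<in>exits v. twalks n u) \<le> (n + 1) ^ e + C * (n + 1) ^ e"
      using C[of n] by (rule add_mono)
    then show ?thesis by (simp only: distrib_right mult_1)
  qed
  \<comment> \<open>The \<open>e\<close> circuits avoid \<open>v\<close>, so that a circuit through
    \<open>v\<close> put in front of the walk is a new one.\<close>
  have "\<exists>N w. walk V E N w \<and> w 0 = v \<and>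
      (exits v \<noteq> {} \<longrightarrow> (\<exists>c. c \<subseteq> circuits_in_walk V E N w \<and> e \<le> card c \<and>
        (\<forall>x\<in>c. v \<notin> class_vertices x)))"
  proof (cases "exits v = {}")
    case True
    have "walk V E (enat 0) (\<lambda>_. v)" using less.prems by (simp add: walk_def zero_enat_def[symmetric])
    then show ?thesis using True by (intro exI[of _ "enat 0"] exI[of _ "\<lambda>_. v"]) simp
  next
    case False
    then have "e \<in> d ` exits v" using finite_exits by (simp add: e_def)
    then obtain u where u: "u \<in> exits v" "e = d u" by auto
    obtain N w where w: "walk V E N w" "w 0 = u" "d u \<le> card (circuits_in_walk V E N w)"
      using dw[OF u(1)] by blast
    have nv: "v \<notin> class_vertices c" if cw: "c \<in> circuits_in_walk V E N w" for c
    proof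
      assume v: "v \<in> class_vertices c"
      obtain i n where c: "enat (i + n) \<le> N" "c = circuit_class n (\<lambda>j. w (i + j))"
        using circuits_in_walkE[OF cw] by blast
      obtain j where j: "j < n" "v = w (i + j)" using v c(2) by (auto simp: class_vertices_eq)
      have "enat (i + j) \<le> N" using j(1) c(1) by (meson add_left_mono enat_ord_simps(1) less_imp_le order.trans)
      then have "(w 0, w (i + j)) \<in> E\<^sup>*" using walk_rtrancl[OF w(1), of 0 "i + j"] by simp
      then show False using exits_reach[OF u(1)] j(2) w(2) by simp
    qed
    have "(v, w 0) \<in> E\<^sup>*" using exits_reach[OF u(1)] w(2) by simp
    then obtain M h where h: "walk V E M h" "h 0 = v" "circuits_in_walk V E N w \<subseteq> circuits_in_walk V E M h"
      using walk_extend_left[OF less.prems _ w(1)] by blast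
    then show ?thesis using w(3) u(2) nv by blast
  qed
  then obtain N w where w: "walk V E N w" "w 0 = v" and
    wc: "exits v \<noteq> {} \<Longrightarrow> \<exists>c. c \<subseteq> circuits_in_walk V E N w \<and> e \<le> card c \<and> (\<forall>x\<in>c. v \<notin> class_vertices x)"
    by blast
  have e0: "exits v = {} \<Longrightarrow> e = 0" by (simp add: e_def)
  show ?case
  proof (cases "(v, v) \<in> E\<^sup>+")
    case False
    have "poly_bound v e" unfolding poly_bound_def
      using order.trans[OF twalks_noncyclic[OF False] S] by blast
    moreover have "e \<le> card (circuits_in_walk V E N w)"
    proof (cases "exits v = {}")
      case False
      then show ?thesis using wc finite_circuits_in_walk card_mono by (meson order.trans)
    qed (simp add: e0)
    ultimately show ?thesis using w by blast
  next
    case True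
    obtain n f where f: "circuit V E n f" "f 0 = v" using circuit_at[OF True] by blast
    have fn: "f n = w 0" using f w(2) by (simp add: circuit_def)
    obtain M h where h: "walk V E M h" "h 0 = f 0" "circuits_in_walk V E N w \<subseteq> circuits_in_walk V E M h"
      "circuit V E n f \<Longrightarrow> circuit_class n f \<in> circuits_in_walk V E M h"
      using walk_appendE[OF circuit_walk[OF f(1)] w(1) fn] by blast
    have cf: "circuit_class n f \<in> circuits_in_walk V E M h" by (rule h(4)[OF f(1)])
    have "f 0 \<in> f ` {..<n}" using circuit_length[OF f(1)] by (intro imageI) simp
    then have vc: "v \<in> class_vertices (circuit_class n f)" using f(2) by (simp add: class_vertices_eq)
    have "Suc e \<le> card (circuits_in_walk V E M h)"
    proof (cases "exits v = {}")
      case True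
      have "card {circuit_class n f} \<le> card (circuits_in_walk V E M h)"
        using cf finite_circuits_in_walk by (intro card_mono) auto
      then show ?thesis using e0[OF True] by simp
    next
      case False
      then obtain c where c: "c \<subseteq> circuits_in_walk V E N w" "e \<le> card c" "\<forall>x\<in>c. v \<notin> class_vertices x"
        using wc by blast
      have "finite c" using c(1) finite_circuits_in_walk by (rule finite_subset)
      moreover have "circuit_class n f \<notin> c" using c(3) vc by blast
      ultimately have "Suc e \<le> card (insert (circuit_class n f) c)" using c(2) by simp
      also have "\<dots> \<le> card (circuits_in_walk V E M h)"
        using c(1) h(3) cf finite_circuits_in_walk by (intro card_mono) auto
      finally show ?thesis .
    qed
    moreover have "poly_bound v (Suc e)" unfolding poly_bound_def
    proof (intro exI[of _ "1 + C"] allI)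
      fix n
      have "twalks n v \<le> n * (1 + (\<Sum>u\<in>exits v. twalks n u))"
        by (rule twalks_component[OF U]) simp_all
      also have "\<dots> \<le> (n + 1) * ((1 + C) * (n + 1) ^ e)" using S[of n] by (intro mult_le_mono) simp_all
      also have "\<dots> = (1 + C) * (n + 1) ^ Suc e" by (simp only: power_Suc mult.left_commute)
      finally show "twalks n v \<le> (1 + C) * (n + 1) ^ Suc e" .
    qed
    ultimately show ?thesis using h(1,2) f(2) by blast
  qed
qed

section \<open>Lower bound: laps around a circuit\<close>

text \<open>Binomial coefficients satisfy the recursion that arises when one more circuit is met
  (\<open>low_bound_Suc\<close>). A lap takes at most \<open>card V\<close> steps, hence the
  dilation of \<open>n\<close>; \<open>r\<close> absorbs an initial path.\<close>

definition low_bound :: "'v \<Rightarrow> nat \<Rightarrow> bool" where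
  "low_bound v d \<longleftrightarrow> (\<exists>r. \<forall>n. n choose d \<le> twalks (card V * n + r) v)"

lemma low_bound_0: "low_bound v 0"
  unfolding low_bound_def by (intro exI[of _ 1]) (simp add: twalks_Suc)

lemma low_bound_path: "(v, u) \<in> E\<^sup>* \<Longrightarrow> low_bound u d \<Longrightarrow> low_bound v d"
proof -
  assume "(v, u) \<in> E\<^sup>*" "low_bound u d"
  then obtain k r where k: "(v, u) \<in> E ^^ k" and r: "\<And>n. n choose d \<le> twalks (card V * n + r) u"
    by (auto simp: low_bound_def rtrancl_power)
  have "n choose d \<le> twalks (card V * n + (r + k)) v" for n
    using r[of n] twalks_path[OF k, of "card V * n + r"] by (simp add: add.assoc)
  then show ?thesis unfolding low_bound_def by blast
qed

text \<open>The edge closes up to a circuit of length at most \<open>card V\<close>, so at most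
  \<open>card V - 1\<close> steps lead from \<open>y\<close> back to \<open>x\<close>.\<close>

lemma twalks_return:
  assumes "(x, y) \<in> E" "(y, x) \<in> E\<^sup>*"
  shows "card V \<ge> 1" "twalks m x \<le> twalks (m + card V - 1) y"
proof -
  obtain n f where f: "circuit V E n f" "f 0 = x" "f 1 = y" using circuit_through_edge[OF assms] by blast
  have n: "1 \<le> n" "n \<le> card V" using circuit_length[OF f(1)] by simp_all
  then show "card V \<ge> 1" by simp
  have "(f 1, f n) \<in> E ^^ (n - 1)" by (rule walk_relpow[OF circuit_walk[OF f(1)]]) (use n in auto)
  then have yx: "(y, x) \<in> E ^^ (n - 1)" using f by (simp add: circuit_def)
  have "twalks m x \<le> twalks (m + (n - 1)) y" by (rule twalks_path[OF yx])
  also have "\<dots> \<le> twalks (m + card V - 1) y" by (rule twalks_mono) (use n in simp)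
  finally show "twalks m x \<le> twalks (m + card V - 1) y" .
qed

text \<open>From \<open>x\<close> a walk either makes a lap through \<open>y\<close> or leaves
  through \<open>u\<close>. Adding the two counts is Pascal's rule.\<close>

lemma low_bound_Suc:
  assumes xy: "(x, y) \<in> E" "(y, x) \<in> E\<^sup>*" and u: "(x, u) \<in> E" "u \<noteq> y" and low: "low_bound u d"
  shows "low_bound x (Suc d)"
proof -
  note ret = twalks_return[OF xy]
  have step: "twalks m x + twalks m u \<le> twalks (m + card V) x" for m
  proof -
    have "twalks m x + twalks m u \<le> twalks (m + card V - 1) y + twalks (m + card V - 1) u"
      using ret(2)[of m] ret(1) by (intro add_mono twalks_mono) auto
    also have "\<dots> = (\<Sum>z\<in>{y, u}. twalks (m + card V - 1) z)" using u(2) by simp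
    also have "\<dots> \<le> (\<Sum>z\<in>E `` {x}. twalks (m + card V - 1) z)"
      using finite_succ xy(1) u(1) by (intro sum_mono2) auto
    also have "\<dots> \<le> twalks (Suc (m + card V - 1)) x" by (simp add: twalks_Suc)
    also have "Suc (m + card V - 1) = m + card V" using ret(1) by simp
    finally show ?thesis .
  qed
  obtain r where r: "\<And>n. n choose d \<le> twalks (card V * n + r) u" using low by (auto simp: low_bound_def)
  have "n choose Suc d \<le> twalks (card V * n + r) x" for n
  proof (induction n)
    case (Suc n)
    have "Suc n choose Suc d = (n choose d) + (n choose Suc d)" by simp
    also have "\<dots> \<le> twalks (card V * n + r) u + twalks (card V * n + r) x" using r Suc by (intro add_mono)
    also have "\<dots> \<le> twalks (card V * n + r + card V) x" using step[of "card V * n + r"] by simp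
    also have "card V * n + r + card V = card V * Suc n + r" by simp
    finally show ?case .
  qed simp
  then show ?thesis unfolding low_bound_def by blast
qed

text \<open>Each lap yields at least one further walk, even when no edge leaves the circuit;
  \<open>low_bound_Suc\<close> needs such an edge.\<close>

lemma low_bound_1:
  assumes "(x, x) \<in> E\<^sup>+"
  shows "low_bound x 1"
proof -
  obtain y where xy: "(x, y) \<in> E" "(y, x) \<in> E\<^sup>*" using tranclD[OF assms] by blast
  note ret = twalks_return[OF xy]
  have step: "Suc (twalks m x) \<le> twalks (m + card V) x" for m
  proof -
    have "twalks (m + card V - 1) y \<le> (\<Sum>z\<in>E `` {x}. twalks (m + card V - 1) z)"
      using finite_succ xy(1) by (intro member_le_sum) auto
    then have "Suc (twalks m x) \<le> twalks (Suc (m + card V - 1)) x" using ret(2)[of m] by (simp add: twalks_Suc)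
    also have "Suc (m + card V - 1) = m + card V" using ret(1) by simp
    finally show ?thesis .
  qed
  have "n choose 1 \<le> twalks (card V * n + 0) x" for n
  proof (induction n)
    case (Suc n)
    then show ?case using step[of "card V * n"] by (simp add: add.commute)
  qed simp
  then show ?thesis unfolding low_bound_def by blast
qed

text \<open>By \<open>usucc\<close>, whatever stays in the component of \<open>f 0\<close> runs
  along \<open>f\<close>. So \<open>g 0\<close> lies on \<open>f\<close>, and disjointness
  identifies the circuits.\<close>

lemma component_circuit_unique:
  assumes D: "circuits_disjoint V E" and f: "circuit V E n f" and g: "circuit V E m g"
    and fg: "(f 0, g 0) \<in> E\<^sup>*" "(g 0, f 0) \<in> E\<^sup>*"
  shows "circuit_class n f = circuit_class m g"
proof -
  have U: usucc using D circuits_disjoint_iff_usucc by simp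
  have n: "n \<ge> 1" "f n = f 0" using f by (auto simp: circuit_def)
  have on: "z \<in> f ` {..<n}" if "(f 0, z) \<in> E\<^sup>*" "(z, f 0) \<in> E\<^sup>*" for z
    using that
  proof (induction rule: rtrancl_induct)
    case base
    then show ?case using n by (intro imageI) simp
  next
    case (step y z)
    have "(y, f 0) \<in> E\<^sup>*" using step(2,4) by (rule converse_rtrancl_into_rtrancl)
    then obtain i where i: "i < n" "y = f i" using step.IH by auto
    have "(z, y) \<in> E\<^sup>*" using step(4,1) by (rule rtrancl_trans)
    then have "z = f (Suc i)"
      using usuccD[OF U step(2) circuit_edge[OF f i(1), folded i(2)]] circuit_rtrancl[OF f, of "Suc i" i] i by simp
    then show ?case using i n by (cases "Suc i = n") auto
  qed
  have "g 0 \<in> f ` {..<n}" by (rule on[OF fg])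
  moreover have "g 0 \<in> g ` {..<m}" using circuit_length[OF g] by (intro imageI) simp
  ultimately have "class_vertices (circuit_class n f) \<inter> class_vertices (circuit_class m g) \<noteq> {}"
    unfolding class_vertices_eq by blast
  then show ?thesis using D circuit_in_circuits[OF f] circuit_in_circuits[OF g]
    unfolding circuits_disjoint_def by blast
qed

text \<open>The walk is cut where it leaves the strong component of \<open>w 0\<close>. All circuits
  before the cut belong to one class, and the rest of the walk is covered by induction; if a circuit
  occurs before the cut, the exit edge raises the exponent by one.\<close>

lemma lower_growth:
  assumes D: "circuits_disjoint V E" and "walk V E N w"
  shows "\<exists>d\<ge>card (circuits_in_walk V E N w). low_bound (w 0) d"
  using assms(2)
proof (induction "card (E\<^sup>* `` {w 0})" arbitrary: N w rule: less_induct)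
  case less
  note w = less.prems
  let ?v = "w 0"
  have vV: "?v \<in> V" using w by (simp add: walk_def zero_enat_def[symmetric])
  have reach: "(?v, w i) \<in> E\<^sup>*" if "enat i \<le> N" for i
    using walk_rtrancl[OF w _ that, of 0] by simp
  have le_N: "enat i \<le> N" if "i \<le> j" "enat j \<le> N" for i j
    using that by (meson enat_ord_simps(1) order.trans)
  have same: "circuit_class n (\<lambda>l. w (i + l)) = circuit_class m (\<lambda>l. w (k + l))"
    if "circuit V E n (\<lambda>l. w (i + l))" "circuit V E m (\<lambda>l. w (k + l))"
      "enat i \<le> N" "enat k \<le> N" "(w i, ?v) \<in> E\<^sup>*" "(w k, ?v) \<in> E\<^sup>*" for i k n m
  proof (rule component_circuit_unique[OF D that(1,2)])
    show "(w (i + 0), w (k + 0)) \<in> E\<^sup>*" "(w (k + 0), w (i + 0)) \<in> E\<^sup>*"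
      using rtrancl_trans[OF that(5) reach[OF that(4)]] rtrancl_trans[OF that(6) reach[OF that(3)]] by simp_all
  qed
  \<comment> \<open>A vertex of the component reaches the circuit and is reached from it, and so
    lies on a closed walk of positive length. This is applied at \<open>w 0\<close> and at the last
    vertex before the exit.\<close>
  have cyc: "(w k, w k) \<in> E\<^sup>+"
    if c: "circuit V E n (\<lambda>l. w (i + l))" and "enat (i + n) \<le> N" "enat k \<le> N" "i + n \<le> k \<or> k = 0"
      "(w k, ?v) \<in> E\<^sup>*" "(w (i + n), ?v) \<in> E\<^sup>*" for i n k
  proof -
    have n: "n \<ge> 1" using circuit_length[OF c] by simp
    have "(w k, w i) \<in> E\<^sup>*"
      using rtrancl_trans[OF that(5) reach] le_N[OF _ that(2), of i] by simp
    moreover have "(w i, w (Suc i)) \<in> E" using circuit_edge[OF c, of 0] n by simp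
    moreover have "(w (Suc i), w (i + n)) \<in> E\<^sup>*" by (rule walk_rtrancl[OF w _ that(2)]) (use n in simp)
    moreover have "(w (i + n), w k) \<in> E\<^sup>*" by (rule rtrancl_trans[OF that(6) reach[OF that(3)]])
    ultimately show ?thesis by (meson rtrancl_into_trancl1 trancl_rtrancl_trancl)
  qed
  show ?case
  proof (cases "\<forall>i. enat i \<le> N \<longrightarrow> (w i, ?v) \<in> E\<^sup>*")
    case True
    show ?thesis
    proof (cases "circuits_in_walk V E N w = {}")
      case True
      then show ?thesis using low_bound_0 by (intro exI[of _ 0]) simp
    next
      case False
      then obtain c where c: "c \<in> circuits_in_walk V E N w" by blast
      obtain i n where i: "circuit V E n (\<lambda>j. w (i + j))" "enat (i + n) \<le> N" "c = circuit_class n (\<lambda>j. w (i + j))"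
        using c by (rule circuits_in_walkE)
      have iN: "enat i \<le> N" using le_N[OF _ i(2), of i] by simp
      have "c' = c" if c': "c' \<in> circuits_in_walk V E N w" for c'
      proof -
        obtain k m where k: "circuit V E m (\<lambda>j. w (k + j))" "enat (k + m) \<le> N" "c' = circuit_class m (\<lambda>j. w (k + j))"
          using c' by (rule circuits_in_walkE)
        have kN: "enat k \<le> N" using le_N[OF _ k(2), of k] by simp
        show ?thesis unfolding i(3) k(3)
          by (rule same[OF k(1) i(1) kN iN]) (use True kN iN in auto)
      qed
      then have "card (circuits_in_walk V E N w) \<le> card {c}" by (intro card_mono) auto
      moreover have "low_bound ?v 1"
        by (rule low_bound_1, rule cyc[OF i(1,2)]) (use True i(2) in \<open>auto simp: zero_enat_def[symmetric]\<close>)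
      ultimately show ?thesis by (intro exI[of _ 1]) simp
    qed
  next
    case False
    \<comment> \<open>The first time outside the component; the walk cannot return to the component
      afterwards.\<close>
    define i0 where "i0 = (LEAST i. enat i \<le> N \<and> (w i, ?v) \<notin> E\<^sup>*)"
    have "\<exists>i. enat i \<le> N \<and> (w i, ?v) \<notin> E\<^sup>*" using False by blast
    then have i0: "enat i0 \<le> N" "(w i0, ?v) \<notin> E\<^sup>*" unfolding i0_def by (metis (mono_tags, lifting) LeastI)+
    have min: "(w i, ?v) \<in> E\<^sup>*" if "i < i0" for i
    proof -
      have "enat i \<le> N" using le_N[OF _ i0(1), of i] that by simp
      then show ?thesis using not_less_Least[of i "\<lambda>i. enat i \<le> N \<and> (w i, ?v) \<notin> E\<^sup>*"] that
        unfolding i0_def by blast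
    qed
    have "i0 \<noteq> 0"
    proof
      assume "i0 = 0" then show False using i0(2) by simp
    qed
    then obtain j where j: "i0 = Suc j" by (cases i0) auto
    let ?u = "w (Suc j)"
    have jN: "enat j \<le> N" using le_N[OF _ i0(1), of j] j by simp
    have xu: "(w j, ?u) \<in> E" using walk_relpow[OF w, of j "Suc j"] i0(1) j by simp
    define M where "M = N - enat (Suc j)"
    define t where "t i = w (Suc j + i)" for i
    have MN: "enat i \<le> M \<longleftrightarrow> enat (Suc j + i) \<le> N" "enat i < M \<longleftrightarrow> enat (Suc j + i) < N" for i
      using i0(1) j by (cases N; auto simp: M_def)+
    have t: "walk V E M t"
      using w unfolding walk_def by (auto simp: MN t_def)
    have t0: "t 0 = ?u" by (simp add: t_def)
    have "card (E\<^sup>* `` {t 0}) < card (E\<^sup>* `` {?v})"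
      unfolding t0 using reach[of "Suc j"] i0 j by (intro reach_card_less[OF vV]) simp_all
    from less.hyps[OF this t] obtain d where d: "d \<ge> card (circuits_in_walk V E M t)" "low_bound ?u d"
      unfolding t0 by blast
    have late: "circuit_class n (\<lambda>l. w (i + l)) \<in> circuits_in_walk V E M t"
      if c: "circuit V E n (\<lambda>l. w (i + l))" "enat (i + n) \<le> N" and ji: "j < i" for i n
    proof -
      obtain k where k: "i = Suc j + k" using ji less_imp_Suc_add by fastforce
      have "(\<lambda>l. w (i + l)) = (\<lambda>l. t (k + l))" by (simp add: k t_def add.assoc)
      then show ?thesis using circuits_in_walkI[of n t k M] c MN(1)[of "k + n"] k by (simp add: add.assoc)
    qed
    \<comment> \<open>A circuit that begins in the component ends at its starting point, hence
      before the exit.\<close>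
    have early: "i + n \<le> j" if c: "circuit V E n (\<lambda>l. w (i + l))" "enat (i + n) \<le> N" "i \<le> j" for i n
    proof (rule ccontr)
      assume "\<not> i + n \<le> j"
      then have "(?u, w (i + n)) \<in> E\<^sup>*" using walk_rtrancl[OF w, of "Suc j" "i + n"] c(2) by simp
      moreover have "w (i + n) = w i" using c(1) by (simp add: circuit_def)
      moreover have "(w i, ?v) \<in> E\<^sup>*" using min[of i] c(3) j by simp
      ultimately have "(?u, ?v) \<in> E\<^sup>*" by (metis rtrancl_trans)
      then show False using i0(2) j by simp
    qed
    show ?thesis
    proof (cases "\<exists>i n. i \<le> j \<and> enat (i + n) \<le> N \<and> circuit V E n (\<lambda>l. w (i + l))")
      case False
      have "circuits_in_walk V E N w \<subseteq> circuits_in_walk V E M t"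
      proof
        fix c assume "c \<in> circuits_in_walk V E N w"
        then obtain i n where "circuit V E n (\<lambda>j. w (i + j))" "enat (i + n) \<le> N" "c = circuit_class n (\<lambda>j. w (i + j))"
          by (rule circuits_in_walkE)
        then show "c \<in> circuits_in_walk V E M t" using late False by (meson not_le)
      qed
      then have "card (circuits_in_walk V E N w) \<le> card (circuits_in_walk V E M t)"
        by (rule card_mono[OF finite_circuits_in_walk])
      then have "card (circuits_in_walk V E N w) \<le> d" using d(1) by simp
      moreover have "(?v, ?u) \<in> E\<^sup>*" using reach[of "Suc j"] i0(1) j by simp
      ultimately show ?thesis using low_bound_path d(2) by blast
    next
      case True
      then obtain i n where i: "i \<le> j" "enat (i + n) \<le> N" "circuit V E n (\<lambda>l. w (i + l))" by blast
      have inj: "i + n \<le> j" by (rule early[OF i(3,2,1)])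
      have iN: "enat i \<le> N" using le_N[OF i(1) jN] .
      let ?c = "circuit_class n (\<lambda>l. w (i + l))"
      have "circuits_in_walk V E N w \<subseteq> insert ?c (circuits_in_walk V E M t)"
      proof
        fix c assume "c \<in> circuits_in_walk V E N w"
        then obtain k m where k: "circuit V E m (\<lambda>j. w (k + j))" "enat (k + m) \<le> N" "c = circuit_class m (\<lambda>j. w (k + j))"
          by (rule circuits_in_walkE)
        show "c \<in> insert ?c (circuits_in_walk V E M t)"
        proof (cases "j < k")
          case True
          then show ?thesis using late[OF k(1,2)] k(3) by simp
        next
          case False
          then have kj: "k \<le> j" by simp
          have "c = ?c" unfolding k(3)
            by (rule same[OF k(1) i(3) le_N[OF kj jN] iN]) (use min kj i(1) j in auto)
          then show ?thesis by simp
        qed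
      qed
      then have "card (circuits_in_walk V E N w) \<le> card (insert ?c (circuits_in_walk V E M t))"
        by (rule card_mono[rotated]) (simp add: finite_circuits_in_walk)
      also have "\<dots> \<le> Suc (card (circuits_in_walk V E M t))"
        using finite_circuits_in_walk by (simp add: card_insert_if)
      finally have "card (circuits_in_walk V E N w) \<le> Suc d" using d(1) by simp
      moreover have "low_bound ?v (Suc d)"
      proof (rule low_bound_path[OF reach[OF jN]])
        have xv: "(w j, ?v) \<in> E\<^sup>*" using min[of j] j by simp
        have "(w j, w j) \<in> E\<^sup>+"
          by (rule cyc[OF i(3,2) jN _ xv]) (use inj min[of "i + n"] j in auto)
        then obtain y where y: "(w j, y) \<in> E" "(y, w j) \<in> E\<^sup>*" using tranclD by metis
        \<comment> \<open>\<open>y\<close> can still reach \<open>w 0\<close> and \<open>?u\<close>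
          cannot, which gives the two different edges for \<open>low_bound_Suc\<close>.\<close>
        have "?u \<noteq> y"
        proof
          assume "?u = y"
          then have "(?u, ?v) \<in> E\<^sup>*" using rtrancl_trans[OF y(2) xv] by simp
          then show False using i0(2) j by simp
        qed
        then show "low_bound (w j) (Suc d)" using low_bound_Suc[OF y xu _ d(2)] by simp
      qed
      ultimately show ?thesis by blast
    qed
  qed
qed

end

section \<open>Growth exponents\<close>

lemma elog_enat: "elog n (enat m) = ereal (log (real n) (real m))"
  by (simp add: elog_def)

text \<open>The logarithm of C (n + 1)^D to base n is ln C / ln n + D ln (n + 1) / ln n, which tends
  to D.\<close>

lemma limsup_elog_le:
  fixes a :: "nat \<Rightarrow> nat"
  assumes pos: "\<And>n. 1 \<le> a n" and bound: "\<And>n. a n \<le> C * (n + 1) ^ D"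
  shows "limsup (\<lambda>n. elog n (enat (a n))) \<le> ereal (real D)"
proof -
  have C: "real C \<ge> 1" using order.trans[OF pos bound, of 0] by simp
  define g where "g n = ln (real C) / ln (real n) + real D * (ln (real n + 1) / ln (real n))" for n :: nat
  have "(\<lambda>n. ln (real C) / ln (real n)) \<longlonglongrightarrow> 0" by real_asymp
  moreover have "(\<lambda>n. ln (real n + 1) / ln (real n)) \<longlonglongrightarrow> 1" by real_asymp
  ultimately have "g \<longlonglongrightarrow> 0 + real D * 1"
    unfolding g_def by (intro tendsto_add tendsto_mult tendsto_const)
  then have lim: "(\<lambda>n. ereal (g n)) \<longlonglongrightarrow> ereal (real D)" by simp
  have "eventually (\<lambda>n. elog n (enat (a n)) \<le> ereal (g n)) sequentially"
    using eventually_ge_at_top[of 2]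
  proof eventually_elim
    case (elim n)
    have "real (a n) \<le> real (C * (n + 1) ^ D)" using bound[of n] by (intro of_nat_mono)
    also have "\<dots> = real C * (real n + 1) ^ D" by (simp add: add.commute)
    finally have le: "real (a n) \<le> real C * (real n + 1) ^ D" .
    have "ln (real (a n)) \<le> ln (real C * (real n + 1) ^ D)"
      using pos[of n] le by (intro ln_mono) auto
    also have "\<dots> = ln (real C) + real D * ln (real n + 1)"
      using C by (simp add: ln_mult ln_realpow)
    finally have "ln (real (a n)) / ln (real n) \<le> (ln (real C) + real D * ln (real n + 1)) / ln (real n)"
      using elim by (intro divide_right_mono) auto
    then show ?case by (simp add: elog_enat log_def g_def add_divide_distrib)
  qed
  then have "limsup (\<lambda>n. elog n (enat (a n))) \<le> limsup (\<lambda>n. ereal (g n))" by (rule Limsup_mono)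
  also have "\<dots> = ereal (real D)" using lim by (intro lim_imp_Limsup) simp_all
  finally show ?thesis .
qed

lemma limsup_elog_ge:
  fixes a :: "nat \<Rightarrow> nat"
  assumes mono: "mono a" and K: "1 \<le> K" and bound: "\<And>n. n choose d \<le> a (K * n + r)"
  shows "ereal (real d) \<le> limsup (\<lambda>n. elog n (enat (a n)))"
proof -
  \<comment> \<open>For large m the quotient n = (m - r) div K is at least m / (4 K), the 4
    absorbing \<open>r\<close> and rounding. Then n choose d is at least (n / d)^d, hence at least
    (m / c)^d; taking d + 1 instead of d keeps \<open>c\<close> positive for d = 0.\<close>
  define c where "c = 4 * real K * (real d + 1)"
  have c: "c > 0" using K by (simp add: c_def)
  define g where "g m = real d * (1 - ln c / ln (real m))" for m :: nat
  have "(\<lambda>m. ln c / ln (real m)) \<longlonglongrightarrow> 0" by real_asymp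
  then have "g \<longlonglongrightarrow> real d * (1 - 0)"
    unfolding g_def by (intro tendsto_diff tendsto_mult tendsto_const)
  then have lim: "(\<lambda>m. ereal (g m)) \<longlonglongrightarrow> ereal (real d)" by simp
  have "eventually (\<lambda>m. ereal (g m) \<le> elog m (enat (a m))) sequentially"
    using eventually_ge_at_top[of "2 * r + 4 * K * (d + 1) + 2"]
  proof eventually_elim
    case (elim m)
    define n where "n = (m - r) div K"
    have rm: "2 * r \<le> m" by (rule order.trans[OF _ elim]) simp
    have Kn: "K * n + r \<le> m"
      using times_div_less_eq_dividend[of K "m - r"] rm unfolding n_def by linarith
    have "m - r < K * n + K"
      using K mod_less_divisor[of K "m - r"] mult_div_mod_eq[of K "m - r"] unfolding n_def by linarith
    then have "real (m - r) < real (K * n + K)" by (rule of_nat_less_iff[THEN iffD2])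
    then have 1: "real m - real r < real K * real n + real K" using rm by simp
    have m: "real m \<ge> 2 * real r + 4 * real K * (real d + 1) + 2"
      using of_nat_mono[OF elim, where 'a = real] by (simp add: algebra_simps)
    have Kd: "real K * (real d + 1) \<ge> real K" using K by simp
    have "real K * real n \<ge> real m / 4"
      using 1 m Kd of_nat_0_le_iff[of m, where 'a = real] of_nat_0_le_iff[of K, where 'a = real] by linarith
    then have n4: "real n \<ge> real m / (4 * real K)" using K by (simp add: field_simps)
    have "real m / (4 * real K) \<ge> real d + 1" using m K by (simp add: field_simps)
    then have dn: "d \<le> n" using n4 by linarith
    have base: "real m / c \<le> (if d = 0 then 1 else real n / real d) \<or> d = 0"
    proof (cases "d = 0")
      case False
      have "real m / c = (real m / (4 * real K)) / (real d + 1)" by (simp add: c_def)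
      also have "\<dots> \<le> real n / (real d + 1)" using n4 by (intro divide_right_mono) simp_all
      also have "\<dots> \<le> real n / real d" using False by (intro divide_left_mono) simp_all
      finally show ?thesis using False by simp
    qed simp
    have "(real m / c) ^ d \<le> (real n / real d) ^ d"
    proof (cases "d = 0")
      case False
      then show ?thesis using base c by (intro power_mono) auto
    qed simp
    also have "\<dots> \<le> real (n choose d)" using dn by (rule binomial_ge_n_over_k_pow_k)
    also have "\<dots> \<le> real (a (K * n + r))" using bound by (intro of_nat_mono)
    also have "\<dots> \<le> real (a m)" using monoD[OF mono Kn] by (intro of_nat_mono)
    finally have le: "(real m / c) ^ d \<le> real (a m)" .
    have m0: "real m > 0" "ln (real m) > 0" using elim by auto
    have "ln ((real m / c) ^ d) \<le> ln (real (a m))"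
      using le m0 c by (intro ln_mono) (simp_all add: zero_less_power)
    then have "real d * (ln (real m) - ln c) \<le> ln (real (a m))"
      using m0 c by (simp add: ln_realpow ln_div)
    then have "real d * (ln (real m) - ln c) / ln (real m) \<le> ln (real (a m)) / ln (real m)"
      using m0 by (intro divide_right_mono) auto
    moreover have "real d * (ln (real m) - ln c) / ln (real m) = g m"
      using m0 by (simp add: g_def field_simps)
    ultimately show ?case by (simp add: elog_enat log_def)
  qed
  then have "limsup (\<lambda>m. ereal (g m)) \<le> limsup (\<lambda>n. elog n (enat (a n)))" by (rule Limsup_mono)
  moreover have "limsup (\<lambda>m. ereal (g m)) = ereal (real d)" using lim by (intro lim_imp_Limsup) simp_all
  ultimately show ?thesis by simp
qed

lemma limsup_elog_infinite:
  fixes a :: "nat \<Rightarrow> nat"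
  assumes mono: "mono a" and L: "1 \<le> L" and bound: "\<And>k. 2 ^ k \<le> a (k * L + r)"
  shows "limsup (\<lambda>n. elog n (enat (a n))) = \<infinity>"
proof -
  \<comment> \<open>With k = (m - r) div L at least m / (4 L), the bound 2^k gives ln (a m) at least
    c m, and m / ln m is unbounded.\<close>
  define c where "c = ln 2 / (4 * real L)"
  have c: "c > 0" using L by (simp add: c_def)
  have "filterlim (\<lambda>m. c * (real m / ln (real m))) at_top sequentially"
  proof (rule filterlim_tendsto_pos_mult_at_top[OF tendsto_const c])
    show "filterlim (\<lambda>m. real m / ln (real m)) at_top sequentially" by real_asymp
  qed
  then have lim: "(\<lambda>m. ereal (c * (real m / ln (real m)))) \<longlonglongrightarrow> \<infinity>"
    by (simp add: tendsto_PInfty_eq_at_top)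
  have "eventually (\<lambda>m. ereal (c * (real m / ln (real m))) \<le> elog m (enat (a m))) sequentially"
    using eventually_ge_at_top[of "2 * r + 4 * L + 2"]
  proof eventually_elim
    case (elim m)
    define k where "k = (m - r) div L"
    have kL: "k * L + r \<le> m"
      using elim div_times_less_eq_dividend[of "m - r" L] unfolding k_def by linarith
    have "m - r < k * L + L"
      using L mod_less_divisor[of L "m - r"] div_mult_mod_eq[of "m - r" L] unfolding k_def by linarith
    then have "real (m - r) < real (k * L + L)" by (rule of_nat_less_iff[THEN iffD2])
    then have 1: "real m - real r < real k * real L + real L" using elim by simp
    have m: "real m \<ge> 2 * real r + 4 * real L + 2"
      using of_nat_mono[OF elim, where 'a = real] by simp
    have "real k * real L \<ge> real m / 4" using 1 m of_nat_0_le_iff[of m, where 'a = real] of_nat_0_le_iff[of L, where 'a = real] by linarith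
    then have k4: "real k \<ge> real m / (4 * real L)" using L by (simp add: field_simps)
    have "(2::nat) ^ k \<le> a m" using bound[of k] monoD[OF mono kL] by linarith
    then have "real (2 ^ k) \<le> real (a m)" by (rule of_nat_mono)
    then have "ln ((2::real) ^ k) \<le> ln (real (a m))" by (intro ln_mono) simp_all
    then have "real k * ln 2 \<le> ln (real (a m))" by (simp add: ln_realpow)
    moreover have "real m / (4 * real L) * ln 2 \<le> real k * ln 2" using k4 by (intro mult_right_mono) simp_all
    ultimately have "c * real m \<le> ln (real (a m))" by (simp add: c_def mult.commute)
    moreover have "ln (real m) > 0" using elim by simp
    ultimately have "c * real m / ln (real m) \<le> ln (real (a m)) / ln (real m)"
      by (intro divide_right_mono) auto
    then show ?case by (simp add: elog_enat log_def)
  qed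
  then have "limsup (\<lambda>m. ereal (c * (real m / ln (real m)))) \<le> limsup (\<lambda>n. elog n (enat (a n)))"
    by (rule Limsup_mono)
  moreover have "limsup (\<lambda>m. ereal (c * (real m / ln (real m)))) = \<infinity>"
    using lim by (intro lim_imp_Limsup) simp_all
  ultimately show ?thesis by simp
qed

section \<open>The CPS graph and the resolution\<close>

context mono_alg
begin

text \<open>\<open>cps_L I w m = w\<close> says that no proper suffix of \<open>w\<close> kills
  \<open>m\<close>, which is the minimality in \<open>nxt\<close>. The tail \<open>\<gamma>\<close>
  is arbitrary because a path is continued according to its last vertex alone.\<close>

lemma cps_A_eq:
  assumes m: "m \<in> words s"
  shows "cps_A s I m = nxt (m # \<gamma>)"
proof (intro equalityI subsetI)
  let ?P = "\<lambda>w w'. suffix w' w \<and> mon (w' @ m) \<in> I"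
  fix w
  { assume "w \<in> words s"
    then have P: "?P w w' \<longleftrightarrow> suffix w' w \<and> bad (w' @ m)" for w'
      using m by (auto simp: mon_in_I suffix_def)
  } note P = this
  { assume "w \<in> cps_A s I m"
    then have w: "w \<in> words s" "\<not> bad w" "bad (w @ m)" and L: "cps_L I w m = w"
      using m by (auto simp: cps_A_def mon_in_I)
    have "\<not> bad (w' @ m)" if ss: "strict_suffix w' w" for w'
    proof
      assume "bad (w' @ m)"
      then have "?P w w'" using ss unfolding P[OF w(1)] by (simp add: strict_suffix_def)
      moreover have "?P w w" using w(3) unfolding P[OF w(1)] by simp
      ultimately have "length (cps_L I w m) \<le> length w'"
        unfolding cps_L_def using arg_min_nat_lemma[of "?P w" w length] by blast
      then show False using L suffix_length_less[OF ss] by simp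
    qed
    then show "w \<in> nxt (m # \<gamma>)" using w by (simp add: nxt_def) }
  { assume "w \<in> nxt (m # \<gamma>)"
    then have w: "w \<in> words s" "\<not> bad w" "bad (w @ m)"
      and min: "\<And>w'. strict_suffix w' w \<Longrightarrow> \<not> bad (w' @ m)" by (auto simp: nxt_def)
    have "?P w w" using w(3) unfolding P[OF w(1)] by simp
    then have "?P w (cps_L I w m)"
      unfolding cps_L_def using arg_min_nat_lemma[of "?P w" w length] by blast
    then have "cps_L I w m = w" using min unfolding P[OF w(1)] by (auto simp: strict_suffix_def)
    then show "w \<in> cps_A s I m" using w m by (simp add: cps_A_def mon_in_I) }
qed

section \<open>The CPS graph as a finite digraph\<close>

abbreviation VV where "VV \<equiv> cps_vertices s I"
abbreviation EE where "EE \<equiv> cps_edges s I"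

lemma cps_G_0: "cps_G s I 0 = nxt []"
  by (simp add: nxt_Nil)

lemma cps_G_words: "w \<in> cps_G s I n \<Longrightarrow> w \<in> words s \<and> \<not> bad w"
proof (cases n)
  case 0
  assume "w \<in> cps_G s I n"
  then show ?thesis unfolding 0 cps_G_0 by (simp add: nxt_def)
next
  case (Suc m)
  assume "w \<in> cps_G s I n"
  then obtain v where "w \<in> cps_A s I v" using Suc by auto
  then show ?thesis by (auto simp: cps_A_def mon_in_I)
qed

lemma vertices_words: "w \<in> VV \<Longrightarrow> w \<in> words s \<and> \<not> bad w"
  unfolding cps_vertices_def using cps_G_words by blast

lemma letters_vertices: "nxt [] \<subseteq> VV"
  unfolding cps_vertices_def using cps_G_0 by blast

lemma nxt_vertices: "m \<in> VV \<Longrightarrow> nxt (m # \<gamma>) \<subseteq> VV"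
proof -
  assume m: "m \<in> VV"
  then obtain n where n: "m \<in> cps_G s I n" unfolding cps_vertices_def by blast
  have "nxt (m # \<gamma>) = cps_A s I m" using cps_A_eq vertices_words[OF m] by simp
  also have "\<dots> \<subseteq> cps_G s I (Suc n)" using n by auto
  finally show ?thesis unfolding cps_vertices_def by blast
qed

lemma finite_vertices: "finite VV"
proof (rule finite_subset)
  show "VV \<subseteq> nxt [] \<union> (\<Union>r\<in>R. set (prefixes r))"
  proof
    fix w assume "w \<in> VV"
    then obtain n where n: "w \<in> cps_G s I n" unfolding cps_vertices_def by blast
    show "w \<in> nxt [] \<union> (\<Union>r\<in>R. set (prefixes r))"
    proof (cases n)
      case 0
      then show ?thesis using n cps_G_0 by blast
    next
      case (Suc k)
      then obtain m where m: "m \<in> cps_G s I k" "w \<in> cps_A s I m" using n by auto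
      have "m \<in> words s" "\<not> bad m" using cps_G_words[OF m(1)] by simp_all
      then show ?thesis using m(2) cps_A_eq[of m "[]"] nxt_subset_prefixes[of m "[]"] by blast
    qed
  qed
  show "finite (nxt [] \<union> (\<Union>r\<in>R. set (prefixes r)))"
    using finite_nxt[of "[]"] R_finite by simp
qed

lemma edges_eq: "m \<in> VV \<Longrightarrow> EE `` {m} = nxt (m # \<gamma>)"
  using cps_A_eq[of m \<gamma>] vertices_words[of m] by (auto simp: cps_edges_def)

lemma fin_digraph_cps: "fin_digraph VV EE"
proof
  show "EE \<subseteq> VV \<times> VV"
  proof
    fix e assume e: "e \<in> EE"
    then have "fst e \<in> VV" "snd e \<in> EE `` {fst e}" by (auto simp: cps_edges_def)
    then show "e \<in> VV \<times> VV" using nxt_vertices[of "fst e" "[]"] edges_eq[of "fst e" "[]"]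
      by (auto simp: mem_Times_iff)
  qed
qed (rule finite_vertices)

interpretation G: fin_digraph VV EE by (rule fin_digraph_cps)

text \<open>Vertices are generated level by level from the letters. Growth observed at any vertex is
  therefore seen by walks from letters, after a bounded delay.\<close>

lemma reachable_from_letter: "v \<in> VV \<Longrightarrow> \<exists>x\<in>nxt []. (x, v) \<in> EE\<^sup>*"
proof -
  have "\<exists>x\<in>nxt []. (x, v) \<in> EE\<^sup>*" if "v \<in> cps_G s I n" for n
    using that
  proof (induction n arbitrary: v)
    case 0
    then show ?case unfolding cps_G_0 by blast
  next
    case (Suc n)
    then obtain w where w: "w \<in> cps_G s I n" "v \<in> cps_A s I w" by auto
    then have "(w, v) \<in> EE" unfolding cps_edges_def cps_vertices_def by blast
    then show ?case using Suc.IH[OF w(1)] rtrancl_into_rtrancl by metis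
  qed
  then show "v \<in> VV \<Longrightarrow> ?thesis" unfolding cps_vertices_def by blast
qed

section \<open>Counting the generators of the resolution\<close>

lemma sum_paths_Suc: "(\<Sum>\<beta>\<in>paths (Suc n). g (hd \<beta>)) = (\<Sum>\<beta>\<in>paths n. \<Sum>w\<in>nxt \<beta>. g w)"
proof -
  let ?h = "\<lambda>(\<beta>, w). w # \<beta>"
  have eq: "paths (Suc n) = ?h ` (SIGMA \<beta>:paths n. nxt \<beta>)" by (auto simp: paths.simps)
  have "inj_on ?h (SIGMA \<beta>:paths n. nxt \<beta>)" by (auto simp: inj_on_def)
  then have "(\<Sum>\<beta>\<in>paths (Suc n). g (hd \<beta>)) = (\<Sum>(\<beta>, w)\<in>(SIGMA \<beta>:paths n. nxt \<beta>). g w)"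
    unfolding eq by (simp add: sum.reindex case_prod_unfold)
  also have "\<dots> = (\<Sum>\<beta>\<in>paths n. \<Sum>w\<in>nxt \<beta>. g w)"
    using finite_paths finite_nxt' by (intro sum.Sigma[symmetric]) auto
  finally show ?thesis .
qed

lemma paths_Suc_hd: "\<beta> \<in> paths (Suc n) \<Longrightarrow> \<exists>m \<gamma>. \<beta> = m # \<gamma> \<and> m \<in> VV"
proof (induction n arbitrary: \<beta>)
  case 0
  then show ?case using letters_vertices by (auto simp: paths.simps)
next
  case (Suc n)
  then obtain w \<gamma> where w: "\<beta> = w # \<gamma>" "\<gamma> \<in> paths (Suc n)" "w \<in> nxt \<gamma>" by (auto simp: paths.simps(2)[of "Suc n"])
  obtain m \<delta> where "\<gamma> = m # \<delta>" "m \<in> VV" using Suc.IH[OF w(2)] by blast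
  then have "w \<in> VV" using w(3) nxt_vertices by blast
  then show ?case using w(1) by blast
qed

text \<open>Paths are extended at their end, while \<open>nwalks\<close> recurses on the first edge.
  With \<open>j\<close> further steps allowed, the induction moves one step at a time from the path
  to the walk.\<close>

lemma sum_paths_nwalks:
  "(\<Sum>\<beta>\<in>paths (Suc i). G.nwalks j (hd \<beta>)) = (\<Sum>x\<in>nxt []. G.nwalks (i + j) x)"
proof (induction i arbitrary: j)
  case 0
  show ?case unfolding sum_paths_Suc by (simp add: paths.simps)
next
  case (Suc i)
  have "(\<Sum>\<beta>\<in>paths (Suc (Suc i)). G.nwalks j (hd \<beta>)) =
    (\<Sum>\<beta>\<in>paths (Suc i). \<Sum>w\<in>nxt \<beta>. G.nwalks j w)" by (rule sum_paths_Suc)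
  also have "\<dots> = (\<Sum>\<beta>\<in>paths (Suc i). G.nwalks (Suc j) (hd \<beta>))"
  proof (rule sum.cong[OF refl])
    fix \<beta> assume "\<beta> \<in> paths (Suc i)"
    then obtain m \<gamma> where "\<beta> = m # \<gamma>" "m \<in> VV" using paths_Suc_hd by blast
    then show "(\<Sum>w\<in>nxt \<beta>. G.nwalks j w) = G.nwalks (Suc j) (hd \<beta>)"
      using edges_eq[of m \<gamma>] by simp
  qed
  also have "\<dots> = (\<Sum>x\<in>nxt []. G.nwalks (i + Suc j) x)" by (rule Suc.IH)
  finally show ?case by simp
qed

lemma card_paths_Suc: "card (paths (Suc i)) = (\<Sum>x\<in>nxt []. G.nwalks i x)"
  using sum_paths_nwalks[of 0 i] by simp

text \<open>The rank of the resolution in degrees 0 to \<open>n\<close>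
  (\<open>sum_card_paths\<close>); the summand 1 is the generator of degree 0.\<close>

definition growth :: "nat \<Rightarrow> nat" where
  "growth n = 1 + (\<Sum>x\<in>nxt []. G.twalks n x)"

lemma sum_card_paths: "(\<Sum>i\<le>n. card (paths i)) = growth n"
proof -
  have "(\<Sum>i\<le>n. card (paths i)) = card (paths 0) + (\<Sum>i<n. card (paths (Suc i)))"
    by (rule sum.atMost_shift)
  also have "(\<Sum>i<n. card (paths (Suc i))) = (\<Sum>x\<in>nxt []. G.twalks n x)"
    unfolding card_paths_Suc G.twalks_def by (rule sum.swap)
  finally show ?thesis by (simp add: growth_def paths.simps(1))
qed

lemma mono_growth: "mono growth"
  unfolding growth_def by (intro monoI add_left_mono sum_mono G.twalks_mono)

lemma finite_letters: "finite (nxt [])"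
  by (rule finite_nxt) simp

lemma twalks_le_growth: "x \<in> nxt [] \<Longrightarrow> G.twalks n x \<le> growth n"
  unfolding growth_def using member_le_sum[of x "nxt []" "G.twalks n"] finite_letters by simp

section \<open>The exponent of growth\<close>

lemma GKdim_eq_limsup:
  assumes "projective_resolution A N X"
  shows "GKdim (yoneda_algebra A N X) (yoneda_component A N X) = limsup (\<lambda>n. elog n (enat (growth n)))"
proof -
  have "(\<Sum>i\<le>n. vdim (yoneda_algebra A N X) (yoneda_component A N X i)) = enat (growth n)" for n
    unfolding vdim_Ext_trivial[OF assms] sum_card_paths[symmetric]
    by (simp add: of_nat_eq_enat[symmetric])
  then show ?thesis by (simp add: GKdim_def)
qed

lemma circuit_counts_bdd:
  "x \<in> {card (circuits_in_walk VV EE L w) | L w. walk VV EE L w} \<Longrightarrow> x \<le> card (circuits VV EE)"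
  using card_mono[OF G.finite_circuits G.circuits_in_walk_subset] by blast

text \<open>\<open>Sup\<close> on natural numbers is an upper bound only for bounded sets; the
  finite number of circuits supplies the bound.\<close>

lemma circuits_le_max: "walk VV EE L w \<Longrightarrow> card (circuits_in_walk VV EE L w) \<le> max_circuits_in_walk VV EE"
  unfolding max_circuits_in_walk_def
  by (rule cSup_upper) (use circuit_counts_bdd in \<open>auto simp: bdd_above_def\<close>)

lemma limsup_growth_disjoint:
  assumes D: "circuits_disjoint VV EE"
  shows "limsup (\<lambda>n. elog n (enat (growth n))) = ereal (real (max_circuits_in_walk VV EE))"
proof (rule antisym)
  let ?D = "max_circuits_in_walk VV EE"
  have pos: "1 \<le> growth n" for n by (simp add: growth_def)
  have U: "G.usucc" using D G.circuits_disjoint_iff_usucc by simp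
  have "\<forall>x\<in>nxt []. \<exists>d. G.poly_bound x d \<and> d \<le> ?D"
  proof
    fix x assume "x \<in> nxt []"
    then have "x \<in> VV" using letters_vertices by blast
    then obtain d L w where "walk VV EE L w" "d \<le> card (circuits_in_walk VV EE L w)" "G.poly_bound x d"
      using G.upper_growth[OF U] by blast
    then show "\<exists>d. G.poly_bound x d \<and> d \<le> ?D" using circuits_le_max order.trans by blast
  qed
  from bchoice[OF this] obtain d where d: "\<And>x. x \<in> nxt [] \<Longrightarrow> G.poly_bound x (d x)"
    "\<And>x. x \<in> nxt [] \<Longrightarrow> d x \<le> ?D" by blast
  obtain C where C: "\<And>n. (\<Sum>x\<in>nxt []. G.twalks n x) \<le> C * (n + 1) ^ ?D"
    using G.sum_poly_bound[OF finite_letters d] by blast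
  have "growth n \<le> (1 + C) * (n + 1) ^ ?D" for n
  proof -
    have "1 \<le> (n + 1) ^ ?D" by simp
    then have "growth n \<le> (n + 1) ^ ?D + C * (n + 1) ^ ?D"
      unfolding growth_def using C[of n] by (rule add_mono)
    then show ?thesis by (simp only: distrib_right mult_1)
  qed
  then show "limsup (\<lambda>n. elog n (enat (growth n))) \<le> ereal (real ?D)"
    by (rule limsup_elog_le[OF pos])
  let ?X = "{card (circuits_in_walk VV EE L w) | L w. walk VV EE L w}"
  show "ereal (real ?D) \<le> limsup (\<lambda>n. elog n (enat (growth n)))"
  \<comment> \<open>A graph without vertices has no walks; \<open>Sup\<close> of the empty set is 0,
    and \<open>growth\<close> is at least 1 = n choose 0.\<close>
  proof (cases "?X = {}")
    case True
    then have "?D = 0" by (simp add: max_circuits_in_walk_def Sup_nat_def)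
    moreover have "ereal (real 0) \<le> limsup (\<lambda>n. elog n (enat (growth n)))"
      by (rule limsup_elog_ge[OF mono_growth, of 1 0 0]) (simp_all add: growth_def)
    ultimately show ?thesis by simp
  next
    case False
    have fin: "finite ?X" by (rule finite_subset[of _ "{..card (circuits VV EE)}"]) (use circuit_counts_bdd in auto)
    \<comment> \<open>The set is finite, so some walk attains the maximum. It need not start at a
      letter, which is why a path from a letter \<open>x\<close> is put in front below.\<close>
    have "Sup ?X \<in> ?X" using Max_in[OF fin False] False by (simp only: Sup_nat_def if_False)
    then obtain L w where w: "walk VV EE L w" "?D = card (circuits_in_walk VV EE L w)"
      unfolding max_circuits_in_walk_def by blast
    obtain e where e: "?D \<le> e" "G.low_bound (w 0) e" using G.lower_growth[OF D w(1)] w(2) by auto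
    have v: "w 0 \<in> VV" using w(1) by (simp add: walk_def zero_enat_def[symmetric])
    obtain x where x: "x \<in> nxt []" "(x, w 0) \<in> EE\<^sup>*" using reachable_from_letter[OF v] by blast
    obtain r where r: "\<And>n. n choose e \<le> G.twalks (card VV * n + r) x"
      using G.low_bound_path[OF x(2) e(2)] unfolding G.low_bound_def by blast
    have "card VV \<ge> 1" using v finite_vertices by (metis One_nat_def Suc_leI card_gt_0_iff empty_iff)
    then have "ereal (real e) \<le> limsup (\<lambda>n. elog n (enat (growth n)))"
      by (rule limsup_elog_ge[OF mono_growth]) (rule order.trans[OF r twalks_le_growth[OF x(1)]])
    moreover have "ereal (real ?D) \<le> ereal (real e)" using e(1) by simp
    ultimately show ?thesis by (rule order.trans[rotated])
  qed
qed

lemma limsup_growth_not_disjoint: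
  assumes "\<not> circuits_disjoint VV EE"
  shows "limsup (\<lambda>n. elog n (enat (growth n))) = \<infinity>"
proof -
  have "\<not> G.usucc" using assms G.circuits_disjoint_iff_usucc by simp
  then obtain v L where v: "v \<in> VV" "L \<ge> 1" "\<And>k. 2 ^ k \<le> G.nwalks (k * L) v"
    using G.not_usucc_growth by blast
  obtain x where x: "x \<in> nxt []" "(x, v) \<in> EE\<^sup>*" using reachable_from_letter[OF v(1)] by blast
  obtain p where p: "(x, v) \<in> EE ^^ p" using x(2) by (auto simp: rtrancl_power)
  \<comment> \<open>\<open>p\<close> is the length of the path from the letter to \<open>v\<close>,
    and \<open>Suc\<close> is due to \<open>twalks\<close> counting strictly shorter walks.\<close>
  have "2 ^ k \<le> growth (k * L + Suc p)" for k
  proof -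
    have "2 ^ k \<le> G.nwalks (k * L + p) x" using v(3)[of k] G.nwalks_path[OF p, of "k * L"] by linarith
    also have "\<dots> \<le> G.twalks (k * L + Suc p) x" unfolding G.twalks_def by (rule member_le_sum) auto
    also have "\<dots> \<le> growth (k * L + Suc p)" by (rule twalks_le_growth[OF x(1)])
    finally show ?thesis .
  qed
  then show ?thesis by (rule limsup_elog_infinite[OF mono_growth v(2)])
qed

end

theorem theorem1p1:
  fixes s :: nat
    and I :: "(nat list \<Rightarrow> 'k::field) set"
    and X :: "((nat list \<Rightarrow> 'k) set, 'p, (nat list \<Rightarrow> 'k) set set) resolution"
  assumes "monomial_ideal s I"
    and "projective_resolution (monomial_algebra s I) (trivial_module s I) X"
  shows "(circuits_disjoint (cps_vertices s I) (cps_edges s I) \<longrightarrow>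
      GKdim (yoneda_algebra (monomial_algebra s I) (trivial_module s I) X)
            (yoneda_component (monomial_algebra s I) (trivial_module s I) X)
        = ereal (real (max_circuits_in_walk (cps_vertices s I) (cps_edges s I))))
    \<and> (\<not> circuits_disjoint (cps_vertices s I) (cps_edges s I) \<longrightarrow>
      GKdim (yoneda_algebra (monomial_algebra s I) (trivial_module s I) X)
            (yoneda_component (monomial_algebra s I) (trivial_module s I) X) = \<infinity>)"
proof -
  obtain R where R: "R \<subseteq> words s" "finite R" "\<forall>r\<in>R. length r \<ge> 2"
    and I: "I = Idl\<^bsub>tensor_algebra s\<^esub> (mon ` R)"
    using assms(1) unfolding monomial_ideal_def by blast
  interpret mono_alg s I R
    by (rule mono_alg.intro[OF R(1,2) _ I]) (use R(3) in blast)
  show ?thesis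
    unfolding GKdim_eq_limsup[OF assms(2)]
    using limsup_growth_disjoint limsup_growth_not_disjoint by blast
qed

end
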